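(* Let $X=a(x,y)\frac{\partial}{\partial x}+b(x,y)\frac{\partial}{\partial y}$ be an algebraically integrable complex planar polynomial vector field such that $X\neq c\,\frac{\partial}{\partial y}$ and $X\neq c\,\frac{\partial}{\partial x}$ for all $c\in\mathbb{C}\setminus\{0\}$. Let $X'=b(y,x)\frac{\partial}{\partial x}+a(y,x)\frac{\partial}{\partial y}$ be the vector field obtained from $X$ by swapping the variables $x$ and $y$. Let $\delta_1=\delta_1(X)$ and $\delta_1'=\delta_1(X')$ be the nonnegative integers defined in the context, and let $d_x^0$ (respectively, $d_y^0$) be the degree of $g(x,0)$ (respectively, $g(0,y)$), where $g(x,y)$ is the generic algebraic invariant curve of $X$ associated to a primitive rational first integral of $X$. Then the Newton polytope $\mathrm{Newt}(X)$ is contained in the region $$\left\{(u,v)\in\mathbb{R}^2_{\ge 0}\mid u\le d_x^0+\delta_1 v\ \text{ and }\ v\le d_y^0+\delta_1' u\right\},$$ where $\mathbb{R}^2_{\ge 0}$ denotes the set of points of $\mathbb{R}^2$ with nonnegative coordinates.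
   Context: A complex planar polynomial vector field is $X=a(x,y)\frac{\partial}{\partial x}+b(x,y)\frac{\partial}{\partial y}$ with $a,b\in\mathbb{C}[x,y]$ coprime; it is also given by the $1$-form $\omega_X=b\,dx-a\,dy$. A rational first integral of $X$ is $f\in\mathbb{C}(x,y)\setminus\mathbb{C}$ with $X(f)=a f_x+b f_y=0$; $X$ is algebraically integrable if one exists. The degree of $f_1/f_2$ is $\max(\deg f_1,\deg f_2)$. A rational first integral $f=f_1/f_2$ is primitive if it is reduced ($f_1,f_2$ coprime) and noncomposite (not of the form $u\circ h$ with $h\in\mathbb{C}(x,y)\setminus\mathbb{C}$, $u\in\mathbb{C}(t)$, $\deg u\ge 2$); an algebraically integrable $X$ always has one. The generic algebraic invariant curve of $X$ associated to a primitive $f=f_1/f_2$ is $g(x,y)=\alpha f_1(x,y)+\beta f_2(x,y)\in\mathbb{C}(\alpha,\beta)[x,y]$, with $\alpha,\beta$ independent variables; write $g=\sum g_{ij}x^iy^j$. The Newton polytope $\mathrm{Newt}(X)$ is the convex hull in $\mathbb{R}^2$ of $\{(i,j)\mid g_{ij}\neq 0\}$; it does not depend on the choice of primitive $f$. Hirzebruch surface. For an integer $\delta\ge 0$, $\mathbb{F}_\delta$ is the quotient of $(\mathbb{C}^2\setminus\{0\})\times(\mathbb{C}^2\setminus\{0\})$, with coordinates $(X_0,X_1;Y_0,Y_1)$, by the action of $(\mathbb{C}^* )^2$ given by $(\lambda,\mu)\cdot(X_0,X_1;Y_0,Y_1)=(\lambda X_0,\lambda X_1;\mu Y_0,\lambda^{-\delta}\mu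 Y_1)$. The open sets $U_{ij}=\{X_i\neq 0,\ Y_j\neq 0\}$ cover $\mathbb{F}_\delta$ and are isomorphic to $\mathbb{C}^2$ (normalize $X_i=1$, $Y_j=1$). $\mathbb{C}^2$ is identified with $U_{00}$ by $x=X_1/X_0$, $y=X_0^\delta Y_1/Y_0$. In $U_{10}$, with coordinates $(s,t)=(X_0/X_1,\,X_1^\delta Y_1/Y_0)$, one has $x=1/s$, $y=s^\delta t$. The extension $\mathcal{F}_X^\delta$ of $X$ to $\mathbb{F}_\delta$ is the singular algebraic foliation with isolated singularities on $\mathbb{F}_\delta$ whose restriction to $U_{00}=\mathbb{C}^2$ is the foliation defined by $\omega_X$: in each chart $U_{ij}$ it is given by the polynomial $1$-form with coprime coefficients proportional (by a rational function) to the pull-back of $\omega_X$ under the change of coordinates. Dicritical singularities. Let $\mathcal{G}$ be a foliation with isolated singularities on a smooth surface, given near a point $p$, in local coordinates $(x,y)$ centred at $p$, by $\omega=P\,dx+Q\,dy$ ($P,Q$ without common factor). Let $\omega_m=p_m\,dx+q_m\,dy$ be the first nonvanishing jet of $\omega$ ($p_m,q_m$ homogeneous of degree $m$). Then $p$ is a singularity iff $m\ge 1$. A singularity $p$ is terminal dicritical if $x p_m+y q_m$ is the zero polynomial. It is simple if $m=1$ and the matrix $\begin{pmatrix}\partial q_1/\partial x&\partial q_1/\partial y\\-\partial p_1/\partial x&-\partial p_1/\partial y\end{pmatrix}$ has eigenvalues $\lambda_1,\lambda_2$ such that either $\lambda_1\lambda_2\ne 0$ and $\lambda_1/\lambda_2$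 is not a positive rational number, or $\lambda_1\lambda_2=0$ and $\lambda_1^2+\lambda_2^2\neq 0$. Nonsimple singularities are called ordinary. The strict transform of $\mathcal{G}$ under the blowup at $p$ is given by the pull-back of $\omega$ divided by the largest possible power of a local equation of the exceptional divisor. After finitely many blowups at ordinary singularities of $\mathcal{G}$ and of its successive strict transforms one reaches a foliation without ordinary singularities; the set of blowup centres is the singular configuration $\mathcal{C}_{\mathcal{G}}$. A point $q$ is infinitely near $p$ if $q=p$ or $q$ lies on an exceptional divisor created by successively blowing up $p$ and points over $p$. An ordinary singularity $p\in\mathcal{C}_{\mathcal{G}}$ is a dicritical singularity of $\mathcal{G}$ if there is $q\in\mathcal{C}_{\mathcal{G}}$ infinitely near $p$ (possibly $q=p$) which is a terminal dicritical singularity of the strict transform of $\mathcal{G}$ on the surface containing $q$. The integer $\delta_1(X)$. For $X$ algebraically integrable with $X\ne c\frac{\partial}{\partial y}$ for all $c\in\mathbb{C}\setminus\{0\}$, $\delta_1(X)$ is the minimum nonnegative integer $\delta$ such that the point $(0,1;1,0)\in\mathbb{F}_\delta$ is not a dicritical singularity of $\mathcal{F}_X^\delta$ (it exists; moreover for all $\delta>\delta_1(X)$ the point $(0,1;0,1)$ is the unique dicritical singularity of $\mathcal{F}_X^\delta$ on $X_0=0$). *)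

theory Defs
  imports
    "HOL-Analysis.Analysis"
    "HOL-Computational_Algebra.Computational_Algebra"
begin

section \<open>Bivariate polynomials and rational functions\<close>

text \<open>
  A polynomial in \<open>\<complex>[x,y]\<close> is a polynomial in \<open>y\<close> (outer variable) whose coefficients are
  polynomials in \<open>x\<close> (inner variable): the coefficient of \<open>x\<^sup>iy\<^sup>j\<close> is \<open>coeff (coeff p j) i\<close>.
  The same type serves for every chart, with the chart's own coordinates in place of \<open>x, y\<close>.
\<close>

type_synonym bpoly = "complex poly poly"
type_synonym ratfun = "complex poly poly fract"

definition polyX :: bpoly where "polyX = [:[:0, 1:]:]"
definition polyY :: bpoly where "polyY = [:0, 1:]"

definition const_bpoly :: "complex \<Rightarrow> bpoly" where "const_bpoly c = [:[:c:]:]"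

definition ratfun_of :: "bpoly \<Rightarrow> ratfun" where "ratfun_of p = Fract p 1"

definition const_ratfun :: "complex \<Rightarrow> ratfun" where "const_ratfun c = ratfun_of (const_bpoly c)"

text \<open>The argument \<open>emb\<close> embeds the constants into the ring in which \<open>p\<close> is evaluated.\<close>

definition eval2 :: "(complex \<Rightarrow> 'k::comm_ring_1) \<Rightarrow> bpoly \<Rightarrow> 'k \<Rightarrow> 'k \<Rightarrow> 'k" where
  "eval2 emb p u v = poly (map_poly (\<lambda>q. poly (map_poly emb q) u) p) v"

definition swap_vars :: "bpoly \<Rightarrow> bpoly" where
  "swap_vars p = eval2 const_bpoly p polyY polyX"

definition pdx :: "bpoly \<Rightarrow> bpoly" where "pdx p = map_poly pderiv p"
definition pdy :: "bpoly \<Rightarrow> bpoly" where "pdy p = pderiv p"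

lemma pderiv_sum_fun: "pderiv (\<Sum>i\<in>A. h i) = (\<Sum>i\<in>A. pderiv (h i :: complex poly))"
  by (induction A rule: infinite_finite_induct) (simp_all add: pderiv_add)

lemma pdx_mult: "pdx (p * q) = pdx p * q + p * pdx q"
proof (rule poly_eqI)
  fix n
  have "coeff (pdx (p * q)) n
      = (\<Sum>i\<le>n. pderiv (coeff p i * coeff q (n - i)))"
    by (simp add: pdx_def coeff_map_poly coeff_mult pderiv_sum_fun)
  also have "\<dots> = (\<Sum>i\<le>n. pderiv (coeff p i) * coeff q (n - i))
                + (\<Sum>i\<le>n. coeff p i * pderiv (coeff q (n - i)))"
    by (simp add: pderiv_mult sum.distrib algebra_simps)
  also have "\<dots> = coeff (pdx p * q + p * pdx q) n"
    by (simp add: pdx_def coeff_map_poly coeff_mult)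
  finally show "coeff (pdx (p * q)) n = coeff (pdx p * q + p * pdx q) n" .
qed

lemma pdy_mult: "pdy (p * q) = pdy p * q + p * pdy q"
  by (simp add: pdy_def pderiv_mult algebra_simps)

lemma quotient_rule_wd:
  fixes p q p' q' :: "'a::idom"
  assumes mult: "\<And>u v. D (u * v) = D u * v + u * D v"
    and eq: "p * q' = p' * q"
  shows "(D p * q - p * D q) * q'\<^sup>2 = (D p' * q' - p' * D q') * q\<^sup>2"
proof -
  have "D (p * q') = D (p' * q)"
    using eq by simp
  then have "D p * q' + p * D q' = D p' * q + p' * D q"
    by (simp add: mult)
  with eq show ?thesis
    by algebra
qed

definition rat_dx :: "ratfun \<Rightarrow> ratfun" where
  "rat_dx f = (THE g. \<exists>p q. q \<noteq> 0 \<and> f = Fract p q \<and> g = Fract (pdx p * q - p * pdx q) (q\<^sup>2))"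

definition rat_dy :: "ratfun \<Rightarrow> ratfun" where
  "rat_dy f = (THE g. \<exists>p q. q \<noteq> 0 \<and> f = Fract p q \<and> g = Fract (pdy p * q - p * pdy q) (q\<^sup>2))"

lemma rat_dx_Fract:
  assumes "q \<noteq> 0"
  shows "rat_dx (Fract p q) = Fract (pdx p * q - p * pdx q) (q\<^sup>2)"
  unfolding rat_dx_def
proof (rule the_equality)
  show "\<exists>p' q'. q' \<noteq> 0 \<and> Fract p q = Fract p' q' \<and>
      Fract (pdx p * q - p * pdx q) (q\<^sup>2) = Fract (pdx p' * q' - p' * pdx q') (q'\<^sup>2)"
    using assms by blast
  show "g = Fract (pdx p * q - p * pdx q) (q\<^sup>2)"
    if "\<exists>p' q'. q' \<noteq> 0 \<and> Fract p q = Fract p' q' \<and> g = Fract (pdx p' * q' - p' * pdx q') (q'\<^sup>2)" for g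
    using that assms quotient_rule_wd[of pdx, OF pdx_mult] by (auto simp: eq_fract)
qed

lemma rat_dy_Fract:
  assumes "q \<noteq> 0"
  shows "rat_dy (Fract p q) = Fract (pdy p * q - p * pdy q) (q\<^sup>2)"
  unfolding rat_dy_def
proof (rule the_equality)
  show "\<exists>p' q'. q' \<noteq> 0 \<and> Fract p q = Fract p' q' \<and>
      Fract (pdy p * q - p * pdy q) (q\<^sup>2) = Fract (pdy p' * q' - p' * pdy q') (q'\<^sup>2)"
    using assms by blast
  show "g = Fract (pdy p * q - p * pdy q) (q\<^sup>2)"
    if "\<exists>p' q'. q' \<noteq> 0 \<and> Fract p q = Fract p' q' \<and> g = Fract (pdy p' * q' - p' * pdy q') (q'\<^sup>2)" for g
    using that assms quotient_rule_wd[of pdy, OF pdy_mult] by (auto simp: eq_fract)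
qed


section \<open>Vector fields, rational first integrals, Newton polytope\<close>

text \<open>The pair \<open>(a, b)\<close> stands for \<open>a \<partial>/\<partial>x + b \<partial>/\<partial>y\<close>.\<close>

type_synonym vfield = "bpoly \<times> bpoly"

definition vector_field :: "vfield \<Rightarrow> bool" where
  "vector_field X \<longleftrightarrow> coprime (fst X) (snd X)"

definition swap_field :: "vfield \<Rightarrow> vfield" where
  "swap_field X = (swap_vars (snd X), swap_vars (fst X))"

definition nonconstant :: "ratfun \<Rightarrow> bool" where
  "nonconstant f \<longleftrightarrow> f \<notin> range const_ratfun"

definition rational_first_integral :: "vfield \<Rightarrow> ratfun \<Rightarrow> bool" where
  "rational_first_integral X f \<longleftrightarrow> nonconstant f \<and>
     ratfun_of (fst X) * rat_dx f + ratfun_of (snd X) * rat_dy f = 0"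

definition algebraically_integrable :: "vfield \<Rightarrow> bool" where
  "algebraically_integrable X \<longleftrightarrow> (\<exists>f. rational_first_integral X f)"

definition noncomposite :: "ratfun \<Rightarrow> bool" where
  "noncomposite f \<longleftrightarrow>
     \<not> (\<exists>(h::ratfun) (u1::complex poly) (u2::complex poly).
          nonconstant h \<and> u2 \<noteq> 0 \<and> coprime u1 u2 \<and> max (degree u1) (degree u2) \<ge> 2 \<and>
          f = poly (map_poly const_ratfun u1) h / poly (map_poly const_ratfun u2) h)"

definition primitive_first_integral :: "vfield \<Rightarrow> bpoly \<Rightarrow> bpoly \<Rightarrow> bool" where
  "primitive_first_integral X f1 f2 \<longleftrightarrow> f2 \<noteq> 0 \<and> coprime f1 f2 \<and>
     rational_first_integral X (Fract f1 f2) \<and> noncomposite (Fract f1 f2)"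

text \<open>
  \<open>\<alpha> f\<^sub>1 + \<beta> f\<^sub>2\<close> as an element of \<open>\<complex>(\<alpha>,\<beta>)[x,y]\<close>; the field \<open>\<complex>(\<alpha>,\<beta>)\<close> of coefficients is
  \<open>ratfun\<close>, with \<open>\<alpha>\<close> and \<open>\<beta>\<close> its two generators \<open>polyX\<close> and \<open>polyY\<close>.
\<close>

definition generic_curve :: "bpoly \<Rightarrow> bpoly \<Rightarrow> ratfun poly poly" where
  "generic_curve f1 f2 =
     smult [:ratfun_of polyX:] (map_poly (map_poly const_ratfun) f1) +
     smult [:ratfun_of polyY:] (map_poly (map_poly const_ratfun) f2)"

definition newton_polytope :: "'k::zero poly poly \<Rightarrow> (real \<times> real) set" where
  "newton_polytope g = convex hull {(real i, real j) |i j. coeff (coeff g j) i \<noteq> 0}"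

text \<open>The degrees of \<open>g(x,0)\<close> and of \<open>g(0,y)\<close>.\<close>

definition deg_x0 :: "'k::comm_semiring_0 poly poly \<Rightarrow> nat" where
  "deg_x0 g = degree (poly g 0)"

definition deg_y0 :: "'k::comm_semiring_0 poly poly \<Rightarrow> nat" where
  "deg_y0 g = degree (map_poly (\<lambda>q. poly q 0) g)"


section \<open>Polynomial 1-forms and their pull-backs\<close>

text \<open>The pair \<open>(P, Q)\<close> stands for \<open>P dx + Q dy\<close>.\<close>

type_synonym form = "bpoly \<times> bpoly"

definition form_of :: "vfield \<Rightarrow> form" where
  "form_of X = (snd X, - fst X)"

text \<open>
  The pull-back of \<open>P dx + Q dy\<close> under \<open>(x, y) = (\<phi>, \<psi>)\<close>, where \<open>\<phi>, \<psi>\<close> are elements of a ring with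
  constants embedded by \<open>emb\<close> and partial derivatives \<open>D1, D2\<close>.
\<close>

definition pullback ::
  "(complex \<Rightarrow> 'k::comm_ring_1) \<Rightarrow> ('k \<Rightarrow> 'k) \<Rightarrow> ('k \<Rightarrow> 'k) \<Rightarrow> 'k \<times> 'k \<Rightarrow> form \<Rightarrow> 'k \<times> 'k" where
  "pullback emb D1 D2 m \<omega> =
     (case m of (\<phi>, \<psi>) \<Rightarrow> case \<omega> of (P, Q) \<Rightarrow>
        (eval2 emb P \<phi> \<psi> * D1 \<phi> + eval2 emb Q \<phi> \<psi> * D1 \<psi>,
         eval2 emb P \<phi> \<psi> * D2 \<phi> + eval2 emb Q \<phi> \<psi> * D2 \<psi>))"

abbreviation pullback_poly :: "bpoly \<times> bpoly \<Rightarrow> form \<Rightarrow> form" where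
  "pullback_poly \<equiv> pullback const_bpoly pdx pdy"

abbreviation pullback_rat :: "ratfun \<times> ratfun \<Rightarrow> form \<Rightarrow> ratfun \<times> ratfun" where
  "pullback_rat \<equiv> pullback const_ratfun rat_dx rat_dy"


section \<open>Singularities of a foliation germ\<close>

text \<open>Here a form is always considered near the origin of its coordinates.\<close>

definition hom_part :: "nat \<Rightarrow> bpoly \<Rightarrow> bpoly" where
  "hom_part m p = (\<Sum>i\<le>m. monom (monom (coeff (coeff p (m - i)) i) i) (m - i))"

definition jet_order :: "form \<Rightarrow> nat" where
  "jet_order \<omega> = (LEAST m. hom_part m (fst \<omega>) \<noteq> 0 \<or> hom_part m (snd \<omega>) \<noteq> 0)"

definition jet1 :: "form \<Rightarrow> bpoly" where "jet1 \<omega> = hom_part (jet_order \<omega>) (fst \<omega>)"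
definition jet2 :: "form \<Rightarrow> bpoly" where "jet2 \<omega> = hom_part (jet_order \<omega>) (snd \<omega>)"

definition singularity :: "form \<Rightarrow> bool" where
  "singularity \<omega> \<longleftrightarrow> jet_order \<omega> \<ge> 1"

definition terminal_dicritical :: "form \<Rightarrow> bool" where
  "terminal_dicritical \<omega> \<longleftrightarrow> singularity \<omega> \<and> polyX * jet1 \<omega> + polyY * jet2 \<omega> = 0"

definition at_origin :: "bpoly \<Rightarrow> complex" where
  "at_origin p = poly (poly p 0) 0"

definition linear_part :: "form \<Rightarrow> complex^2^2" where
  "linear_part \<omega> = vector
     [vector [at_origin (pdx (jet2 \<omega>)), at_origin (pdy (jet2 \<omega>))],
      vector [- at_origin (pdx (jet1 \<omega>)), - at_origin (pdy (jet1 \<omega>))]]"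

text \<open>The two eigenvalues, with multiplicity, are the roots of the characteristic polynomial.\<close>

definition eigenvalue_pair :: "complex^2^2 \<Rightarrow> complex \<Rightarrow> complex \<Rightarrow> bool" where
  "eigenvalue_pair A l1 l2 \<longleftrightarrow> (\<forall>z. det (mat z - A) = (z - l1) * (z - l2))"

definition positive_rational :: "complex \<Rightarrow> bool" where
  "positive_rational z \<longleftrightarrow> (\<exists>r::rat. r > 0 \<and> z = of_rat r)"

definition simple_singularity :: "form \<Rightarrow> bool" where
  "simple_singularity \<omega> \<longleftrightarrow> jet_order \<omega> = 1 \<and>
     (\<exists>l1 l2. eigenvalue_pair (linear_part \<omega>) l1 l2 \<and>
        (l1 * l2 \<noteq> 0 \<and> \<not> positive_rational (l1 / l2) \<or>
         l1 * l2 = 0 \<and> l1\<^sup>2 + l2\<^sup>2 \<noteq> 0))"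

definition ordinary_singularity :: "form \<Rightarrow> bool" where
  "ordinary_singularity \<omega> \<longleftrightarrow> singularity \<omega> \<and> \<not> simple_singularity \<omega>"


section \<open>Blowups, singular configuration, dicritical singularities\<close>

text \<open>
  The points of the exceptional divisor of the blowup of the origin are the directions at the
  origin: \<open>Slope c\<close> is the direction \<open>y = c x\<close>, and \<open>Vertical\<close> the direction \<open>x = 0\<close>.  Near each of
  them the blowup map is written in coordinates centred at that point.
\<close>

datatype direction = Slope complex | Vertical

fun blowup_map :: "direction \<Rightarrow> bpoly \<times> bpoly" where
  "blowup_map (Slope c) = (polyX, polyX * (polyY + const_bpoly c))"
| "blowup_map Vertical = (polyX * polyY, polyY)"

fun exceptional_eq :: "direction \<Rightarrow> bpoly" where
  "exceptional_eq (Slope c) = polyX"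
| "exceptional_eq Vertical = polyY"

definition divide_out :: "bpoly \<Rightarrow> form \<Rightarrow> form" where
  "divide_out e \<omega> =
     (let k = (GREATEST k. e ^ k dvd fst \<omega> \<and> e ^ k dvd snd \<omega>)
      in (fst \<omega> div e ^ k, snd \<omega> div e ^ k))"

definition strict_transform :: "direction \<Rightarrow> form \<Rightarrow> form" where
  "strict_transform e \<omega> = divide_out (exceptional_eq e) (pullback_poly (blowup_map e) \<omega>)"

text \<open>
  A point infinitely near the origin is a finite sequence of directions: each one is the next
  point, on the exceptional divisor of the blowup of the preceding one.  The empty sequence is the
  origin itself.  The following is the strict transform of the foliation around such a point.
\<close>

fun transform_at :: "form \<Rightarrow> direction list \<Rightarrow> form" where
  "transform_at \<omega> [] = \<omega>"
| "transform_at \<omega> (e # es) = transform_at (strict_transform e \<omega>) es"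

text \<open>
  The points of the singular configuration that are infinitely near the origin: a point is blown
  up iff it is an ordinary singularity and all the points it lies over have been blown up.
\<close>

definition singular_configuration :: "form \<Rightarrow> direction list set" where
  "singular_configuration \<omega> =
     {es. \<forall>n\<le>length es. ordinary_singularity (transform_at \<omega> (take n es))}"

definition dicritical :: "form \<Rightarrow> bool" where
  "dicritical \<omega> \<longleftrightarrow> [] \<in> singular_configuration \<omega> \<and>
     (\<exists>es\<in>singular_configuration \<omega>. terminal_dicritical (transform_at \<omega> es))"


section \<open>The extended foliation on a Hirzebruch surface\<close>

text \<open>
  A point of \<open>\<FF>\<^sub>\<delta>\<close> is the orbit of a quadruple \<open>(X0, X1, Y0, Y1)\<close> with \<open>(X0, X1) \<noteq> 0\<close> and
  \<open>(Y0, Y1) \<noteq> 0\<close>.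
\<close>

type_synonym quad = "complex \<times> complex \<times> complex \<times> complex"

fun hirzebruch_point :: "nat \<Rightarrow> quad \<Rightarrow> quad set" where
  "hirzebruch_point \<delta> (X0, X1, Y0, Y1) =
     {(l * X0, l * X1, m * Y0, m * Y1 / l ^ \<delta>) |l m. l \<noteq> 0 \<and> m \<noteq> 0}"

text \<open>
  The chart \<open>U\<^sub>i\<^sub>j\<close> (\<open>X\<^sub>i \<noteq> 0\<close>, \<open>Y\<^sub>j \<noteq> 0\<close>), with \<open>i, j \<in> {0, 1}\<close>, and its coordinates: those obtained by
  normalizing \<open>X\<^sub>i = 1\<close>, \<open>Y\<^sub>j = 1\<close>.
\<close>

fun in_chart :: "nat \<Rightarrow> nat \<Rightarrow> quad \<Rightarrow> bool" where
  "in_chart i j (X0, X1, Y0, Y1) \<longleftrightarrow>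
     (if i = 0 then X0 else X1) \<noteq> 0 \<and> (if j = 0 then Y0 else Y1) \<noteq> 0"

fun chart_coords :: "nat \<Rightarrow> nat \<Rightarrow> nat \<Rightarrow> quad \<Rightarrow> complex \<times> complex" where
  "chart_coords \<delta> i j (X0, X1, Y0, Y1) =
     (let A = (if i = 0 then X0 else X1); B = (if i = 0 then X1 else X0)
      in (B / A, if j = 0 then A ^ \<delta> * Y1 / Y0 else Y0 / (A ^ \<delta> * Y1)))"

text \<open>
  The change of coordinates from \<open>U\<^sub>i\<^sub>j\<close>, with coordinates \<open>(s, t)\<close>, to \<open>U\<^sub>0\<^sub>0 = \<complex>\<^sup>2\<close>: the rational
  functions \<open>x\<close> and \<open>y\<close> of \<open>(s, t)\<close>.
\<close>

definition chart_change :: "nat \<Rightarrow> nat \<Rightarrow> nat \<Rightarrow> ratfun \<times> ratfun" where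
  "chart_change \<delta> i j =
     (let s = ratfun_of polyX; t = ratfun_of polyY
      in (if i = 0 then s else 1 / s,
          (if i = 0 then 1 else s ^ \<delta>) * (if j = 0 then t else 1 / t)))"

definition extended_form :: "nat \<Rightarrow> vfield \<Rightarrow> nat \<Rightarrow> nat \<Rightarrow> form \<Rightarrow> bool" where
  "extended_form \<delta> X i j \<omega> \<longleftrightarrow> coprime (fst \<omega>) (snd \<omega>) \<and>
     (\<exists>r::ratfun. r \<noteq> 0 \<and> pullback_rat (chart_change \<delta> i j) (form_of X) =
        (r * ratfun_of (fst \<omega>), r * ratfun_of (snd \<omega>)))"

definition centre_at :: "complex \<times> complex \<Rightarrow> form \<Rightarrow> form" where
  "centre_at c = pullback_poly (polyX + const_bpoly (fst c), polyY + const_bpoly (snd c))"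

text \<open>
  The existential quantifiers are harmless: \<open>\<omega>\<close> is unique up to a nonzero constant, and being
  dicritical does not depend on the representative nor on the chart.
\<close>

definition dicritical_point :: "nat \<Rightarrow> vfield \<Rightarrow> quad set \<Rightarrow> bool" where
  "dicritical_point \<delta> X p \<longleftrightarrow>
     (\<exists>q\<in>p. \<exists>i\<in>{0, 1}. \<exists>j\<in>{0, 1}. \<exists>\<omega>.
        in_chart i j q \<and> extended_form \<delta> X i j \<omega> \<and>
        dicritical (centre_at (chart_coords \<delta> i j q) \<omega>))"

text \<open>
  The minimum exists if \<open>X\<close> is algebraically integrable and not of the form \<open>c \<partial>/\<partial>y\<close>.
\<close>

definition delta1 :: "vfield \<Rightarrow> nat" where
  "delta1 X = (LEAST \<delta>. \<not> dicritical_point \<delta> X (hirzebruch_point \<delta> (0, 1, 1, 0)))"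

end

theory Submission
  imports Defs "HOL-Computational_Algebra.Field_as_Ring"
begin

text \<open>
  In the chart \<open>U\<^sub>1\<^sub>0\<close> the monomial \<open>x\<^sup>i y\<^sup>j\<close> becomes \<open>s\<close> to the power \<open>\<delta> j - i\<close> times \<open>t\<^sup>j\<close>.  If the
  point \<open>(0,1;1,0)\<close> is not a base point of the pencil spanned by \<open>f\<^sub>1\<close> and \<open>f\<^sub>2\<close>, then, after removal of
  the common power of \<open>s\<close>, the generic member does not vanish at the origin.  So the smallest value of
  \<open>\<delta> j - i\<close> on the support is attained on the row \<open>j = 0\<close>, which is the first inequality for
  \<open>\<delta> = \<delta>\<^sub>1\<close>; the second one follows by swapping the variables.

  It remains to see that the dicritical points are exactly the base points.  The colength of the
  ideal of the pencil drops at each blowup of a base point.  When the exceptional divisor is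
  invariant, the first integral is constant on it, hence a base point below yields one on the
  divisor; so some terminal dicritical point is reached.  Nonsingular points and simple
  singularities reproduce themselves under blowup, always with invariant exceptional divisor, so the
  same descent shows that they are never base points.  Conversely, off the base points every
  exceptional divisor is invariant.
\<close>

section \<open>Evaluation homomorphisms\<close>

text \<open>The obstacle is that \<open>dicritical\<close> is defined by a tree of blowups which
  grows only through ordinary singularities, whereas a base point is a property of two polynomials.
  The link is order counting for the contraction \<open>radial\<close> of a form with the Euler
  field x d/dx + y d/dy. If the contraction of P dx + Q dy has order exactly one more than the form,
  comparison with the contraction of g df - f dg shows that the parts of f and g of their common
  order m \<ge> 1 have zero Wronskian. Over the complex numbers they then share a zero on the
  projective line, and this is the base point on the exceptional divisor. Off the base points the
  same count shows that the contraction always has this order. Everything is done with polynomials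
  in coordinates centred at the current point. The local ring appears through denominators
  \<open>s\<close> with \<open>at_origin s \<noteq> 0\<close>, and of the colength only an upper
  bound is carried along, since a drop by one per blowup is all that the descent uses. As \<alpha>
  and \<beta> are independent, the support of g is the union of the supports of \<open>f1\<close>
  and \<open>f2\<close>, so g is replaced by this pair until the end.\<close>

locale ring_hom_1 =
  fixes h :: "'a::comm_ring_1 \<Rightarrow> 'b::comm_ring_1"
  assumes one [simp]: "h 1 = 1"
    and add [simp]: "h (a + b) = h a + h b"
    and mult [simp]: "h (a * b) = h a * h b"
begin

lemma zero [simp]: "h 0 = 0"
  using add[of 0 0] by simp

lemma uminus [simp]: "h (- a) = - h a"
  using add[of a "- a"] by (simp add: eq_neg_iff_add_eq_0 add.commute)

lemma diff [simp]: "h (a - b) = h a - h b"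
  using add[of a "- b"] by simp

lemma power [simp]: "h (a ^ n) = h a ^ n"
  by (induction n) simp_all

lemma sum: "h (\<Sum>i\<in>A. f i) = (\<Sum>i\<in>A. h (f i))"
  by (induction A rule: infinite_finite_induct) simp_all

lemma map_poly_pCons [simp]: "map_poly h (pCons a p) = pCons (h a) (map_poly h p)"
  by (rule map_poly_pCons) simp

lemma poly_map_poly: "ring_hom_1 (\<lambda>p. poly (map_poly h p) u)"
proof
  show add: "poly (map_poly h (p + q)) u = poly (map_poly h p) u + poly (map_poly h q) u" for p q
    by (induction p q rule: poly_induct2) (simp_all add: algebra_simps)
  have smult: "poly (map_poly h (smult a q)) u = h a * poly (map_poly h q) u" for a q
    by (induction q) (simp_all add: algebra_simps)
  show "poly (map_poly h (p * q)) u = poly (map_poly h p) u * poly (map_poly h q) u" for p q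
    by (induction p) (simp_all add: add smult algebra_simps)
qed (simp add: map_poly_1')

end

lemma ring_hom_1_id: "ring_hom_1 (\<lambda>x. x)"
  by unfold_locales simp_all

lemma ring_hom_1_comp:
  assumes "ring_hom_1 f" "ring_hom_1 g"
  shows "ring_hom_1 (\<lambda>x. f (g x))"
proof -
  interpret f: ring_hom_1 f by fact
  interpret g: ring_hom_1 g by fact
  show ?thesis by unfold_locales simp_all
qed

lemma ring_hom_1_const_poly: "ring_hom_1 (\<lambda>c. [:c:])"
  by unfold_locales (simp_all add: one_pCons mult.commute)

interpretation const_bpoly: ring_hom_1 const_bpoly
  unfolding const_bpoly_def using ring_hom_1_comp[OF ring_hom_1_const_poly ring_hom_1_const_poly] .

interpretation ratfun_of: ring_hom_1 ratfun_of
  by unfold_locales (simp_all add: ratfun_of_def One_fract_def)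

interpretation const_ratfun: ring_hom_1 const_ratfun
  unfolding const_ratfun_def by (rule ring_hom_1_comp) unfold_locales

interpretation at_origin: ring_hom_1 at_origin
  by unfold_locales (simp_all add: at_origin_def)

text \<open>Blowups, the chart change, the swap and evaluation at a point are all
  \<open>eval2\<close> with different targets and embeddings of the constants; their algebra comes
  from here.\<close>

lemma ring_hom_1_eval2:
  assumes "ring_hom_1 emb"
  shows "ring_hom_1 (\<lambda>p. eval2 emb p u v)"
  unfolding eval2_def
  by (intro ring_hom_1.poly_map_poly assms)

interpretation eval2_bpoly: ring_hom_1 "\<lambda>p. eval2 const_bpoly p u v" for u v
  by (rule ring_hom_1_eval2) unfold_locales

interpretation eval2_complex: ring_hom_1 "\<lambda>p. eval2 (\<lambda>c. c) p u v" for u v :: complex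
  by (rule ring_hom_1_eval2[OF ring_hom_1_id])

interpretation eval2_ratfun: ring_hom_1 "\<lambda>p. eval2 const_ratfun p u v" for u v
  by (rule ring_hom_1_eval2) unfold_locales

interpretation eval2_poly: ring_hom_1 "\<lambda>p. eval2 (\<lambda>c. [:c:]) p u v" for u v :: "complex poly"
  by (rule ring_hom_1_eval2[OF ring_hom_1_const_poly])

lemma eval2_gen [simp]:
  assumes "ring_hom_1 emb"
  shows "eval2 emb (const_bpoly c) u v = emb c" "eval2 emb polyX u v = u" "eval2 emb polyY u v = v"
proof -
  interpret ring_hom_1 emb by fact
  interpret E: ring_hom_1 "\<lambda>q. poly (map_poly emb q) u" by (rule poly_map_poly)
  show "eval2 emb (const_bpoly c) u v = emb c" "eval2 emb polyX u v = u" "eval2 emb polyY u v = v"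
    by (simp_all add: eval2_def const_bpoly_def polyX_def polyY_def map_poly_1')
qed

lemmas [simp] = eval2_gen[OF ring_hom_1_id] eval2_gen[OF ring_hom_1_const_poly]
  eval2_gen[OF const_bpoly.ring_hom_1_axioms] eval2_gen[OF const_ratfun.ring_hom_1_axioms]

lemma bpoly_linear_induct [case_names const add multX multY]:
  fixes p :: bpoly
  assumes const: "\<And>c. P (const_bpoly c)" and add: "\<And>p q. P p \<Longrightarrow> P q \<Longrightarrow> P (p + q)"
    and multX: "\<And>p. P p \<Longrightarrow> P (polyX * p)" and multY: "\<And>p. P p \<Longrightarrow> P (polyY * p)"
  shows "P p"
proof (induction p)
  case 0
  show ?case using const[of 0] by (simp add: const_bpoly_def)
next
  case (pCons q p)
  have "P [:q:]"
  proof (induction q)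
    case 0
    show ?case using const[of 0] by (simp add: const_bpoly_def)
  next
    case (pCons a q)
    have "[:pCons a q:] = const_bpoly a + polyX * [:q:]"
      by (simp add: const_bpoly_def polyX_def)
    then show ?case using add const multX pCons by metis
  qed
  moreover have "pCons q p = [:q:] + polyY * p"
    by (simp add: polyY_def)
  ultimately show ?case using add multY pCons by metis
qed

lemma bpoly_induct [case_names const X Y add mult]:
  fixes p :: bpoly
  assumes "\<And>c. P (const_bpoly c)" "P polyX" "P polyY"
    and "\<And>p q. P p \<Longrightarrow> P q \<Longrightarrow> P (p + q)" "\<And>p q. P p \<Longrightarrow> P q \<Longrightarrow> P (p * q)"
  shows "P p"
  by (induction p rule: bpoly_linear_induct) (use assms in auto)

lemma ring_hom_1_bpoly_eqI:
  assumes "ring_hom_1 f" "ring_hom_1 g"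
    and "\<And>c. f (const_bpoly c) = g (const_bpoly c)" "f polyX = g polyX" "f polyY = g polyY"
  shows "f p = g p"
proof -
  interpret f: ring_hom_1 f by fact
  interpret g: ring_hom_1 g by fact
  show ?thesis by (induction p rule: bpoly_induct) (simp_all add: assms)
qed

lemma ring_hom_1_apply_eval2:
  assumes "ring_hom_1 h" "ring_hom_1 emb"
  shows "h (eval2 emb p u v) = eval2 (\<lambda>c. h (emb c)) p (h u) (h v)"
proof -
  note hom = ring_hom_1_comp[OF assms(1) ring_hom_1_eval2[OF assms(2)], of u v]
    and emb = ring_hom_1_comp[OF assms]
  show ?thesis
    by (rule ring_hom_1_bpoly_eqI[OF hom ring_hom_1_eval2[OF emb]]) (simp_all add: assms emb)
qed

lemma eval2_id: "eval2 const_bpoly p polyX polyY = p"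
  by (rule ring_hom_1_bpoly_eqI[where f = "\<lambda>p. eval2 const_bpoly p polyX polyY" and g = "\<lambda>p. p"])
    (unfold_locales, simp_all)

lemma at_origin_gen [simp]:
  "at_origin (const_bpoly c) = c" "at_origin polyX = 0" "at_origin polyY = 0"
  by (simp_all add: at_origin_def const_bpoly_def polyX_def polyY_def)

lemma at_origin_eval2 [simp]:
  "at_origin (eval2 const_bpoly p u v) = eval2 (\<lambda>c. c) p (at_origin u) (at_origin v)"
  by (subst ring_hom_1_apply_eval2) (unfold_locales, simp)

lemma eval2_origin [simp]: "eval2 (\<lambda>c. c) p 0 0 = at_origin p"
  by (rule ring_hom_1_bpoly_eqI[where f = "\<lambda>p. eval2 (\<lambda>c. c) p 0 0"])
    (unfold_locales, simp_all)

section \<open>Coefficients and partial derivatives\<close>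

abbreviation coeff2 :: "bpoly \<Rightarrow> nat \<Rightarrow> nat \<Rightarrow> complex" where
  "coeff2 p i j \<equiv> coeff (coeff p j) i"

lemma bpoly_eqI: "(\<And>i j. coeff2 p i j = coeff2 q i j) \<Longrightarrow> p = q"
  by (intro poly_eqI) auto

lemma coeff2_mult_const [simp]: "coeff2 (const_bpoly c * p) i j = c * coeff2 p i j"
  by (simp add: const_bpoly_def)

lemma polyX_mult: "polyX * p = map_poly (pCons 0) p"
  by (rule poly_eqI) (simp add: polyX_def coeff_map_poly)

lemma coeff2_mult_X: "coeff2 (polyX * p) i j = (if i = 0 then 0 else coeff2 p (i - 1) j)"
  by (cases i) (simp_all add: polyX_mult coeff_map_poly)

lemma coeff2_mult_Y: "coeff2 (polyY * p) i j = (if j = 0 then 0 else coeff2 p i (j - 1))"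
  by (cases j) (simp_all add: polyY_def)

lemma coeff2_mult_X_power: "coeff2 (polyX ^ n * p) i j = (if i < n then 0 else coeff2 p (i - n) j)"
  by (induction n arbitrary: i) (auto simp: coeff2_mult_X mult.assoc)

lemma coeff2_mult_Y_power: "coeff2 (polyY ^ n * p) i j = (if j < n then 0 else coeff2 p i (j - n))"
  by (induction n arbitrary: j) (auto simp: coeff2_mult_Y mult.assoc)

lemma coeff2_const: "coeff2 (const_bpoly c) i j = (if i = 0 \<and> j = 0 then c else 0)"
  by (auto simp: const_bpoly_def coeff_pCons split: nat.splits)

lemma at_origin_coeff2: "at_origin p = coeff2 p 0 0"
  by (simp add: at_origin_def poly_0_coeff_0)

lemma coeff2_pdx: "coeff2 (pdx p) i j = of_nat (Suc i) * coeff2 p (Suc i) j"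
  by (simp add: pdx_def coeff_map_poly coeff_pderiv)

lemma coeff2_pdy: "coeff2 (pdy p) i j = of_nat (Suc j) * coeff2 p i (Suc j)"
  by (simp only: pdy_def coeff_pderiv of_nat_mult_conv_smult) (simp add: of_nat_poly)

lemma coeff2_monom: "coeff2 (monom (monom c i) j) k l = (if i = k \<and> j = l then c else 0)"
  by simp

lemma monom2_eq: "monom (monom c i) j = const_bpoly c * polyX ^ i * polyY ^ j"
  by (rule bpoly_eqI)
    (auto simp: mult.commute[of _ "polyY ^ j"] mult.commute[of _ "polyX ^ i"]
      coeff2_mult_Y_power coeff2_mult_X_power coeff2_const)

lemma polyX_nonzero [simp]: "polyX \<noteq> 0" and polyY_nonzero [simp]: "polyY \<noteq> 0"
  by (simp_all add: polyX_def polyY_def)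

lemma coeff2_gen: "coeff2 polyX i j = (if i = 1 \<and> j = 0 then 1 else 0)"
  "coeff2 polyY i j = (if i = 0 \<and> j = 1 then 1 else 0)"
  by (auto simp: polyX_def polyY_def coeff_pCons split: nat.splits)

lemma pd_gen [simp]:
  "pdx (const_bpoly c) = 0" "pdy (const_bpoly c) = 0"
  "pdx polyX = 1" "pdy polyX = 0" "pdx polyY = 0" "pdy polyY = 1"
  by (auto simp: pdx_def pdy_def const_bpoly_def polyX_def polyY_def map_poly_pCons pderiv_pCons one_pCons)

locale derivation =
  fixes D :: "'k::comm_ring_1 \<Rightarrow> 'k"
  assumes add [simp]: "D (a + b) = D a + D b"
    and mult: "D (a * b) = D a * b + a * D b"
begin

lemma zero [simp]: "D 0 = 0"
  using add[of 0 0] by simp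

lemma diff [simp]: "D (a - b) = D a - D b"
  using add[of "a - b" b] by (simp add: algebra_simps)

lemma one [simp]: "D 1 = 0"
  using mult[of 1 1] by simp

lemma chain_rule:
  assumes emb: "ring_hom_1 emb" and const: "\<And>c. D (emb c) = 0"
  shows "D (eval2 emb p u v) = eval2 emb (pdx p) u v * D u + eval2 emb (pdy p) u v * D v"
proof -
  interpret E: ring_hom_1 "\<lambda>p. eval2 emb p u v" by (rule ring_hom_1_eval2[OF emb])
  have [simp]: "pdx (p + q) = pdx p + pdx q" "pdy (p + q) = pdy p + pdy q" for p q
    by (auto intro!: bpoly_eqI simp: coeff2_pdx coeff2_pdy algebra_simps)
  show ?thesis
    by (induction p rule: bpoly_induct)
      (simp_all add: emb const mult pdx_mult pdy_mult algebra_simps)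
qed

text \<open>The quotient a/b does not see a common factor w, so the numerator of its derivative only
  picks up w squared. This lets common powers of the exceptional equation, or of s at infinity, be
  removed from a pencil.\<close>

lemma scaled_wronskian:
  "D (w * a) * (w * b) - w * a * D (w * b) = w\<^sup>2 * (D a * b - a * D b)"
  by (simp add: mult algebra_simps power2_eq_square)

end

interpretation pdx: derivation pdx
  by unfold_locales (auto intro!: bpoly_eqI simp: coeff2_pdx algebra_simps pdx_mult)

interpretation pdy: derivation pdy
  by unfold_locales (auto intro!: bpoly_eqI simp: coeff2_pdy algebra_simps pdy_mult)

section \<open>Homogeneous parts\<close>

lemma coeff2_hom_part: "coeff2 (hom_part m p) i j = (if i + j = m then coeff2 p i j else 0)"
proof -
  have "coeff2 (hom_part m p) i j = (\<Sum>k\<le>m. if i = k \<and> j = m - k then coeff2 p k (m - k) else 0)"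
    unfolding hom_part_def by (auto simp: coeff_sum intro!: sum.cong)
  also have "\<dots> = (\<Sum>k\<le>m. if i = k then (if j = m - k then coeff2 p k (m - k) else 0) else 0)"
    by (intro sum.cong) auto
  also have "\<dots> = (if i + j = m then coeff2 p i j else 0)"
    by (subst sum.delta') auto
  finally show ?thesis .
qed

lemma eval2_hom_part:
  assumes "ring_hom_1 emb"
  shows "eval2 emb (hom_part m p) u v = (\<Sum>i\<le>m. emb (coeff2 p i (m - i)) * u ^ i * v ^ (m - i))"
proof -
  interpret E: ring_hom_1 "\<lambda>p. eval2 emb p u v" by (rule ring_hom_1_eval2[OF assms])
  show ?thesis
    unfolding hom_part_def monom2_eq by (simp add: E.sum assms)
qed

lemma hom_part_eq_0_iff: "hom_part m p = 0 \<longleftrightarrow> (\<forall>i\<le>m. coeff2 p i (m - i) = 0)"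
proof
  assume "hom_part m p = 0"
  then show "\<forall>i\<le>m. coeff2 p i (m - i) = 0"
    using coeff2_hom_part[of m p] by (metis coeff_0 le_add_diff_inverse)
next
  assume *: "\<forall>i\<le>m. coeff2 p i (m - i) = 0"
  show "hom_part m p = 0"
  proof (rule bpoly_eqI)
    show "coeff2 (hom_part m p) i j = coeff2 0 i j" for i j
      using *[rule_format, of i] by (auto simp: coeff2_hom_part)
  qed
qed

lemma hom_part_add: "hom_part m (p + q) = hom_part m p + hom_part m q"
  by (rule bpoly_eqI) (simp add: coeff2_hom_part)

lemma hom_part_diff: "hom_part m (p - q) = hom_part m p - hom_part m q"
  by (rule bpoly_eqI) (simp add: coeff2_hom_part)

lemma hom_part_const_mult: "hom_part m (const_bpoly c * p) = const_bpoly c * hom_part m p"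
  by (rule bpoly_eqI) (simp add: coeff2_hom_part)

lemma hom_part_mult_X: "hom_part (Suc m) (polyX * p) = polyX * hom_part m p"
  by (rule bpoly_eqI) (auto simp: coeff2_hom_part coeff2_mult_X)

lemma hom_part_mult_Y: "hom_part (Suc m) (polyY * p) = polyY * hom_part m p"
  by (rule bpoly_eqI) (auto simp: coeff2_hom_part coeff2_mult_Y)

lemma hom_part_pdx: "hom_part m (pdx p) = pdx (hom_part (Suc m) p)"
  by (rule bpoly_eqI) (auto simp: coeff2_hom_part coeff2_pdx)

lemma hom_part_pdy: "hom_part m (pdy p) = pdy (hom_part (Suc m) p)"
  by (rule bpoly_eqI) (auto simp: coeff2_hom_part coeff2_pdy)

lemma hom_part_0: "hom_part 0 p = const_bpoly (at_origin p)"
  by (rule bpoly_eqI) (simp add: coeff2_hom_part coeff2_const at_origin_coeff2)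

lemma euler:
  "polyX * pdx (hom_part m p) + polyY * pdy (hom_part m p) = const_bpoly (of_nat m) * hom_part m p"
  by (rule bpoly_eqI)
    (auto simp: coeff2_hom_part coeff2_pdx coeff2_pdy coeff2_mult_X coeff2_mult_Y
      simp flip: distrib_right of_nat_add of_nat_Suc)

text \<open>The substitution of (t x, t y) for (x, y) with a new variable t: the coefficient of t^n
  is the homogeneous part of degree n, so the rule for products comes from a ring
  homomorphism.\<close>

definition graded :: "bpoly \<Rightarrow> bpoly poly" where
  "graded p = eval2 (\<lambda>c. [:const_bpoly c:]) p [:0, polyX:] [:0, polyY:]"

lemma ring_hom_1_const_const: "ring_hom_1 (\<lambda>c. [:const_bpoly c:])"
  by unfold_locales (simp_all add: one_pCons mult.commute)

interpretation graded: ring_hom_1 graded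
  unfolding graded_def by (rule ring_hom_1_eval2) (rule ring_hom_1_const_const)

lemma graded_gen [simp]:
  "graded (const_bpoly c) = [:const_bpoly c:]" "graded polyX = [:0, polyX:]" "graded polyY = [:0, polyY:]"
  unfolding graded_def by (simp_all add: ring_hom_1_const_const)

lemma coeff_graded: "coeff (graded p) n = hom_part n p"
proof (induction p arbitrary: n rule: bpoly_linear_induct)
  case (const c)
  show ?case
    by (rule bpoly_eqI) (auto simp: coeff2_hom_part coeff2_const coeff_pCons split: nat.splits)
next
  case (add p q)
  then show ?case by (simp add: hom_part_add)
next
  case (multX p)
  then show ?case
    by (cases n) (simp_all add: hom_part_mult_X hom_part_0)
next
  case (multY p)
  then show ?case
    by (cases n) (simp_all add: hom_part_mult_Y hom_part_0)
qed

lemma hom_part_mult: "hom_part n (p * q) = (\<Sum>k\<le>n. hom_part k p * hom_part (n - k) q)"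
  by (simp flip: coeff_graded add: coeff_mult)

definition ord_ge :: "nat \<Rightarrow> bpoly \<Rightarrow> bool" where
  "ord_ge m p \<longleftrightarrow> (\<forall>k<m. hom_part k p = 0)"

lemma ord_ge_0 [simp]: "ord_ge 0 p" "ord_ge m 0"
  by (auto simp: ord_ge_def intro!: bpoly_eqI simp: coeff2_hom_part)

lemma ord_ge_mono: "ord_ge m p \<Longrightarrow> n \<le> m \<Longrightarrow> ord_ge n p"
  by (auto simp: ord_ge_def)

lemma ord_ge_add: "ord_ge m p \<Longrightarrow> ord_ge m q \<Longrightarrow> ord_ge m (p + q)"
  by (auto simp: ord_ge_def hom_part_add)

lemma ord_ge_diff: "ord_ge m p \<Longrightarrow> ord_ge m q \<Longrightarrow> ord_ge m (p - q)"
  by (auto simp: ord_ge_def hom_part_diff)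

lemma ord_ge_const_mult: "ord_ge m p \<Longrightarrow> ord_ge m (const_bpoly c * p)"
  by (auto simp: ord_ge_def hom_part_const_mult)

lemma ord_ge_pdx: "ord_ge m p \<Longrightarrow> ord_ge (m - 1) (pdx p)"
  by (auto simp: ord_ge_def hom_part_pdx)

lemma ord_ge_pdy: "ord_ge m p \<Longrightarrow> ord_ge (m - 1) (pdy p)"
  by (auto simp: ord_ge_def hom_part_pdy)

lemma ord_ge_Suc: "ord_ge (Suc m) p \<longleftrightarrow> ord_ge m p \<and> hom_part m p = 0"
  by (auto simp: ord_ge_def less_Suc_eq)

lemma ord_ge_1: "ord_ge 1 p \<longleftrightarrow> at_origin p = 0"
  by (auto simp: ord_ge_def hom_part_0 const_bpoly_def)

lemma hom_part_mult_ord_ge: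
  assumes "ord_ge m p" "ord_ge n q"
  shows "hom_part (m + n) (p * q) = hom_part m p * hom_part n q"
proof -
  have "hom_part (m + n) (p * q) = (\<Sum>k\<le>m + n. if k = m then hom_part m p * hom_part n q else 0)"
    unfolding hom_part_mult
  proof (intro sum.cong refl)
    fix k assume "k \<in> {..m + n}"
    then show "hom_part k p * hom_part (m + n - k) q = (if k = m then hom_part m p * hom_part n q else 0)"
      using assms by (cases k m rule: linorder_cases) (auto simp: ord_ge_def)
  qed
  then show ?thesis by simp
qed

lemma ord_ge_mult:
  assumes "ord_ge m p" "ord_ge n q"
  shows "ord_ge (m + n) (p * q)"
  unfolding ord_ge_def hom_part_mult
proof (intro allI impI sum.neutral ballI)
  fix k i assume "k < m + n" "i \<in> {..k}"
  then have "i < m \<or> k - i < n" by auto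
  then show "hom_part i p * hom_part (k - i) q = 0"
    using assms by (auto simp: ord_ge_def)
qed

lemma ord_ge_mult_X: "ord_ge m p \<Longrightarrow> ord_ge (Suc m) (polyX * p)"
  and ord_ge_mult_Y: "ord_ge m p \<Longrightarrow> ord_ge (Suc m) (polyY * p)"
  using ord_ge_mult[of 1 _ m p] by (simp_all add: ord_ge_1[simplified])

lemma hom_parts_eq_0: "(\<And>m. hom_part m p = 0) \<Longrightarrow> p = 0"
proof (rule bpoly_eqI)
  fix i j
  assume "\<And>m. hom_part m p = 0"
  then show "coeff2 p i j = coeff2 0 i j"
    using coeff2_hom_part[of "i + j" p j i] by simp
qed

lemma order_exists2:
  assumes "p \<noteq> 0 \<or> q \<noteq> 0"
  obtains m where "ord_ge m p" "ord_ge m q" "hom_part m p \<noteq> 0 \<or> hom_part m q \<noteq> 0"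
proof -
  let ?m = "LEAST m. hom_part m p \<noteq> 0 \<or> hom_part m q \<noteq> 0"
  have "\<exists>m. hom_part m p \<noteq> 0 \<or> hom_part m q \<noteq> 0"
    using assms hom_parts_eq_0 by metis
  then have "hom_part ?m p \<noteq> 0 \<or> hom_part ?m q \<noteq> 0"
    by (rule LeastI_ex)
  moreover have "ord_ge ?m p" "ord_ge ?m q"
    unfolding ord_ge_def using not_less_Least by blast+
  ultimately show thesis using that by blast
qed

lemma order_exists:
  assumes "p \<noteq> 0"
  obtains m where "ord_ge m p" "hom_part m p \<noteq> 0"
  using order_exists2[of p p] assms by metis

lemma jet_order_eqI:
  assumes "ord_ge m P" "ord_ge m Q" "hom_part m P \<noteq> 0 \<or> hom_part m Q \<noteq> 0"
  shows "jet_order (P, Q) = m"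
  unfolding jet_order_def
  by (rule Least_equality) (use assms in \<open>auto simp: ord_ge_def not_le[symmetric]\<close>)

text \<open>This is how a blowup acts, z being the exceptional equation. Since t^m divides
  \<open>graded p\<close>, evaluation at t = z extracts z^m, and the constant coefficient of the
  quotient is the part of degree m.\<close>

lemma eval2_scaled:
  assumes "ord_ge m p"
  obtains p' g where "eval2 const_bpoly p (z * u) (z * v) = z ^ m * p'"
    and "p' = eval2 const_bpoly (hom_part m p) u v + z * g"
proof -
  define H where "H = (\<lambda>q. eval2 const_bpoly q u v)"
  interpret H: ring_hom_1 H unfolding H_def by unfold_locales
  define E where "E = (\<lambda>q. poly (map_poly H q) z)"
  interpret E: ring_hom_1 E unfolding E_def by (rule H.poly_map_poly)
  have E: "E (graded p) = eval2 const_bpoly p (z * u) (z * v)"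
    unfolding graded_def
    by (subst ring_hom_1_apply_eval2[OF E.ring_hom_1_axioms ring_hom_1_const_const])
      (simp add: E_def H_def)
  have "monom 1 m dvd graded p"
    using assms by (simp add: monom_1_dvd_iff' ord_ge_def coeff_graded)
  then obtain r where r: "graded p = monom 1 m * r" by blast
  have r0: "coeff r 0 = hom_part m p"
    using arg_cong[OF r, of "\<lambda>q. coeff q m"] by (simp add: coeff_graded coeff_monom_mult)
  obtain a s where as: "r = pCons a s" by (cases r)
  have "E (monom 1 m) = z ^ m"
    unfolding E_def by (induction m) (simp_all add: monom_0 monom_Suc)
  then have "eval2 const_bpoly p (z * u) (z * v) = z ^ m * E r"
    unfolding E[symmetric] r by simp
  moreover have "E r = eval2 const_bpoly (hom_part m p) u v + z * E s"
    using r0 by (simp add: as E_def H_def)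
  ultimately show thesis using that by blast
qed

section \<open>Ideals in the local ring at the origin\<close>

text \<open>The exceptional divisor is \<open>polyX = 0\<close> around a finite slope and
  \<open>polyY = 0\<close> around the vertical direction; the local algebra is developed for both
  namings at once.\<close>

definition coordinates :: "bpoly \<Rightarrow> bpoly \<Rightarrow> bool" where
  "coordinates z w \<longleftrightarrow> z = polyX \<and> w = polyY \<or> z = polyY \<and> w = polyX"

lemma coordinates_sym: "coordinates z w \<Longrightarrow> coordinates w z"
  by (auto simp: coordinates_def)

lemma coordinatesD:
  assumes "coordinates z w"
  shows "z \<noteq> 0" "w \<noteq> 0" "at_origin z = 0" "at_origin w = 0"
  using assms by (auto simp: coordinates_def)

text \<open>Here \<open>poly (map_poly const_bpoly f) w\<close> is the one-variable polynomial f in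
  the coordinate w. Such polynomials represent the classes modulo the other coordinate z, that is,
  the functions on the line z = 0.\<close>

interpretation up: ring_hom_1 "\<lambda>f. poly (map_poly const_bpoly f) w" for w
  by (rule const_bpoly.poly_map_poly)

lemma at_origin_up:
  assumes "at_origin w = 0"
  shows "at_origin (poly (map_poly const_bpoly f) w) = coeff f 0"
  using assms by (cases f) simp

lemma decompose_coordinates:
  assumes "coordinates z w"
  obtains f g where "p = poly (map_poly const_bpoly f) w + z * g"
proof -
  have "\<exists>f g. p = poly (map_poly const_bpoly f) w + z * g"
  proof (induction p rule: bpoly_linear_induct)
    case (const c)
    show ?case by (rule exI[of _ "[:c:]"], rule exI[of _ 0]) simp
  next
    case (add p q)
    then obtain f g f' g' where "p = poly (map_poly const_bpoly f) w + z * g"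
      "q = poly (map_poly const_bpoly f') w + z * g'" by blast
    then show ?case
      by (intro exI[of _ "f + f'"] exI[of _ "g + g'"]) (simp add: algebra_simps)
  next
    case (multX p)
    then obtain f g where "p = poly (map_poly const_bpoly f) w + z * g" by blast
    then show ?case using assms unfolding coordinates_def
      by (elim disjE) (rule exI[of _ 0], rule exI[of _ p], simp,
        rule exI[of _ "pCons 0 f"], rule exI[of _ "polyX * g"], simp add: algebra_simps)
  next
    case (multY p)
    then obtain f g where "p = poly (map_poly const_bpoly f) w + z * g" by blast
    then show ?case using assms unfolding coordinates_def
      by (elim disjE) (rule exI[of _ "pCons 0 f"], rule exI[of _ "polyY * g"], simp add: algebra_simps,
        rule exI[of _ 0], rule exI[of _ p], simp)
  qed
  then show thesis using that by blast
qed

lemma polyX_power_eq: "polyX ^ K = [:monom 1 K:]"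
  by (induction K) (simp_all add: polyX_def monom_0 monom_Suc one_pCons)

lemma polyY_power_eq: "polyY ^ K = monom 1 K"
  by (induction K) (simp_all add: polyY_def monom_eq_1 monom_Suc)

lemma polyX_power_dvd_iff: "polyX ^ K dvd p \<longleftrightarrow> (\<forall>i<K. \<forall>j. coeff2 p i j = 0)"
  by (auto simp: polyX_power_eq const_poly_dvd_iff monom_1_dvd_iff')

lemma polyY_power_dvd_iff: "polyY ^ K dvd p \<longleftrightarrow> (\<forall>j<K. \<forall>i. coeff2 p i j = 0)"
  by (auto simp: polyY_power_eq monom_1_dvd_iff' poly_eq_iff)

text \<open>The coefficient of w^r in the product is \<open>at_origin s\<close>, while a multiple of
  z has no pure power of w.\<close>

lemma not_dvd_power_times_unit:
  assumes "coordinates z w" "at_origin s \<noteq> 0"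
  shows "\<not> z dvd w ^ r * s"
proof
  assume "z dvd w ^ r * s"
  then have "z ^ 1 dvd w ^ r * s" by simp
  moreover have "coeff2 (polyX ^ r * s) r 0 \<noteq> 0" "coeff2 (polyY ^ r * s) 0 r \<noteq> 0"
    using assms(2) by (simp_all add: coeff2_mult_X_power coeff2_mult_Y_power at_origin_coeff2)
  ultimately show False
    using assms(1) unfolding coordinates_def
    by (auto simp only: polyX_power_dvd_iff polyY_power_dvd_iff)
qed

lemma up_eq_power_times_unit:
  assumes "f \<noteq> 0" "at_origin w = 0"
  obtains r s where "poly (map_poly const_bpoly f) w = w ^ r * s" "at_origin s \<noteq> 0" "r \<le> degree f"
proof -
  obtain f2 where f2: "f = [:-0, 1:] ^ order 0 f * f2" "\<not> [:-0, 1:] dvd f2"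
    using order_decomp[OF assms(1)] by blast
  have "poly (map_poly const_bpoly f) w = w ^ order 0 f * poly (map_poly const_bpoly f2) w"
    by (subst f2(1)) simp
  moreover have "at_origin (poly (map_poly const_bpoly f2) w) \<noteq> 0"
    using f2(2) poly_eq_0_iff_dvd[of f2 0] by (simp add: at_origin_up[OF assms(2)] poly_0_coeff_0)
  ultimately show thesis
    using that order_degree[OF assms(1)] by blast
qed

lemma coordinate_dvd_up:
  assumes "coordinates z w" "z dvd poly (map_poly const_bpoly f) w"
  shows "f = 0"
proof (rule ccontr)
  assume "f \<noteq> 0"
  then obtain r s where "poly (map_poly const_bpoly f) w = w ^ r * s" "at_origin s \<noteq> 0"
    using up_eq_power_times_unit coordinatesD[OF assms(1)] by metis
  then show False using not_dvd_power_times_unit[OF assms(1)] assms(2) by metis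
qed

lemma prime_elem_coordinate:
  assumes "coordinates z w"
  shows "prime_elem z"
proof (rule prime_elemI)
  show "z \<noteq> 0" using coordinatesD[OF assms] by simp
  show "\<not> is_unit z" using not_dvd_power_times_unit[OF assms, of 1 0] by simp
  fix p q assume dvd: "z dvd p * q"
  obtain f g where p: "p = poly (map_poly const_bpoly f) w + z * g"
    using decompose_coordinates[OF assms] .
  obtain f' g' where q: "q = poly (map_poly const_bpoly f') w + z * g'"
    using decompose_coordinates[OF assms] .
  have "p * q = poly (map_poly const_bpoly (f * f')) w + z * (g * q + poly (map_poly const_bpoly f) w * g')"
    by (simp add: p q algebra_simps)
  then have "z dvd poly (map_poly const_bpoly (f * f')) w"
    using dvd by (metis dvd_add_left_iff dvd_triv_left)
  then have "f * f' = 0" by (rule coordinate_dvd_up[OF assms])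
  then show "z dvd p \<or> z dvd q" by (auto simp: p q)
qed

text \<open>Membership of r in the ideal generated by p and q in the local ring at the origin, with
  the denominator s cleared so that only polynomials occur.\<close>

definition local_ideal :: "bpoly \<Rightarrow> bpoly \<Rightarrow> bpoly \<Rightarrow> bool" where
  "local_ideal p q r \<longleftrightarrow> (\<exists>s a b. at_origin s \<noteq> 0 \<and> s * r = a * p + b * q)"

lemma local_idealI: "at_origin s \<noteq> 0 \<Longrightarrow> s * r = a * p + b * q \<Longrightarrow> local_ideal p q r"
  by (auto simp: local_ideal_def)

lemma local_idealE:
  assumes "local_ideal p q r"
  obtains s a b where "at_origin s \<noteq> 0" "s * r = a * p + b * q"
  using assms by (auto simp: local_ideal_def)

lemma local_ideal_lin: "local_ideal p q (a * p + b * q)"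
  by (rule local_idealI[of 1]) simp_all

lemma local_ideal_0 [simp]: "local_ideal p q 0"
  using local_ideal_lin[of p q 0 0] by simp

lemma local_ideal_add:
  assumes "local_ideal p q r" "local_ideal p q r'"
  shows "local_ideal p q (r + r')"
proof -
  obtain s a b s' a' b' where *: "at_origin s \<noteq> 0" "s * r = a * p + b * q"
    "at_origin s' \<noteq> 0" "s' * r' = a' * p + b' * q"
    using assms by (auto simp: local_ideal_def)
  have "(s * s') * (r + r') = s' * (s * r) + s * (s' * r')" by (simp add: algebra_simps)
  also have "\<dots> = (s' * a + s * a') * p + (s' * b + s * b') * q"
    unfolding * by (simp add: algebra_simps)
  finally show ?thesis using * by (intro local_idealI[of "s * s'"]) simp_all
qed

lemma local_ideal_mult:
  assumes "local_ideal p q r"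
  shows "local_ideal p q (t * r)"
proof -
  obtain s a b where *: "at_origin s \<noteq> 0" "s * r = a * p + b * q"
    using assms by (auto simp: local_ideal_def)
  have "s * (t * r) = t * (s * r)" by (simp add: algebra_simps)
  also have "\<dots> = (t * a) * p + (t * b) * q" unfolding * by (simp add: algebra_simps)
  finally show ?thesis using * by (intro local_idealI[of s]) simp_all
qed

lemma local_ideal_dvd: "local_ideal p q r \<Longrightarrow> r dvd t \<Longrightarrow> local_ideal p q t"
  by (elim dvdE) (simp add: mult.commute[of r] local_ideal_mult)

lemma local_ideal_diff:
  assumes "local_ideal p q r" "local_ideal p q r'"
  shows "local_ideal p q (r - r')"
  using local_ideal_add[OF assms(1) local_ideal_mult[OF assms(2), of "- 1"]] by simp

lemma local_ideal_sum:
  "(\<And>i. i \<in> A \<Longrightarrow> local_ideal p q (r i)) \<Longrightarrow> local_ideal p q (\<Sum>i\<in>A. r i)"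
  by (induction A rule: infinite_finite_induct) (simp_all add: local_ideal_add)

lemma local_ideal_cancel:
  assumes "at_origin s \<noteq> 0" "local_ideal p q (s * r)"
  shows "local_ideal p q r"
proof -
  obtain s' a b where *: "at_origin s' \<noteq> 0" "s' * (s * r) = a * p + b * q"
    using assms(2) by (rule local_idealE)
  then show ?thesis using assms(1) by (intro local_idealI[of "s' * s"]) (simp_all add: mult.assoc)
qed

text \<open>
  \<open>p\<close> and \<open>q\<close> have no common component through the origin.  In contrast to coprimality, this is
  stable under the substitutions used in a blowup.
\<close>

definition locally_coprime :: "bpoly \<Rightarrow> bpoly \<Rightarrow> bool" where
  "locally_coprime p q \<longleftrightarrow>
     (\<forall>z\<in>{polyX, polyY}. (\<exists>K. local_ideal p q (z ^ K)) \<and> \<not> (z dvd p \<and> z dvd q))"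

lemma locally_coprimeD:
  assumes "locally_coprime p q" "coordinates z w"
  shows "\<exists>K. local_ideal p q (z ^ K)" "\<not> (z dvd p \<and> z dvd q)"
  using assms by (auto simp: locally_coprime_def coordinates_def)

lemma dvd_power_diff:
  fixes x y :: "'a::comm_ring_1"
  shows "x - y dvd x ^ n - y ^ n"
  by (simp only: power_diff_sumr2 dvd_triv_left)

text \<open>On the line z = 0 a generator F not divisible by z is w^r times a unit s, so F - z g =
  w^r s. Its K-th power differs from (- z g)^K by a multiple of F, and z^K is in the ideal; hence so
  is w^(r K), and one coordinate controls the other.\<close>

lemma locally_coprimeI:
  assumes zw: "coordinates z w" and K: "local_ideal p q (z ^ K)" and ndvd: "\<not> (z dvd p \<and> z dvd q)"
  shows "locally_coprime p q"
proof -
  obtain F where F: "F = p \<or> F = q" "\<not> z dvd F" using ndvd by blast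
  then have FI: "local_ideal p q (a * F)" for a
    using local_ideal_lin[of p q a 0] local_ideal_lin[of p q 0 a] by auto
  obtain f g where fg: "F = poly (map_poly const_bpoly f) w + z * g"
    using decompose_coordinates[OF zw] .
  have "f \<noteq> 0" using F(2) fg by auto
  then obtain r s where rs: "poly (map_poly const_bpoly f) w = w ^ r * s" "at_origin s \<noteq> 0"
    using up_eq_power_times_unit coordinatesD(4)[OF zw] by metis
  have "F dvd (F - z * g) ^ K - (- (z * g)) ^ K"
    using dvd_power_diff[of "F - z * g" "- (z * g)" K] by (simp only: diff_minus_eq_add diff_add_cancel)
  then obtain a where a: "(F - z * g) ^ K - (- (z * g)) ^ K = F * a" by (rule dvdE)
  have "- (z * g) = (- g) * z" by simp
  then have "(- (z * g)) ^ K = (- g) ^ K * z ^ K" by (simp only: power_mult_distrib)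
  then have "(F - z * g) ^ K = a * F + (- g) ^ K * z ^ K"
    using a[unfolded diff_eq_eq] by (simp only: mult.commute[of a F])
  then have "local_ideal p q ((F - z * g) ^ K)"
    using local_ideal_add[OF FI local_ideal_mult[OF K]] by (simp only:)
  moreover have "F - z * g = w ^ r * s"
    unfolding fg rs(1) by (rule add_diff_cancel_right')
  ultimately have "local_ideal p q (s ^ K * w ^ (r * K))"
    by (simp only: power_mult_distrib power_mult mult.commute[of "s ^ K"])
  moreover have "at_origin (s ^ K) \<noteq> 0" using rs(2) by simp
  ultimately have wI: "local_ideal p q (w ^ (r * K))"
    using local_ideal_cancel by blast
  have "\<not> (w dvd p \<and> w dvd q)"
  proof
    assume "w dvd p \<and> w dvd q"
    moreover obtain s a b where *: "at_origin s \<noteq> 0" "s * z ^ K = a * p + b * q"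
      using K by (rule local_idealE)
    ultimately have "w dvd z ^ K * s" by (simp add: mult.commute)
    then show False using not_dvd_power_times_unit[OF coordinates_sym[OF zw] *(1)] by blast
  qed
  then show ?thesis
    using zw K wI ndvd unfolding locally_coprime_def coordinates_def by blast
qed

lemma decompose_origin:
  obtains a b where "p = const_bpoly (at_origin p) + polyX * a + polyY * b"
proof -
  obtain f g where fg: "p = poly (map_poly const_bpoly f) polyY + polyX * g"
    using decompose_coordinates[of polyX polyY p] by (auto simp: coordinates_def)
  obtain c f' where "f = pCons c f'" by (cases f)
  then show thesis
    using that[of g "poly (map_poly const_bpoly f') polyY"] fg by (simp add: algebra_simps)
qed

text \<open>In the expansion of (x a + y b)^(K + L) every term contains x^K or y^L, so the maximal
  ideal is nilpotent modulo (p, q).\<close>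

lemma local_ideal_power:
  assumes "locally_coprime p q" "at_origin r = 0"
  obtains k where "local_ideal p q (r ^ k)"
proof -
  obtain a b where r: "r = polyX * a + polyY * b"
    using decompose_origin[of r] assms(2) by auto
  have "coordinates polyX polyY" by (simp add: coordinates_def)
  then obtain K L where K: "local_ideal p q (polyX ^ K)" and L: "local_ideal p q (polyY ^ L)"
    using locally_coprimeD(1)[OF assms(1)] coordinates_sym by metis
  have "local_ideal p q (r ^ (K + L))"
    unfolding r binomial_ring
  proof (rule local_ideal_sum)
    fix i assume "i \<in> {..K + L}"
    then consider "K \<le> i" | "L \<le> K + L - i" by fastforce
    then show "local_ideal p q (of_nat (K + L choose i) * (polyX * a) ^ i * (polyY * b) ^ (K + L - i))"
    proof cases
      case 1
      then have "polyX ^ K dvd (polyX * a) ^ i"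
        using dvd_trans[OF le_imp_power_dvd dvd_power_same[OF dvd_triv_left]] by blast
      then show ?thesis
        by (intro local_ideal_dvd[OF K] dvd_mult2 dvd_mult)
    next
      case 2
      then have "polyY ^ L dvd (polyY * b) ^ (K + L - i)"
        using dvd_trans[OF le_imp_power_dvd dvd_power_same[OF dvd_triv_left]] by blast
      then show ?thesis
        by (intro local_ideal_dvd[OF L] dvd_mult)
    qed
  qed
  then show thesis by (rule that)
qed

text \<open>Scaled to value 1 at the origin, s is 1 - n with n nilpotent modulo (p, q), and the
  geometric series breaks off. This turns denominators into honest polynomial inverses.\<close>

lemma local_ideal_unit_inverse:
  assumes "locally_coprime p q" "at_origin s \<noteq> 0"
  obtains t where "local_ideal p q (s * t - 1)"
proof -
  define n where "n = 1 - s * const_bpoly (1 / at_origin s)"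
  have "at_origin n = 0" using assms(2) by (simp add: n_def)
  then obtain k where k: "local_ideal p q (n ^ k)"
    using local_ideal_power[OF assms(1)] by blast
  have "(1 - n) * (\<Sum>i<k. n ^ i) - 1 = - 1 * n ^ k"
    by (simp add: one_diff_power_eq[symmetric])
  then have "s * (const_bpoly (1 / at_origin s) * (\<Sum>i<k. n ^ i)) - 1 = - 1 * n ^ k"
    by (simp add: n_def mult.assoc)
  then show thesis using that local_ideal_mult[OF k] by metis
qed

section \<open>Colength\<close>

definition independent_mod :: "bpoly \<Rightarrow> bpoly \<Rightarrow> nat \<Rightarrow> (nat \<Rightarrow> bpoly) \<Rightarrow> bool" where
  "independent_mod p q n b \<longleftrightarrow>
     (\<forall>c. local_ideal p q (\<Sum>i<n. const_bpoly (c i) * b i) \<longrightarrow> (\<forall>i<n. c i = 0))"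

text \<open>The dimension of the local ring modulo (p, q), that is, the intersection multiplicity at
  the origin, is at most N. Bounding the size of independent families avoids quotient spaces and
  bases.\<close>

definition colength_le :: "bpoly \<Rightarrow> bpoly \<Rightarrow> nat \<Rightarrow> bool" where
  "colength_le p q N \<longleftrightarrow> (\<forall>n b. independent_mod p q n b \<longrightarrow> n \<le> N)"

lemma homogeneous_system:
  fixes a :: "nat \<Rightarrow> 'i \<Rightarrow> 'a::field"
  assumes "finite S" "N < card S"
  shows "\<exists>c. (\<exists>i\<in>S. c i \<noteq> 0) \<and> (\<forall>e<N. (\<Sum>i\<in>S. c i * a e i) = 0)"
  using assms
proof (induction N arbitrary: S a)
  case 0
  then have "S \<noteq> {}" by auto
  then show ?case by (intro exI[of _ "\<lambda>_. 1"]) auto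
next
  case (Suc N)
  show ?case
  proof (cases "\<forall>i\<in>S. a N i = 0")
    case True
    obtain c where "\<exists>i\<in>S. c i \<noteq> 0" "\<forall>e<N. (\<Sum>i\<in>S. c i * a e i) = 0"
      using Suc.IH[of S a] Suc.prems by auto
    then show ?thesis using True by (intro exI[of _ c]) (auto simp: less_Suc_eq)
  next
    case False
    then obtain p where p: "p \<in> S" "a N p \<noteq> 0" by blast
    define T where "T = S - {p}"
    have T: "finite T" "N < card T" "p \<notin> T" "S = insert p T"
      using Suc.prems p by (auto simp: T_def)
    define a' where "a' = (\<lambda>e i. a e i - a e p * a N i / a N p)"
    obtain c where c: "\<exists>i\<in>T. c i \<noteq> 0" "\<forall>e<N. (\<Sum>i\<in>T. c i * a' e i) = 0"
      using Suc.IH[of T a'] T by auto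
    define c' where "c' = c(p := - (\<Sum>i\<in>T. c i * a N i) / a N p)"
    have T_sum: "(\<Sum>i\<in>T. c' i * a e i) = (\<Sum>i\<in>T. c i * a e i)" for e
      using T by (intro sum.cong) (auto simp: c'_def)
    have eq: "(\<Sum>i\<in>S. c' i * a e i) = (\<Sum>i\<in>T. c i * a' e i)" for e
    proof -
      have "(\<Sum>i\<in>S. c' i * a e i) = - (\<Sum>i\<in>T. c i * a N i) / a N p * a e p + (\<Sum>i\<in>T. c i * a e i)"
        using T by (simp add: T_sum) (simp add: c'_def)
      also have "\<dots> = (\<Sum>i\<in>T. c i * a' e i)"
        by (simp add: a'_def algebra_simps sum_subtractf sum_distrib_left sum_divide_distrib)
      finally show ?thesis .
    qed
    moreover have "a' N i = 0" for i using p by (simp add: a'_def)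
    ultimately have "\<forall>e<Suc N. (\<Sum>i\<in>S. c' i * a e i) = 0"
      using c(2) by (auto simp: less_Suc_eq)
    moreover have "\<exists>i\<in>S. c' i \<noteq> 0"
      using c(1) T by (auto simp: c'_def)
    ultimately show ?thesis by blast
  qed
qed

lemma low_coeffs_eq_0:
  assumes "\<And>i j. i < K \<Longrightarrow> j < L \<Longrightarrow> coeff2 p i j = 0"
  obtains a b where "p = a * polyX ^ K + b * polyY ^ L"
proof -
  define r where "r = poly_cutoff L p"
  have "polyX ^ K dvd r"
    unfolding polyX_power_dvd_iff using assms by (auto simp: r_def coeff_poly_cutoff)
  moreover have "polyY ^ L dvd p - r"
    unfolding polyY_power_dvd_iff by (auto simp: r_def coeff_poly_cutoff)
  ultimately obtain a b where "r = polyX ^ K * a" "p - r = polyY ^ L * b" by (auto elim!: dvdE)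
  then show thesis using that[of a b] by (simp add: algebra_simps)
qed

lemma colength_finite:
  assumes "locally_coprime p q"
  obtains N where "colength_le p q N"
proof -
  have "coordinates polyX polyY" by (simp add: coordinates_def)
  then obtain K L where K: "local_ideal p q (polyX ^ K)" and L: "local_ideal p q (polyY ^ L)"
    using locally_coprimeD(1)[OF assms(1)] coordinates_sym by metis
  have "n \<le> K * L" if ind: "independent_mod p q n b" for n b
  proof (rule ccontr)
    assume "\<not> n \<le> K * L"
    \<comment> \<open>The K L equations say that the coefficient of x^k y^l in the combination
      vanishes for all k < K and l < L; the pair is coded as e = k L + l.\<close>
    then obtain c where c: "\<exists>i\<in>{..<n}. c i \<noteq> 0"
      and eq: "\<And>e. e < K * L \<Longrightarrow> (\<Sum>i<n. c i * coeff2 (b i) (e div L) (e mod L)) = 0"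
      using homogeneous_system[of "{..<n}" "K * L" "\<lambda>e i. coeff2 (b i) (e div L) (e mod L)"] by auto
    let ?s = "\<Sum>i<n. const_bpoly (c i) * b i"
    have "coeff2 ?s k l = 0" if "k < K" "l < L" for k l
    proof -
      have "k * L + l < K * L"
      proof -
        have "k * L + l < Suc k * L" using that by simp
        also have "\<dots> \<le> K * L" using that by (intro mult_right_mono) auto
        finally show ?thesis .
      qed
      from eq[OF this] that show ?thesis by (simp add: coeff_sum)
    qed
    then obtain u v where "?s = u * polyX ^ K + v * polyY ^ L"
      by (rule low_coeffs_eq_0)
    then have "local_ideal p q ?s"
      using local_ideal_add[OF local_ideal_mult[OF K] local_ideal_mult[OF L]] by simp
    then show False using ind c by (auto simp: independent_mod_def)
  qed
  then show thesis using that unfolding colength_le_def by blast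
qed

section \<open>Substitution of a blowup map\<close>

fun other_coord :: "direction \<Rightarrow> bpoly" where
  "other_coord (Slope c) = polyY"
| "other_coord Vertical = polyX"

text \<open>The blowup map is z times (\<open>blow_u\<close>, \<open>blow_v\<close>), z being the
  exceptional equation; at the origin this pair is a vector pointing in the chosen
  direction.\<close>

fun blow_u :: "direction \<Rightarrow> bpoly" where
  "blow_u (Slope c) = 1"
| "blow_u Vertical = polyX"

fun blow_v :: "direction \<Rightarrow> bpoly" where
  "blow_v (Slope c) = polyY + const_bpoly c"
| "blow_v Vertical = 1"

definition blow :: "direction \<Rightarrow> bpoly \<Rightarrow> bpoly" where
  "blow e p = eval2 const_bpoly p (exceptional_eq e * blow_u e) (exceptional_eq e * blow_v e)"

lemma blowup_map_eq: "blowup_map e = (exceptional_eq e * blow_u e, exceptional_eq e * blow_v e)"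
  by (cases e) (simp_all add: mult.commute)

interpretation blow: ring_hom_1 "blow e" for e
  unfolding blow_def by unfold_locales

lemma coordinates_direction: "coordinates (exceptional_eq e) (other_coord e)"
  by (cases e) (simp_all add: coordinates_def)

lemma at_origin_exceptional [simp]: "at_origin (exceptional_eq e) = 0"
  by (cases e) simp_all

lemma exceptional_nonzero [simp]: "exceptional_eq e \<noteq> 0"
  by (cases e) simp_all

lemma blow_const [simp]: "blow e (const_bpoly c) = const_bpoly c"
  by (simp add: blow_def)

lemma at_origin_blow [simp]: "at_origin (blow e p) = at_origin p"
  by (simp add: blow_def)

lemma blow_polyX: "blow e polyX = exceptional_eq e * blow_u e"
  and blow_polyY: "blow e polyY = exceptional_eq e * blow_v e"
  by (simp_all add: blow_def)

lemma blow_exceptional: "blow e (exceptional_eq e) = exceptional_eq e"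
  by (cases e) (simp_all add: blow_def)

lemma up_monom: "poly (map_poly const_bpoly (monom a k)) w = const_bpoly a * w ^ k"
  by (simp add: map_poly_monom poly_monom)

lemma up_pcompose:
  "poly (map_poly const_bpoly (f \<circ>\<^sub>p g)) w = poly (map_poly const_bpoly f) (poly (map_poly const_bpoly g) w)"
  by (induction f) (simp_all add: pcompose_pCons)

text \<open>Restricting a form of degree m to the exceptional divisor dehomogenizes it and, for
  \<open>Slope c\<close>, translates by c; neither operation kills it or raises the degree above
  m.\<close>

lemma hom_part_restricted:
  assumes "hom_part m p \<noteq> 0"
  obtains f where "eval2 const_bpoly (hom_part m p) (blow_u e) (blow_v e) =
      poly (map_poly const_bpoly f) (other_coord e)" "f \<noteq> 0" "degree f \<le> m"
proof (cases e)
  case (Slope c)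
  define f where "f = (\<Sum>i\<le>m. monom (coeff2 p i (m - i)) (m - i))"
  obtain i where i: "i \<le> m" "coeff2 p i (m - i) \<noteq> 0"
    using assms by (auto simp: hom_part_eq_0_iff)
  have "coeff f (m - i) = (\<Sum>k\<le>m. if k = i then coeff2 p i (m - i) else 0)"
    unfolding f_def coeff_sum using i by (intro sum.cong) auto
  then have "f \<noteq> 0" using i by auto
  then have "f \<circ>\<^sub>p [:c, 1:] \<noteq> 0" using pcompose_eq_0[of f "[:c, 1:]"] by auto
  moreover have "degree f \<le> m"
    unfolding f_def by (rule degree_sum_le) (auto intro: order.trans[OF degree_monom_le])
  then have "degree (f \<circ>\<^sub>p [:c, 1:]) \<le> m" by (simp add: degree_pcompose)
  moreover have "eval2 const_bpoly (hom_part m p) (blow_u e) (blow_v e) =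
      poly (map_poly const_bpoly (f \<circ>\<^sub>p [:c, 1:])) (other_coord e)"
    by (simp add: Slope eval2_hom_part[OF const_bpoly.ring_hom_1_axioms] up_pcompose f_def up.sum up_monom add.commute)
  ultimately show thesis using that by blast
next
  case Vertical
  define f where "f = (\<Sum>i\<le>m. monom (coeff2 p i (m - i)) i)"
  obtain i where i: "i \<le> m" "coeff2 p i (m - i) \<noteq> 0"
    using assms by (auto simp: hom_part_eq_0_iff)
  have "coeff f i = (\<Sum>k\<le>m. if k = i then coeff2 p i (m - i) else 0)"
    unfolding f_def coeff_sum using i by (intro sum.cong) auto
  then have "f \<noteq> 0" using i by auto
  moreover have "degree f \<le> m"
    unfolding f_def by (rule degree_sum_le) (auto intro: order.trans[OF degree_monom_le])
  moreover have "eval2 const_bpoly (hom_part m p) (blow_u e) (blow_v e) =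
      poly (map_poly const_bpoly f) (other_coord e)"
    by (simp add: Vertical eval2_hom_part[OF const_bpoly.ring_hom_1_axioms] f_def up.sum up_monom)
  ultimately show thesis using that by blast
qed

lemma blow_factor:
  assumes "ord_ge m p"
  obtains p' where "blow e p = exceptional_eq e ^ m * p'"
  using eval2_scaled[OF assms] unfolding blow_def by metis

lemma blow_residue_eq:
  assumes "ord_ge m p" "blow e p = exceptional_eq e ^ m * p'"
  obtains g where "p' = eval2 const_bpoly (hom_part m p) (blow_u e) (blow_v e) + exceptional_eq e * g"
proof -
  obtain q g where "blow e p = exceptional_eq e ^ m * q"
    "q = eval2 const_bpoly (hom_part m p) (blow_u e) (blow_v e) + exceptional_eq e * g"
    using eval2_scaled[OF assms(1)] unfolding blow_def by metis
  then show thesis using that assms(2) by simp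
qed

lemma at_origin_blow_factor:
  assumes "ord_ge m p" "blow e p = exceptional_eq e ^ m * p'"
  shows "at_origin p' = eval2 (\<lambda>c. c) (hom_part m p) (at_origin (blow_u e)) (at_origin (blow_v e))"
  by (rule blow_residue_eq[OF assms]) simp

text \<open>Here r is the order of contact with the exceptional divisor at the new origin, that is,
  the multiplicity of a root of the dehomogenized leading form; hence r \<le> m.\<close>

lemma blow_residue:
  assumes "ord_ge m p" "hom_part m p \<noteq> 0" "blow e p = exceptional_eq e ^ m * p'"
  obtains r s g where "p' = other_coord e ^ r * s + exceptional_eq e * g" "at_origin s \<noteq> 0" "r \<le> m"
proof -
  obtain g where g: "p' = eval2 const_bpoly (hom_part m p) (blow_u e) (blow_v e) + exceptional_eq e * g"
    using blow_residue_eq[OF assms(1,3)] .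
  obtain f where f: "eval2 const_bpoly (hom_part m p) (blow_u e) (blow_v e) =
      poly (map_poly const_bpoly f) (other_coord e)" "f \<noteq> 0" "degree f \<le> m"
    using hom_part_restricted[OF assms(2)] .
  then obtain r s where "poly (map_poly const_bpoly f) (other_coord e) = other_coord e ^ r * s"
    "at_origin s \<noteq> 0" "r \<le> degree f"
    using up_eq_power_times_unit[OF f(2) coordinatesD(4)[OF coordinates_direction]] by metis
  with f g that[of r s g] show thesis by simp
qed

lemma exceptional_not_dvd_blow_factor:
  assumes "ord_ge m p" "hom_part m p \<noteq> 0" "blow e p = exceptional_eq e ^ m * p'"
  shows "\<not> exceptional_eq e dvd p'"
proof
  obtain r s g where *: "p' = other_coord e ^ r * s + exceptional_eq e * g" "at_origin s \<noteq> 0"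
    using blow_residue[OF assms] by metis
  moreover assume "exceptional_eq e dvd p'"
  ultimately have "exceptional_eq e dvd other_coord e ^ r * s"
    by (simp add: dvd_add_left_iff)
  then show False
    using not_dvd_power_times_unit[OF coordinates_direction *(2)] by blast
qed

lemma blow_eq_0_iff: "blow e p = 0 \<longleftrightarrow> p = 0"
proof
  assume 0: "blow e p = 0"
  show "p = 0"
  proof (rule ccontr)
    assume "p \<noteq> 0"
    then obtain m where m: "ord_ge m p" "hom_part m p \<noteq> 0" by (rule order_exists)
    obtain p' where p': "blow e p = exceptional_eq e ^ m * p'" using blow_factor[OF m(1)] .
    then have "p' = 0" using 0 by simp
    then show False using exceptional_not_dvd_blow_factor[OF m p'] by simp
  qed
qed simp

lemma local_ideal_blow:
  assumes "local_ideal p q r" "blow e p = exceptional_eq e ^ m * p'" "blow e q = exceptional_eq e ^ m * q'"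
    "blow e r = exceptional_eq e ^ m * r'"
  shows "local_ideal p' q' r'"
proof -
  obtain s a b where *: "at_origin s \<noteq> 0" "s * r = a * p + b * q"
    using assms(1) by (rule local_idealE)
  have "exceptional_eq e ^ m * (blow e s * r') = blow e (s * r)"
    by (simp add: assms)
  also have "\<dots> = exceptional_eq e ^ m * (blow e a * p' + blow e b * q')"
    unfolding * by (simp add: assms algebra_simps)
  finally have "blow e s * r' = blow e a * p' + blow e b * q'" by simp
  then show ?thesis using *(1) by (intro local_idealI[of "blow e s"]) simp_all
qed

lemma locally_coprime_blow:
  assumes lc: "locally_coprime p q" and ord: "ord_ge m p" "ord_ge m q"
    and m: "hom_part m p \<noteq> 0 \<or> hom_part m q \<noteq> 0"
    and p': "blow e p = exceptional_eq e ^ m * p'" and q': "blow e q = exceptional_eq e ^ m * q'"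
  shows "locally_coprime p' q'"
proof -
  obtain K where "local_ideal p q (exceptional_eq e ^ K)"
    using locally_coprimeD(1)[OF lc coordinates_direction] by blast
  \<comment> \<open>The surplus factor z^m is the one that cancels when p and q are divided by z^m
    upstairs.\<close>
  then have "local_ideal p q (exceptional_eq e ^ m * exceptional_eq e ^ K)"
    by (rule local_ideal_mult)
  then have "local_ideal p' q' (exceptional_eq e ^ K)"
    by (rule local_ideal_blow[OF _ p' q']) (simp add: blow_exceptional)
  moreover have "\<not> (exceptional_eq e dvd p' \<and> exceptional_eq e dvd q')"
    using exceptional_not_dvd_blow_factor ord m p' q' by metis
  ultimately show ?thesis by (rule locally_coprimeI[OF coordinates_direction])
qed

text \<open>
  On the exceptional divisor \<open>p'\<close> or \<open>q'\<close> has a zero of order at most \<open>m\<close>, so powers of the other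
  coordinate up to the \<open>m\<close>-th, which do lift, generate the local algebra of \<open>(p', q')\<close>.
\<close>

lemma blow_quotient_surjective:
  assumes lc: "locally_coprime p q" and ord: "ord_ge m p" "ord_ge m q"
    and m: "hom_part m p \<noteq> 0 \<or> hom_part m q \<noteq> 0"
    and p': "blow e p = exceptional_eq e ^ m * p'" and q': "blow e q = exceptional_eq e ^ m * q'"
  shows "\<exists>r r'. ord_ge m r \<and> blow e r = exceptional_eq e ^ m * r' \<and> local_ideal p' q' (r' - t)"
proof -
  define z where "z = exceptional_eq e"
  define w where "w = other_coord e"
  have zw: "coordinates z w" unfolding z_def w_def by (rule coordinates_direction)
  \<comment> \<open>The classes that lift to functions of order at least m downstairs. S is a vector
    space closed under multiplication by z; that it contains everything is shown by descending
    induction on the power of z, beginning with a z^K in the ideal.\<close>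
  define S where "S = {t. \<exists>r r'. ord_ge m r \<and> blow e r = z ^ m * r' \<and> local_ideal p' q' (r' - t)}"
  have S_ideal: "t \<in> S" if "local_ideal p' q' t" for t
    unfolding S_def using local_ideal_mult[OF that, of "- 1"]
    by (intro CollectI exI[of _ 0]) simp
  have S_add: "t + t' \<in> S" if t: "t \<in> S" "t' \<in> S" for t t'
  proof -
    obtain r r1 r' r1' where *: "ord_ge m r" "blow e r = z ^ m * r1" "local_ideal p' q' (r1 - t)"
      "ord_ge m r'" "blow e r' = z ^ m * r1'" "local_ideal p' q' (r1' - t')"
      using t unfolding S_def by blast
    have "(r1 - t) + (r1' - t') = r1 + r1' - (t + t')" by (simp add: algebra_simps)
    with local_ideal_add[OF *(3,6)] have "local_ideal p' q' (r1 + r1' - (t + t'))" by simp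
    moreover have "blow e (r + r') = z ^ m * (r1 + r1')" using * by (simp add: algebra_simps)
    ultimately show ?thesis unfolding S_def using ord_ge_add[OF *(1,4)] by blast
  qed
  have S_const: "const_bpoly c * t \<in> S" if "t \<in> S" for t c
  proof -
    obtain r r1 where *: "ord_ge m r" "blow e r = z ^ m * r1" "local_ideal p' q' (r1 - t)"
      using \<open>t \<in> S\<close> unfolding S_def by blast
    have "blow e (const_bpoly c * r) = z ^ m * (const_bpoly c * r1)"
      using * by (simp add: algebra_simps)
    moreover have "local_ideal p' q' (const_bpoly c * r1 - const_bpoly c * t)"
      using local_ideal_mult[OF *(3), of "const_bpoly c"] by (simp add: algebra_simps)
    ultimately show ?thesis unfolding S_def using ord_ge_const_mult[OF *(1)] by blast
  qed
  have S_z: "z * t \<in> S" if "t \<in> S" for t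
  proof -
    obtain r r1 where *: "ord_ge m r" "blow e r = z ^ m * r1" "local_ideal p' q' (r1 - t)"
      using \<open>t \<in> S\<close> unfolding S_def by blast
    have "ord_ge m (z * r)"
      using ord_ge_mult_X[OF *(1)] ord_ge_mult_Y[OF *(1)] zw ord_ge_mono
      unfolding coordinates_def by (metis le_SucI order_refl)
    moreover have "blow e (z * r) = z ^ m * (z * r1)"
      using * by (simp add: z_def blow_exceptional)
    moreover have "local_ideal p' q' (z * r1 - z * t)"
      using local_ideal_mult[OF *(3), of z] by (simp add: algebra_simps)
    ultimately show ?thesis unfolding S_def by blast
  qed
  have S_z_power: "z ^ n * t \<in> S" if "t \<in> S" for t n
    by (induction n) (simp_all add: that S_z mult.assoc)
  have S_sum: "(\<Sum>i\<in>A. f i) \<in> S" if "\<And>i. i \<in> A \<Longrightarrow> f i \<in> S" for A :: "nat set" and f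
    using that by (induction A rule: infinite_finite_induct) (simp_all add: S_add S_ideal)
  have ord_power: "ord_ge (i + j) (f ^ i * g ^ j)" if "at_origin f = 0" "at_origin g = 0" for f g i j
  proof -
    have "ord_ge n (f ^ n)" if "at_origin f = 0" for f n
      using that by (induction n) (use ord_ge_mult[of 1 f] in \<open>auto simp: ord_ge_1[simplified]\<close>)
    then show ?thesis using that ord_ge_mult by blast
  qed
  have S_w: "w ^ i \<in> S" if "i \<le> m" for i
  proof (cases e)
    case (Slope c)
    \<comment> \<open>A form of degree m that vanishes i-fold in the direction of slope c: after
      division by z^m only w^i is left.\<close>
    define r where "r = (polyY - const_bpoly c * polyX) ^ i * polyX ^ (m - i)"
    have "ord_ge m r"
      using ord_power[of "polyY - const_bpoly c * polyX" polyX i "m - i"] that by (simp add: r_def)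
    moreover have "blow e r = z ^ m * w ^ i"
    proof -
      have "blow e (polyY - const_bpoly c * polyX) = polyX * polyY"
        by (simp add: Slope blow_polyX blow_polyY algebra_simps)
      then have "blow e r = (polyX * polyY) ^ i * polyX ^ (m - i)"
        by (simp add: r_def blow_polyX) (simp add: Slope)
      also have "\<dots> = polyX ^ (i + (m - i)) * polyY ^ i"
        by (simp only: power_add power_mult_distrib mult_ac)
      finally show ?thesis using that by (simp add: z_def w_def Slope)
    qed
    ultimately show ?thesis unfolding S_def
      by (intro CollectI exI[of _ r] exI[of _ "w ^ i"]) simp
  next
    case Vertical
    define r where "r = polyX ^ i * polyY ^ (m - i)"
    have "ord_ge m r"
      using ord_power[of polyX polyY i "m - i"] that by (simp add: r_def)
    moreover have "blow e r = z ^ m * w ^ i"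
    proof -
      have "blow e r = (polyY * polyX) ^ i * polyY ^ (m - i)"
        by (simp add: r_def blow_polyX blow_polyY) (simp add: Vertical)
      also have "\<dots> = polyY ^ (i + (m - i)) * polyX ^ i"
        by (simp only: power_add power_mult_distrib mult_ac)
      finally show ?thesis using that by (simp add: z_def w_def Vertical)
    qed
    ultimately show ?thesis unfolding S_def
      by (intro CollectI exI[of _ r] exI[of _ "w ^ i"]) simp
  qed
  \<comment> \<open>The generator with nonzero part of degree m is w^r s + z g; inverting the unit s
    expresses w^r as a multiple of z modulo (p', q').\<close>
  obtain r q1 where r: "r \<le> m" and wr: "local_ideal p' q' (w ^ r - z * q1)"
  proof -
    obtain F r s g where F: "F = p' \<or> F = q'"
      and rs: "F = w ^ r * s + z * g" "at_origin s \<noteq> 0" "r \<le> m"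
    proof (cases "hom_part m p = 0")
      case False
      show ?thesis
        by (rule blow_residue[OF ord(1) False p']) (rule that[of p'], simp_all add: z_def w_def)
    next
      case True
      then have "hom_part m q \<noteq> 0" using m by simp
      show ?thesis
        by (rule blow_residue[OF ord(2) \<open>hom_part m q \<noteq> 0\<close> q'])
          (rule that[of q'], simp_all add: z_def w_def)
    qed
    have F: "local_ideal p' q' (a * F)" for a
      using F local_ideal_lin[of p' q' a 0] local_ideal_lin[of p' q' 0 a] by auto
    obtain t where t: "local_ideal p' q' (s * t - 1)"
      using local_ideal_unit_inverse[OF locally_coprime_blow[OF assms] rs(2)] .
    have "t * F - w ^ r * (s * t - 1) = w ^ r - z * (- (g * t))"
      by (simp add: rs(1) algebra_simps)
    with local_ideal_diff[OF F local_ideal_mult[OF t]] have "local_ideal p' q' (w ^ r - z * (- (g * t)))"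
      by metis
    then show thesis using that rs(3) by blast
  qed
  obtain K where K: "local_ideal p' q' (z ^ K)"
    using locally_coprimeD(1)[OF locally_coprime_blow[OF assms] zw] by blast
  have step: "z ^ n * t \<in> S" if IH: "\<And>t. z ^ Suc n * t \<in> S" for n t
  proof -
    have w_in: "z ^ n * w ^ i \<in> S" for i
    proof (cases "i \<le> m")
      case True
      then show ?thesis by (simp add: S_w S_z_power)
    next
      case False
      \<comment> \<open>For i > m a factor w^r is traded for a multiple of z, which the induction
        hypothesis covers.\<close>
      then have "w ^ i = w ^ (i - r) * w ^ r" using r by (simp flip: power_add)
      then have "z ^ n * w ^ i = (z ^ n * w ^ (i - r)) * (w ^ r - z * q1) + z ^ Suc n * (q1 * w ^ (i - r))"
        by (simp add: algebra_simps)
      then show ?thesis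
        using S_add[OF S_ideal[OF local_ideal_mult[OF wr]] IH] by simp
    qed
    obtain f g where fg: "t = poly (map_poly const_bpoly f) w + z * g"
      using decompose_coordinates[OF zw] .
    have "poly (map_poly const_bpoly f) w = (\<Sum>i\<le>degree f. const_bpoly (coeff f i) * w ^ i)"
      by (subst (1) poly_as_sum_of_monoms[of f, symmetric]) (simp only: up.sum up_monom)
    then have "z ^ n * t = (\<Sum>i\<le>degree f. const_bpoly (coeff f i) * (z ^ n * w ^ i)) + z ^ Suc n * g"
      unfolding fg by (simp add: algebra_simps sum_distrib_left)
    then show ?thesis
      by (simp only:) (intro S_add S_sum S_const w_in IH)
  qed
  have "z ^ (K - j) * t \<in> S" for j t
  proof (induction j arbitrary: t)
    case 0
    show ?case using S_ideal local_ideal_mult[OF K, of t] by (simp add: mult.commute)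
  next
    case (Suc j)
    show ?case
    proof (cases "j < K")
      case True
      then have "K - j = Suc (K - Suc j)" by simp
      then show ?thesis using Suc.IH step by metis
    next
      case False
      then show ?thesis using Suc.IH[of t] by simp
    qed
  qed
  from this[of K t] show ?thesis by (simp add: S_def z_def)
qed

text \<open>
  The independent family upstairs is lifted to functions of positive order, to which the constant 1
  can be added.
\<close>

lemma colength_blow:
  assumes lc: "locally_coprime p q" and ord: "ord_ge m p" "ord_ge m q"
    and m: "hom_part m p \<noteq> 0 \<or> hom_part m q \<noteq> 0"
    and p': "blow e p = exceptional_eq e ^ m * p'" and q': "blow e q = exceptional_eq e ^ m * q'"
    and base: "at_origin p = 0" "at_origin q = 0"
    and N: "colength_le p q (Suc N)"
  shows "colength_le p' q' N"
  unfolding colength_le_def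
proof (intro allI impI)
  fix n b assume ind: "independent_mod p' q' n b"
  have "m \<noteq> 0"
  proof
    assume "m = 0"
    then show False using m base by (simp add: hom_part_0)
  qed
  have "\<forall>i. \<exists>r r'. ord_ge m r \<and> blow e r = exceptional_eq e ^ m * r' \<and> local_ideal p' q' (r' - b i)"
    using blow_quotient_surjective[OF lc ord m p' q'] by blast
  then obtain r r' where r: "\<And>i. ord_ge m (r i)" "\<And>i. blow e (r i) = exceptional_eq e ^ m * r' i"
    "\<And>i. local_ideal p' q' (r' i - b i)"
    by metis
  have r0: "at_origin (r i) = 0" for i
    using ord_ge_mono[OF r(1)[of i], of 1] \<open>m \<noteq> 0\<close> by (simp add: ord_ge_1[simplified])
  define b1 where "b1 = case_nat 1 r"
  have "independent_mod p q (Suc n) b1"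
    unfolding independent_mod_def
  proof (intro allI impI)
    fix c i
    assume "local_ideal p q (\<Sum>i<Suc n. const_bpoly (c i) * b1 i)" and i: "i < Suc n"
    then have I: "local_ideal p q (const_bpoly (c 0) + (\<Sum>i<n. const_bpoly (c (Suc i)) * r i))"
      by (simp add: b1_def sum.lessThan_Suc_shift del: sum.lessThan_Suc)
    then obtain s u v where s: "at_origin s \<noteq> 0"
      "s * (const_bpoly (c 0) + (\<Sum>i<n. const_bpoly (c (Suc i)) * r i)) = u * p + v * q"
      by (rule local_idealE)
    \<comment> \<open>The generators and all lifts vanish at the origin, the lifts because m \<ge>
      1; so evaluation there isolates the coefficient of 1, and the remaining relation can be
      transported upstairs.\<close>
    have "c 0 = 0"
      using arg_cong[OF s(2), of at_origin] s(1) by (simp add: base at_origin.sum r0)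
    then have "local_ideal p q (\<Sum>i<n. const_bpoly (c (Suc i)) * r i)" using I by simp
    then have "local_ideal p' q' (\<Sum>i<n. const_bpoly (c (Suc i)) * r' i)"
      by (rule local_ideal_blow[OF _ p' q']) (simp add: blow.sum r(2) sum_distrib_left mult_ac)
    then have "local_ideal p' q' ((\<Sum>i<n. const_bpoly (c (Suc i)) * r' i) -
        (\<Sum>i<n. const_bpoly (c (Suc i)) * (r' i - b i)))"
      by (rule local_ideal_diff) (intro local_ideal_sum local_ideal_mult r)
    then have "local_ideal p' q' (\<Sum>i<n. const_bpoly (c (Suc i)) * b i)"
      by (simp add: algebra_simps sum_subtractf)
    then have "\<forall>i<n. c (Suc i) = 0" 
      using ind[unfolded independent_mod_def, rule_format, of "\<lambda>i. c (Suc i)"] by blast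
    then show "c i = 0" using \<open>c 0 = 0\<close> i by (cases i) auto
  qed
  then have "Suc n \<le> Suc N" using N unfolding colength_le_def by blast
  then show "n \<le> N" by simp
qed

section \<open>First integrals and strict transforms\<close>

text \<open>This says that P dx + Q dy and g df - f dg have zero wedge product, i.e. f / g is
  constant along the leaves. Being free of denominators, it keeps its meaning where g
  vanishes.\<close>

definition form_integral :: "bpoly \<Rightarrow> bpoly \<Rightarrow> bpoly \<Rightarrow> bpoly \<Rightarrow> bool" where
  "form_integral P Q f g \<longleftrightarrow> P * (pdy f * g - f * pdy g) = Q * (pdx f * g - f * pdx g)"

lemma form_integral_commute: "form_integral P Q f g \<Longrightarrow> form_integral P Q g f"
proof -
  have "pdx g * f - g * pdx f = - (pdx f * g - f * pdx g)"
    "pdy g * f - g * pdy f = - (pdy f * g - f * pdy g)"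
    by (simp_all add: algebra_simps)
  then show "form_integral P Q f g \<Longrightarrow> form_integral P Q g f"
    by (simp only: form_integral_def mult_minus_right neg_equal_iff_equal)
qed

lemma form_integral_shift:
  assumes "form_integral P Q f g"
  shows "form_integral P Q (f - const_bpoly c * g) g"
proof -
  have "pdx (f - const_bpoly c * g) * g - (f - const_bpoly c * g) * pdx g = pdx f * g - f * pdx g"
    "pdy (f - const_bpoly c * g) * g - (f - const_bpoly c * g) * pdy g = pdy f * g - f * pdy g"
    by (simp_all add: pdx.mult pdy.mult algebra_simps)
  then show ?thesis using assms by (simp only: form_integral_def)
qed

text \<open>The wedge product pulls back to its substitution times the Jacobian determinant. The
  ring is arbitrary because this is applied to blowups (polynomials) and to the chart change
  (rational functions).\<close>

lemma pullback_wedge: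
  fixes \<phi> \<psi> :: "'k::comm_ring_1"
  assumes D1: "derivation D1" and D2: "derivation D2" and emb: "ring_hom_1 emb"
    and const: "\<And>c. D1 (emb c) = 0" "\<And>c. D2 (emb c) = 0"
    and integral: "form_integral P Q f g"
    and A: "pullback emb D1 D2 (\<phi>, \<psi>) (P, Q) = (A1, A2)"
    and F: "F = eval2 emb f \<phi> \<psi>" and G: "G = eval2 emb g \<phi> \<psi>"
  shows "A1 * (D2 F * G - F * D2 G) = A2 * (D1 F * G - F * D1 G)"
proof -
  interpret E: ring_hom_1 "\<lambda>p. eval2 emb p \<phi> \<psi>" by (rule ring_hom_1_eval2[OF emb])
  let ?E = "\<lambda>p. eval2 emb p \<phi> \<psi>"
  define x where "x = pdx f * g - f * pdx g"
  define y where "y = pdy f * g - f * pdy g"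
  have PQ: "?E P * ?E y = ?E Q * ?E x"
    unfolding E.mult[symmetric] using integral by (simp add: form_integral_def x_def y_def)
  have D1F: "D1 F * G - F * D1 G = ?E x * D1 \<phi> + ?E y * D1 \<psi>"
    unfolding F G derivation.chain_rule[OF D1 emb const(1)] x_def y_def by (simp add: algebra_simps)
  have D2F: "D2 F * G - F * D2 G = ?E x * D2 \<phi> + ?E y * D2 \<psi>"
    unfolding F G derivation.chain_rule[OF D2 emb const(2)] x_def y_def by (simp add: algebra_simps)
  have A12: "A1 = ?E P * D1 \<phi> + ?E Q * D1 \<psi>" "A2 = ?E P * D2 \<phi> + ?E Q * D2 \<psi>"
    using A by (auto simp: pullback_def)
  show ?thesis
  proof -
    have eq: "(p * a + q * b) * (x' * c + y' * d) = (p * c + q * d) * (x' * a + y' * b) + (p * y' - q * x') * (a * d - b * c)"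
      for p q a b c d x' y' :: 'k
      by (simp add: algebra_simps)
    show ?thesis unfolding D1F D2F A12 by (subst eq) (simp add: PQ)
  qed
qed

text \<open>Contraction of P dx + Q dy with the Euler field. For a form of order k \<ge> 1 its part
  of degree k + 1 is the tangent cone, which vanishes exactly in the terminal dicritical
  case.\<close>

definition radial :: "bpoly \<Rightarrow> bpoly \<Rightarrow> bpoly" where
  "radial P Q = polyX * P + polyY * Q"

lemma ord_ge_radial: "ord_ge k P \<Longrightarrow> ord_ge k Q \<Longrightarrow> ord_ge (Suc k) (radial P Q)"
  unfolding radial_def by (intro ord_ge_add ord_ge_mult_X ord_ge_mult_Y)

lemma hom_part_radial:
  "hom_part (Suc k) (radial P Q) = polyX * hom_part k P + polyY * hom_part k Q"
  by (simp add: radial_def hom_part_add hom_part_mult_X hom_part_mult_Y)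

lemma hom_part_radial_nonzero:
  "hom_part (Suc k) (radial P Q) \<noteq> 0 \<Longrightarrow> hom_part k P \<noteq> 0 \<or> hom_part k Q \<noteq> 0"
  by (auto simp: hom_part_radial)

lemma terminal_dicritical_iff:
  assumes "ord_ge k P" "ord_ge k Q" "hom_part k P \<noteq> 0 \<or> hom_part k Q \<noteq> 0"
  shows "terminal_dicritical (P, Q) \<longleftrightarrow> k \<ge> 1 \<and> hom_part (Suc k) (radial P Q) = 0"
  unfolding terminal_dicritical_def singularity_def jet1_def jet2_def jet_order_eqI[OF assms]
  by (simp add: hom_part_radial)

lemma divide_out_eqI:
  assumes A: "A = z ^ k * A'" and B: "B = z ^ k * B'" and "z \<noteq> 0" and ndvd: "\<not> (z dvd A' \<and> z dvd B')"
  shows "divide_out z (A, B) = (A', B')"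
proof -
  have greatest: "(GREATEST k. z ^ k dvd A \<and> z ^ k dvd B) = k"
  proof (rule Greatest_equality)
    show "z ^ k dvd A \<and> z ^ k dvd B" by (simp add: A B)
    fix n assume n: "z ^ n dvd A \<and> z ^ n dvd B"
    show "n \<le> k"
    proof (rule ccontr)
      assume "\<not> n \<le> k"
      then have d: "z ^ Suc k dvd z ^ n" by (intro le_imp_power_dvd) simp
      have "z ^ k * z dvd z ^ k * A'"
        using dvd_trans[OF d conjunct1[OF n]] unfolding A power_Suc2 .
      moreover have "z ^ k * z dvd z ^ k * B'"
        using dvd_trans[OF d conjunct2[OF n]] unfolding B power_Suc2 .
      ultimately have "z dvd A'" "z dvd B'"
        using \<open>z \<noteq> 0\<close> by (simp_all only: dvd_mult_cancel_left power_eq_0_iff) simp_all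
      then show False using ndvd by blast
    qed
  qed
  show ?thesis
    unfolding divide_out_def fst_conv snd_conv greatest Let_def using \<open>z \<noteq> 0\<close> by (simp add: A B)
qed

text \<open>What the differentials of the blowup map do to the already transformed coefficients. The
  coefficient belonging to the other coordinate is divisible by the exceptional equation, which
  makes the exceptional divisor invariant.\<close>

fun strict_coeffs :: "direction \<Rightarrow> bpoly \<Rightarrow> bpoly \<Rightarrow> form" where
  "strict_coeffs (Slope c) P Q = (P + (polyY + const_bpoly c) * Q, polyX * Q)"
| "strict_coeffs Vertical P Q = (polyY * P, polyX * P + Q)"

text \<open>The nondicritical case: as the tangent cone is not 0, exactly z^k is divided out of the
  pullback, and \<open>strict_coeffs\<close> is the strict transform.\<close>

locale invariant_exceptional =
  fixes P Q P' Q' :: bpoly and k :: nat and e :: direction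
  assumes ord: "ord_ge k P" "ord_ge k Q"
    and radial: "hom_part (Suc k) (radial P Q) \<noteq> 0"
    and P': "blow e P = exceptional_eq e ^ k * P'" and Q': "blow e Q = exceptional_eq e ^ k * Q'"
begin

lemma pullback_eq:
  "pullback_poly (blowup_map e) (P, Q) =
    (exceptional_eq e ^ k * fst (strict_coeffs e P' Q'), exceptional_eq e ^ k * snd (strict_coeffs e P' Q'))"
  using P' Q' unfolding blow_def pullback_def
  by (cases e) (simp_all add: pdx_mult pdy_mult algebra_simps)

lemma exceptional_not_dvd_strict_coeffs:
  "\<not> (exceptional_eq e dvd fst (strict_coeffs e P' Q') \<and> exceptional_eq e dvd snd (strict_coeffs e P' Q'))"
proof -
  \<comment> \<open>The factor after z^(k + 1) is the coefficient of dz in the strict transform, so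
    the nonzero tangent cone keeps z from dividing it.\<close>
  have "blow e (radial P Q) = exceptional_eq e ^ Suc k * (blow_u e * P' + blow_v e * Q')"
    unfolding radial_def by (simp add: blow_polyX blow_polyY P' Q' algebra_simps)
  then have "\<not> exceptional_eq e dvd blow_u e * P' + blow_v e * Q'"
    by (rule exceptional_not_dvd_blow_factor[OF ord_ge_radial[OF ord] radial])
  then show ?thesis by (cases e) auto
qed

lemma strict_transform_eq: "strict_transform e (P, Q) = strict_coeffs e P' Q'"
  unfolding strict_transform_def pullback_eq
  by (subst divide_out_eqI[OF refl refl]) (simp_all add: exceptional_not_dvd_strict_coeffs[simplified])

text \<open>The new coefficients arise from P' and Q' by a matrix of determinant z, so z times the
  ideal (P', Q') lies in the new ideal; the witnesses below come from the adjugate matrix.\<close>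

lemma locally_coprime_strict_coeffs:
  assumes lc: "locally_coprime P Q"
  shows "locally_coprime (fst (strict_coeffs e P' Q')) (snd (strict_coeffs e P' Q'))"
proof -
  have lc': "locally_coprime P' Q'"
    using locally_coprime_blow[OF lc ord hom_part_radial_nonzero[OF radial] P' Q'] .
  obtain K where "local_ideal P' Q' (exceptional_eq e ^ K)"
    using locally_coprimeD(1)[OF lc' coordinates_direction] by blast
  then obtain s a b where s: "at_origin s \<noteq> 0" "s * exceptional_eq e ^ K = a * P' + b * Q'"
    by (rule local_idealE)
  have eq: "s * exceptional_eq e ^ Suc K = exceptional_eq e * (a * P' + b * Q')"
    by (simp flip: s(2))
  have "local_ideal (fst (strict_coeffs e P' Q')) (snd (strict_coeffs e P' Q')) (exceptional_eq e ^ Suc K)"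
  proof (cases e)
    case (Slope c)
    show ?thesis
      by (rule local_idealI[OF s(1), of _ "polyX * a" _ "b - (polyY + const_bpoly c) * a"])
        (use eq in \<open>simp add: Slope algebra_simps\<close>)
  next
    case Vertical
    show ?thesis
      by (rule local_idealI[OF s(1), of _ "a - polyX * b" _ "polyY * b"])
        (use eq in \<open>simp add: Vertical algebra_simps\<close>)
  qed
  then show ?thesis
    by (rule locally_coprimeI[OF coordinates_direction _ exceptional_not_dvd_strict_coeffs])
qed

lemma form_integral_strict_coeffs:
  assumes integral: "form_integral P Q f g"
    and f': "blow e f = exceptional_eq e ^ m * f'" and g': "blow e g = exceptional_eq e ^ m * g'"
  shows "form_integral (fst (strict_coeffs e P' Q')) (snd (strict_coeffs e P' Q')) f' g'"
proof -
  let ?z = "exceptional_eq e"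
  obtain A B where AB: "strict_coeffs e P' Q' = (A, B)" by fastforce
  have "?z ^ k * A * (pdy (?z ^ m * f') * (?z ^ m * g') - ?z ^ m * f' * pdy (?z ^ m * g')) =
      ?z ^ k * B * (pdx (?z ^ m * f') * (?z ^ m * g') - ?z ^ m * f' * pdx (?z ^ m * g'))"
    by (rule pullback_wedge[OF pdx.derivation_axioms pdy.derivation_axioms const_bpoly.ring_hom_1_axioms _ _ integral
          pullback_eq[unfolded blowup_map_eq AB fst_conv snd_conv]])
      (simp_all add: f'[unfolded blow_def] g'[unfolded blow_def])
  then have "(?z ^ k * (?z ^ m)\<^sup>2) * (A * (pdy f' * g' - f' * pdy g')) =
      (?z ^ k * (?z ^ m)\<^sup>2) * (B * (pdx f' * g' - f' * pdx g'))"
    unfolding pdx.scaled_wronskian pdy.scaled_wronskian by (simp only: mult_ac)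
  then show ?thesis by (simp add: form_integral_def AB)
qed

end

text \<open>Of two proportional forms, one with isolated zeros divides the other near the origin.
  The multiplier comes from Bezout: if a P + b Q = s x^K, then H = a A + b B satisfies P H = s x^K A
  and Q H = s x^K B, and x^K divides H because the prime x does not divide both P and Q.\<close>

lemma proportional_coprime:
  assumes lc: "locally_coprime P Q" and eq: "P * B = Q * A"
  obtains u h where "at_origin u \<noteq> 0" "u * A = P * h" "u * B = Q * h"
proof -
  have c: "coordinates polyX polyY" by (simp add: coordinates_def)
  obtain K where "local_ideal P Q (polyX ^ K)" using locally_coprimeD(1)[OF lc c] by blast
  then obtain s a b where s: "at_origin s \<noteq> 0" "s * polyX ^ K = a * P + b * Q"
    by (rule local_idealE)
  define H where "H = a * A + b * B"
  have "polyX ^ K * (s * A) = (s * polyX ^ K) * A" by (simp add: mult_ac)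
  also have "\<dots> = P * H" unfolding s H_def using eq by (simp add: algebra_simps)
  finally have 1: "polyX ^ K * (s * A) = P * H" .
  have "polyX ^ K * (s * B) = (s * polyX ^ K) * B" by (simp add: mult_ac)
  also have "\<dots> = Q * H" unfolding s H_def using eq by (simp add: algebra_simps)
  finally have 2: "polyX ^ K * (s * B) = Q * H" .
  have "polyX ^ K dvd P * H" "polyX ^ K dvd Q * H" by (simp_all flip: 1 2)
  moreover have "\<not> polyX dvd P \<or> \<not> polyX dvd Q" using locally_coprimeD(2)[OF lc c] by blast
  ultimately have "polyX ^ K dvd H"
    using prime_power_dvd_multD[OF prime_elem_coordinate[OF c], of K _ H] by (cases "K = 0") auto
  then obtain h where h: "H = polyX ^ K * h" by blast
  have "polyX ^ K * (s * A) = polyX ^ K * (P * h)" "polyX ^ K * (s * B) = polyX ^ K * (Q * h)"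
    unfolding 1 2 h by (simp_all add: mult_ac)
  then have "s * A = P * h" "s * B = Q * h" by simp_all
  then show thesis using that s(1) by blast
qed

section \<open>The first integral on an invariant exceptional divisor\<close>

lemma hom_part_theta:
  "hom_part m (radial (pdx f) (pdy f)) = const_bpoly (of_nat m) * hom_part m f"
proof (cases m)
  case 0
  then show ?thesis by (simp add: hom_part_0 radial_def)
next
  case (Suc n)
  then show ?thesis by (simp add: hom_part_radial hom_part_pdx hom_part_pdy euler)
qed

lemma ord_ge_theta: "ord_ge m f \<Longrightarrow> ord_ge m (radial (pdx f) (pdy f))"
  by (simp add: ord_ge_def hom_part_theta)

lemma radial_wronskian:
  "radial (pdx f * g - f * pdx g) (pdy f * g - f * pdy g) =
    radial (pdx f) (pdy f) * g - f * radial (pdx g) (pdy g)"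
  by (simp add: radial_def algebra_simps)

text \<open>
  Off the dicritical case the first integral is constant on the exceptional divisor: the radial
  contraction of \<open>g df - f dg\<close> always vanishes to order \<open>2m + 1\<close>, which forces
  \<open>g df - f dg\<close> itself to vanish to order \<open>2m\<close>.
\<close>

lemma leading_wronskian_eq_0:
  assumes integral: "form_integral P Q f g" and lc: "locally_coprime P Q"
    and k: "ord_ge k P" "ord_ge k Q" "hom_part (Suc k) (radial P Q) \<noteq> 0"
    and m: "ord_ge m f" "ord_ge m g" "m \<ge> 1"
  shows "pdy (hom_part m f) * hom_part m g = hom_part m f * pdy (hom_part m g)"
proof -
  define A where "A = pdx f * g - f * pdx g"
  define B where "B = pdy f * g - f * pdy g"
  obtain u h where u: "at_origin u \<noteq> 0" "u * A = P * h" "u * B = Q * h"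
    using proportional_coprime[OF lc, of B A] integral by (auto simp: form_integral_def A_def B_def)
  obtain n where n: "m = Suc n" using m(3) by (cases m) auto
  \<comment> \<open>By Euler's identity both products contribute m times the same form in degree 2
    m, and these cancel.\<close>
  have "ord_ge (Suc (m + m)) (radial A B)"
    unfolding ord_ge_Suc A_def B_def radial_wronskian using m
    by (auto intro!: ord_ge_diff ord_ge_mult ord_ge_theta
        simp: hom_part_diff hom_part_mult_ord_ge ord_ge_theta hom_part_theta algebra_simps)
  then have V: "ord_ge (Suc (m + m)) (u * radial A B)"
    using ord_ge_mult[of 0 u] by simp
  have "u * radial A B = polyX * (u * A) + polyY * (u * B)"
    by (simp add: radial_def algebra_simps)
  also have "\<dots> = radial P Q * h" unfolding u by (simp add: radial_def algebra_simps)
  finally have Wh: "u * radial A B = radial P Q * h" .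
  have "ord_ge (m + m) (u * B)"
  proof (cases "h = 0")
    case True
    then show ?thesis by (simp add: u)
  next
    case False
    then obtain l where l: "ord_ge l h" "hom_part l h \<noteq> 0" by (rule order_exists)
    \<comment> \<open>As \<open>radial P Q\<close> has order exactly k + 1, the order l of h
      satisfies k + l \<ge> 2 m, and Q h has order at least 2 m.\<close>
    have "hom_part (Suc k + l) (radial P Q * h) \<noteq> 0"
      using hom_part_mult_ord_ge[OF ord_ge_radial[OF k(1,2)] l(1)] k(3) l(2) by simp
    then have "\<not> Suc k + l < Suc (m + m)"
      using V unfolding Wh ord_ge_def by blast
    then show ?thesis
      using ord_ge_mono[OF ord_ge_mult[OF k(2) l(1)]] unfolding u by simp
  qed
  \<comment> \<open>A priori B has order at least 2 m - 1 = n + m; its part of that degree, the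
    Wronskian of the parts of degree m, must therefore vanish.\<close>
  moreover have "ord_ge (n + m) B"
    unfolding B_def
    using ord_ge_mult[of n "pdy f" m g] ord_ge_mult[of m f n "pdy g"] ord_ge_pdy[OF m(1)] ord_ge_pdy[OF m(2)] m n
    by (intro ord_ge_diff) (simp_all add: add.commute)
  then have "hom_part (0 + (n + m)) (u * B) = hom_part 0 u * hom_part (n + m) B"
    by (intro hom_part_mult_ord_ge) simp_all
  ultimately have "hom_part 0 u * hom_part (n + m) B = 0"
    using n by (simp add: ord_ge_def)
  then have "hom_part (n + m) B = 0"
    using u(1) by (simp add: hom_part_0 const_bpoly_def)
  moreover have "hom_part (n + m) (pdy f * g) = hom_part n (pdy f) * hom_part m g"
    using ord_ge_pdy[OF m(1)] m(2) n by (intro hom_part_mult_ord_ge) simp_all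
  moreover have "hom_part (m + n) (f * pdy g) = hom_part m f * hom_part n (pdy g)"
    using ord_ge_pdy[OF m(2)] m(1) n by (intro hom_part_mult_ord_ge) simp_all
  ultimately show ?thesis
    by (simp add: B_def hom_part_diff hom_part_pdy add.commute[of m n] flip: n)
qed

text \<open>At a root t of g differentiation lowers the order by exactly one (characteristic 0). If
  f did not vanish at t, the two sides would have different orders there.\<close>

lemma wronskian_0_common_root:
  fixes f g :: "complex poly"
  assumes eq: "pderiv f * g = f * pderiv g" and "g \<noteq> 0" "poly g t = 0"
  shows "poly f t = 0"
proof (rule ccontr)
  assume f: "poly f t \<noteq> 0"
  have "pderiv g \<noteq> 0"
  proof
    assume "pderiv g = 0"
    then obtain a where "g = [:a:]" by (auto simp: pderiv_eq_0_iff elim: degree_eq_zeroE)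
    then show False using assms(2,3) by simp
  qed
  then have nz: "f * pderiv g \<noteq> 0" using f by auto
  then have "order t (pderiv f) + order t g = order t f + order t (pderiv g)"
    using order_mult[of "f" "pderiv g" t] order_mult[of "pderiv f" g t] eq by simp
  moreover have "order t f = 0" using f by (simp add: order_root)
  moreover have "order t g = Suc (order t (pderiv g))"
    using order_pderiv assms(2,3) by blast
  ultimately show False by simp
qed

lemma wronskian_0_cases:
  fixes f g :: "complex poly"
  assumes eq: "pderiv f * g = f * pderiv g"
  shows "(\<exists>t. poly f t = 0 \<and> poly g t = 0) \<or> degree f = 0 \<and> degree g = 0"
proof -
  have main: "(\<exists>t. poly f t = 0 \<and> poly g t = 0) \<or> degree f = 0 \<and> degree g = 0"
    if eq: "pderiv f * g = f * pderiv g" and "g \<noteq> 0" for f g :: "complex poly"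
  proof (cases "degree g = 0")
    case True
    then have "pderiv g = 0" by (simp add: pderiv_eq_0_iff)
    then have "pderiv f = 0" using eq \<open>g \<noteq> 0\<close> by simp
    then show ?thesis using True by (simp add: pderiv_eq_0_iff)
  next
    case False
    then have "\<not> constant (poly g)" by (simp add: constant_degree)
    then obtain t where "poly g t = 0" using fundamental_theorem_of_algebra by blast
    then show ?thesis using wronskian_0_common_root[OF eq \<open>g \<noteq> 0\<close>] by blast
  qed
  show ?thesis
  proof (cases "g = 0")
    case False
    then show ?thesis using main eq by blast
  next
    case True
    show ?thesis
    proof (cases "f = 0")
      case False
      then show ?thesis using main[of g f] eq by (auto simp: mult.commute)
    qed (simp add: True)
  qed
qed

interpretation pderiv: derivation "pderiv :: complex poly \<Rightarrow> complex poly"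
  by unfold_locales (simp_all add: pderiv_add pderiv_mult algebra_simps)

text \<open>Setting x = 1 leaves two polynomials in one variable with zero Wronskian. A common root
  t is the direction of slope t. If instead both are constant, only x^m occurs, and it vanishes in
  the vertical direction because m \<ge> 1.\<close>

lemma homogeneous_common_zero:
  assumes "pdy (hom_part m f) * hom_part m g = hom_part m f * pdy (hom_part m g)" "m \<ge> 1"
  obtains e where "eval2 (\<lambda>c. c) (hom_part m f) (at_origin (blow_u e)) (at_origin (blow_v e)) = 0"
    "eval2 (\<lambda>c. c) (hom_part m g) (at_origin (blow_u e)) (at_origin (blow_v e)) = 0"
proof -
  define r where "r = (\<lambda>h. eval2 (\<lambda>c. [:c:]) h 1 [:0, 1:])"
  interpret r: ring_hom_1 r unfolding r_def by unfold_locales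
  have pderiv_r: "pderiv (r h) = r (pdy h)" for h
    unfolding r_def by (subst pderiv.chain_rule[OF ring_hom_1_const_poly]) (simp_all add: pderiv_pCons)
  have poly_r: "poly (r h) c = eval2 (\<lambda>c. c) h 1 c" for h c
  proof -
    have "ring_hom_1 (\<lambda>q. poly q c)" by unfold_locales simp_all
    from ring_hom_1_apply_eval2[OF this ring_hom_1_const_poly, of h 1 "[:0, 1:]"]
    show ?thesis by (simp add: r_def)
  qed
  have vertical: "eval2 (\<lambda>c. c) (hom_part m h) 0 1 = 0" if "degree (r (hom_part m h)) = 0" for h
  proof -
    have "r (hom_part m h) = (\<Sum>i\<le>m. monom (coeff2 h i (m - i)) (m - i))"
      unfolding r_def eval2_hom_part[OF ring_hom_1_const_poly]
      by (intro sum.cong) (simp_all add: monom_altdef)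
    then have "coeff (r (hom_part m h)) m = (\<Sum>i\<le>m. coeff (monom (coeff2 h i (m - i)) (m - i)) m)"
      by (simp only: coeff_sum)
    also have "\<dots> = (\<Sum>i\<le>m. if i = 0 then coeff2 h 0 m else 0)"
      using assms(2) by (intro sum.cong) auto
    finally have "coeff (r (hom_part m h)) m = (\<Sum>i\<le>m. if i = 0 then coeff2 h 0 m else 0)" .
    moreover have "coeff (r (hom_part m h)) m = 0"
      using that assms(2) by (simp add: coeff_eq_0)
    moreover have "eval2 (\<lambda>c. c) (hom_part m h) 0 1 = (\<Sum>i\<le>m. if i = 0 then coeff2 h 0 m else 0)"
      unfolding eval2_hom_part[OF ring_hom_1_id] by (intro sum.cong) (auto simp: power_0_left)
    ultimately show ?thesis by simp
  qed
  have "pderiv (r (hom_part m f)) * r (hom_part m g) = r (hom_part m f) * pderiv (r (hom_part m g))"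
    unfolding pderiv_r r.mult[symmetric] assms(1) ..
  from wronskian_0_cases[OF this] show thesis
  proof (elim disjE exE conjE)
    fix t assume "poly (r (hom_part m f)) t = 0" "poly (r (hom_part m g)) t = 0"
    then show thesis using that[of "Slope t"] by (simp add: poly_r)
  next
    assume "degree (r (hom_part m f)) = 0" "degree (r (hom_part m g)) = 0"
    then show thesis using that[of Vertical] vertical by simp
  qed
qed

lemma base_point_on_exceptional:
  assumes "form_integral P Q f g" "locally_coprime P Q"
    and k: "ord_ge k P" "ord_ge k Q" "hom_part (Suc k) (radial P Q) \<noteq> 0"
    and m: "ord_ge m f" "ord_ge m g" "m \<ge> 1"
  obtains e f' g' where "blow e f = exceptional_eq e ^ m * f'" "blow e g = exceptional_eq e ^ m * g'"
    "at_origin f' = 0" "at_origin g' = 0"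
proof -
  obtain e where e: "eval2 (\<lambda>c. c) (hom_part m f) (at_origin (blow_u e)) (at_origin (blow_v e)) = 0"
    "eval2 (\<lambda>c. c) (hom_part m g) (at_origin (blow_u e)) (at_origin (blow_v e)) = 0"
    using homogeneous_common_zero[OF leading_wronskian_eq_0[OF assms] m(3)] .
  obtain f' where f': "blow e f = exceptional_eq e ^ m * f'" using blow_factor[OF m(1)] .
  obtain g' where g': "blow e g = exceptional_eq e ^ m * g'" using blow_factor[OF m(2)] .
  show thesis
    using that[OF f' g'] e at_origin_blow_factor[OF m(1) f'] at_origin_blow_factor[OF m(2) g'] by simp
qed

lemma locally_coprime_nonzero:
  assumes "locally_coprime p q"
  shows "p \<noteq> 0 \<or> q \<noteq> 0"
  using locally_coprimeD(2)[OF assms, of polyX polyY] by (auto simp: coordinates_def)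

text \<open>The descent shared by both inductions on the colength: when the exceptional divisor is
  invariant, all data reappear at some point of it, with the bound lowered by one.\<close>

lemma base_point_step:
  assumes integral: "form_integral P Q f g" and lc: "locally_coprime P Q" and fg: "locally_coprime f g"
    and base: "at_origin f = 0" "at_origin g = 0" and N: "colength_le f g (Suc N)"
    and k: "ord_ge k P" "ord_ge k Q" "hom_part (Suc k) (radial P Q) \<noteq> 0"
  obtains e P1 Q1 f' g' where "strict_transform e (P, Q) = (P1, Q1)" "form_integral P1 Q1 f' g'"
    "locally_coprime P1 Q1" "locally_coprime f' g'" "at_origin f' = 0" "at_origin g' = 0" "colength_le f' g' N"
proof -
  obtain m where m: "ord_ge m f" "ord_ge m g" "hom_part m f \<noteq> 0 \<or> hom_part m g \<noteq> 0"
    using order_exists2[OF locally_coprime_nonzero[OF fg]] .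
  have "m \<noteq> 0"
  proof
    assume "m = 0"
    then show False using m(3) base by (simp add: hom_part_0)
  qed
  then have "m \<ge> 1" by simp
  obtain e f' g' where e: "blow e f = exceptional_eq e ^ m * f'" "blow e g = exceptional_eq e ^ m * g'"
    "at_origin f' = 0" "at_origin g' = 0"
    using base_point_on_exceptional[OF integral lc k m(1,2) \<open>m \<ge> 1\<close>] .
  obtain P' where P': "blow e P = exceptional_eq e ^ k * P'" using blow_factor[OF k(1)] .
  obtain Q' where Q': "blow e Q = exceptional_eq e ^ k * Q'" using blow_factor[OF k(2)] .
  interpret invariant_exceptional P Q P' Q' k e
    by unfold_locales (fact k P' Q')+
  show thesis
  proof (rule that)
    show "strict_transform e (P, Q) = (fst (strict_coeffs e P' Q'), snd (strict_coeffs e P' Q'))"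
      by (simp only: strict_transform_eq prod.collapse)
    show "form_integral (fst (strict_coeffs e P' Q')) (snd (strict_coeffs e P' Q')) f' g'"
      by (rule form_integral_strict_coeffs[OF integral e(1,2)])
    show "locally_coprime (fst (strict_coeffs e P' Q')) (snd (strict_coeffs e P' Q'))"
      by (rule locally_coprime_strict_coeffs[OF lc])
    show "locally_coprime f' g'" by (rule locally_coprime_blow[OF fg m e(1,2)])
    show "colength_le f' g' N" by (rule colength_blow[OF fg m e(1,2) base N])
  qed (fact e)+
qed

lemma colength_base_point:
  assumes "at_origin f = 0" "at_origin g = 0"
  shows "\<not> colength_le f g 0"
proof -
  have "independent_mod f g 1 (\<lambda>_. 1)"
    unfolding independent_mod_def
  proof (intro allI impI)
    fix c :: "nat \<Rightarrow> complex" and i :: nat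
    assume "local_ideal f g (\<Sum>i<1. const_bpoly (c i) * 1)" and i: "i < 1"
    then obtain s a b where s: "at_origin s \<noteq> 0" "s * const_bpoly (c 0) = a * f + b * g"
      by (auto elim: local_idealE)
    have "at_origin (s * const_bpoly (c 0)) = at_origin (a * f + b * g)"
      by (rule arg_cong[OF s(2)])
    then have "c 0 = 0" using s(1) by (simp add: assms)
    then show "c i = 0" using i by simp
  qed
  then show ?thesis unfolding colength_le_def by (metis not_one_le_zero)
qed

section \<open>Nonsingular points and simple singularities\<close>

definition reduced_point :: "form \<Rightarrow> bool" where
  "reduced_point \<omega> \<longleftrightarrow> jet_order \<omega> = 0 \<or> simple_singularity \<omega>"

lemma ordinary_iff_not_reduced: "ordinary_singularity \<omega> \<longleftrightarrow> \<not> reduced_point \<omega>"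
  by (auto simp: ordinary_singularity_def reduced_point_def singularity_def simple_singularity_def)

definition simple_eigenvalues :: "complex \<Rightarrow> complex \<Rightarrow> bool" where
  "simple_eigenvalues l1 l2 \<longleftrightarrow>
     l1 * l2 \<noteq> 0 \<and> \<not> positive_rational (l1 / l2) \<or> l1 * l2 = 0 \<and> l1\<^sup>2 + l2\<^sup>2 \<noteq> 0"

lemma positive_rational_inverse: "positive_rational z \<Longrightarrow> positive_rational (inverse z)"
  unfolding positive_rational_def
proof (elim exE conjE)
  fix r :: rat assume "0 < r" "z = of_rat r"
  then show "\<exists>r>0. inverse z = of_rat r" by (intro exI[of _ "inverse r"]) (simp add: of_rat_inverse)
qed

lemma positive_rational_add_1: "positive_rational z \<Longrightarrow> positive_rational (z + 1)"
  unfolding positive_rational_def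
proof (elim exE conjE)
  fix r :: rat assume "0 < r" "z = of_rat r"
  then show "\<exists>r>0. z + 1 = of_rat r" by (intro exI[of _ "r + 1"]) (simp add: of_rat_add)
qed

lemma not_positive_rational_minus_1: "\<not> positive_rational (- 1)"
proof
  assume "positive_rational (- 1)"
  then obtain r :: rat where r: "r > 0" "(- 1 :: complex) = of_rat r" by (auto simp: positive_rational_def)
  then have "(of_rat (- 1) :: complex) = of_rat r" by simp
  then have "r = - 1" by (simp only: of_rat_eq_iff)
  then show False using r(1) by simp
qed

lemma simple_eigenvalues_commute: "simple_eigenvalues l1 l2 \<longleftrightarrow> simple_eigenvalues l2 l1"
proof -
  have "positive_rational (l1 / l2) \<longleftrightarrow> positive_rational (l2 / l1)"
    using positive_rational_inverse[of "l1 / l2"] positive_rational_inverse[of "l2 / l1"] by auto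
  then show ?thesis by (auto simp: simple_eigenvalues_def add.commute mult.commute)
qed

lemma simple_eigenvalues_minus: "l \<noteq> 0 \<Longrightarrow> simple_eigenvalues l (- l)"
  using not_positive_rational_minus_1 by (simp add: simple_eigenvalues_def)

lemma simple_eigenvalues_distinct: "simple_eigenvalues l1 l2 \<Longrightarrow> l1 \<noteq> l2"
proof
  assume "simple_eigenvalues l1 l2" "l1 = l2"
  moreover have "positive_rational 1" unfolding positive_rational_def by (rule exI[of _ 1]) simp
  ultimately show False by (auto simp: simple_eigenvalues_def)
qed

text \<open>These are the eigenvalues after the blowup, in the direction of an eigenvector for
  \<open>l1\<close>. The quotient l2 / l1 decreases by 1, so a positive rational value afterwards
  would have been positive rational before; a vanishing \<open>l2\<close> gives the quotient
  -1.\<close>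

lemma simple_eigenvalues_blow:
  assumes "simple_eigenvalues l1 l2"
  shows "simple_eigenvalues l1 (l2 - l1)"
proof -
  have neq: "l1 \<noteq> l2" using simple_eigenvalues_distinct[OF assms] .
  show ?thesis
  proof (cases "l1 = 0 \<or> l2 = 0")
    case True
    then show ?thesis
    proof
      assume "l1 = 0"
      then show ?thesis using neq by (simp add: simple_eigenvalues_def)
    next
      assume "l2 = 0"
      then show ?thesis using neq simple_eigenvalues_minus by simp
    qed
  next
    case False
    then have "\<not> positive_rational (l1 / l2)" using assms by (simp add: simple_eigenvalues_def)
    moreover have "(l2 - l1) / l1 + 1 = l2 / l1" using False by (simp add: field_simps)
    ultimately have "\<not> positive_rational ((l2 - l1) / l1)"
      using positive_rational_add_1[of "(l2 - l1) / l1"] positive_rational_inverse[of "l2 / l1"] by auto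
    then have "simple_eigenvalues (l2 - l1) l1"
      using False neq by (simp add: simple_eigenvalues_def)
    then show ?thesis by (simp only: simple_eigenvalues_commute[of l1])
  qed
qed

lemma jet_order_1I:
  assumes "at_origin P = 0" "at_origin Q = 0" "hom_part 1 P \<noteq> 0 \<or> hom_part 1 Q \<noteq> 0"
  shows "jet_order (P, Q) = 1"
  using assms by (intro jet_order_eqI) (simp_all only: ord_ge_1)

text \<open>The right-hand sides are the trace and the determinant of the linear part; from here on
  they stand for the matrix.\<close>

lemma simple_singularity_iff:
  assumes "jet_order (P, Q) = 1"
  shows "simple_singularity (P, Q) \<longleftrightarrow>
    (\<exists>l1 l2. l1 + l2 = coeff2 Q 1 0 - coeff2 P 0 1 \<and>
       l1 * l2 = coeff2 Q 0 1 * coeff2 P 1 0 - coeff2 Q 1 0 * coeff2 P 0 1 \<and> simple_eigenvalues l1 l2)"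
proof -
  have coeffs: "at_origin (pdx (hom_part 1 p)) = coeff2 p 1 0" "at_origin (pdy (hom_part 1 p)) = coeff2 p 0 1" for p
    by (simp_all add: at_origin_coeff2 coeff2_pdx coeff2_pdy coeff2_hom_part)
  have det: "det (mat z - linear_part (P, Q)) =
      (z - coeff2 Q 1 0) * (z + coeff2 P 0 1) + coeff2 Q 0 1 * coeff2 P 1 0" for z
    unfolding det_2 linear_part_def jet1_def jet2_def assms
    by (simp add: mat_def coeffs[simplified])
  have "eigenvalue_pair (linear_part (P, Q)) l1 l2 \<longleftrightarrow> l1 + l2 = coeff2 Q 1 0 - coeff2 P 0 1 \<and>
       l1 * l2 = coeff2 Q 0 1 * coeff2 P 1 0 - coeff2 Q 1 0 * coeff2 P 0 1" for l1 l2
  proof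
    assume "eigenvalue_pair (linear_part (P, Q)) l1 l2"
    then have eq: "(z - coeff2 Q 1 0) * (z + coeff2 P 0 1) + coeff2 Q 0 1 * coeff2 P 1 0 = (z - l1) * (z - l2)" for z
      by (simp only: eigenvalue_pair_def det)
    have l12: "l1 * l2 = coeff2 Q 0 1 * coeff2 P 1 0 - coeff2 Q 1 0 * coeff2 P 0 1"
      using eq[of 0] by simp
    moreover have "l1 + l2 = coeff2 Q 1 0 - coeff2 P 0 1"
    proof -
      show ?thesis using eq[of 1] l12 by algebra
    qed
    ultimately show "l1 + l2 = coeff2 Q 1 0 - coeff2 P 0 1 \<and>
       l1 * l2 = coeff2 Q 0 1 * coeff2 P 1 0 - coeff2 Q 1 0 * coeff2 P 0 1" by simp
  next
    assume eq: "l1 + l2 = coeff2 Q 1 0 - coeff2 P 0 1 \<and>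
       l1 * l2 = coeff2 Q 0 1 * coeff2 P 1 0 - coeff2 Q 1 0 * coeff2 P 0 1"
    have "(z - l1) * (z - l2) = z * z - (l1 + l2) * z + l1 * l2" for z by (simp add: algebra_simps)
    then show "eigenvalue_pair (linear_part (P, Q)) l1 l2"
      using eq by (simp add: eigenvalue_pair_def det algebra_simps)
  qed
  then show ?thesis by (simp add: simple_singularity_def simple_eigenvalues_def assms)
qed

lemma reduced_pointI_nonsingular:
  assumes "at_origin P \<noteq> 0 \<or> at_origin Q \<noteq> 0"
  shows "reduced_point (P, Q)"
proof -
  have "hom_part 0 P \<noteq> 0 \<or> hom_part 0 Q \<noteq> 0" using assms by (auto simp: hom_part_0 const_bpoly_def)
  then have "jet_order (P, Q) = 0" by (intro jet_order_eqI) simp_all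
  then show ?thesis by (simp add: reduced_point_def)
qed

text \<open>The product condition says that the linear part is triangular, with \<open>l1\<close>
  and \<open>l2\<close> on the diagonal, as happens on an invariant exceptional divisor.\<close>

lemma reduced_pointI_simple:
  assumes "at_origin P = 0" "at_origin Q = 0" "coeff2 Q 1 0 = l1" "coeff2 P 0 1 = - l2"
    "coeff2 Q 0 1 * coeff2 P 1 0 = 0" "simple_eigenvalues l1 l2"
  shows "reduced_point (P, Q)"
proof -
  have "l1 \<noteq> 0 \<or> l2 \<noteq> 0" using simple_eigenvalues_distinct[OF assms(6)] by auto
  then have "hom_part 1 P \<noteq> 0 \<or> hom_part 1 Q \<noteq> 0"
    using assms(3,4) coeff2_hom_part[of 1 P 1 0] coeff2_hom_part[of 1 Q 0 1] by auto
  then have "jet_order (P, Q) = 1" using assms by (intro jet_order_1I) simp_all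
  moreover have "l1 + l2 = coeff2 Q 1 0 - coeff2 P 0 1"
    "l1 * l2 = coeff2 Q 0 1 * coeff2 P 1 0 - coeff2 Q 1 0 * coeff2 P 0 1"
    unfolding assms(3,4,5) by simp_all
  ultimately have "simple_singularity (P, Q)" using simple_singularity_iff assms(6) by blast
  then show ?thesis by (simp add: reduced_point_def)
qed

text \<open>The strict transform is singular only in the direction tangent to the leaf, where P(0) +
  c Q(0) = 0, respectively Q(0) = 0. The eigenvalues there are opposite to each other, so their
  quotient is -1.\<close>

lemma nonsingular_blow:
  assumes nz: "at_origin P \<noteq> 0 \<or> at_origin Q \<noteq> 0"
  shows "reduced_point (strict_coeffs e (blow e P) (blow e Q))"
proof -
  have res: "\<exists>g. blow e p = const_bpoly (at_origin p) + exceptional_eq e * g" for p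
    by (rule blow_residue_eq[of 0 p e "blow e p"]) (auto simp: hom_part_0)
  show ?thesis
  proof (cases e)
    case (Slope c)
    obtain g1 g2 where g: "blow e P = const_bpoly (at_origin P) + polyX * g1"
      "blow e Q = const_bpoly (at_origin Q) + polyX * g2" using res Slope by fastforce
    show ?thesis
    proof (cases "at_origin P + c * at_origin Q = 0")
      case False
      then show ?thesis by (simp add: Slope) (intro reduced_pointI_nonsingular, simp)
    next
      case True
      then have "at_origin Q \<noteq> 0" using nz by auto
      then show ?thesis
        unfolding Slope strict_coeffs.simps g[unfolded Slope] using True
        by (intro reduced_pointI_simple[of _ _ "at_origin Q" "- at_origin Q"])
          (simp_all add: distrib_right coeff2_mult_X coeff2_mult_Y coeff2_const coeff2_gen simple_eigenvalues_minus)
    qed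
  next
    case Vertical
    obtain g1 g2 where g: "blow e P = const_bpoly (at_origin P) + polyY * g1"
      "blow e Q = const_bpoly (at_origin Q) + polyY * g2" using res Vertical by fastforce
    show ?thesis
    proof (cases "at_origin Q = 0")
      case False
      then show ?thesis by (simp add: Vertical) (intro reduced_pointI_nonsingular, simp)
    next
      case True
      then have "at_origin P \<noteq> 0" using nz by auto
      then show ?thesis
        unfolding Vertical strict_coeffs.simps g[unfolded Vertical] using True
        by (intro reduced_pointI_simple[of _ _ "at_origin P" "- at_origin P"])
          (simp_all add: coeff2_mult_X coeff2_mult_Y coeff2_const coeff2_gen simple_eigenvalues_minus)
    qed
  qed
qed

lemma sum_product_cases:
  fixes l1 l2 m1 m2 :: "'a::idom"
  assumes "l1 + l2 = m1 + m2" "l1 * l2 = m1 * m2"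
  shows "m1 = l1 \<and> m2 = l2 \<or> m1 = l2 \<and> m2 = l1"
proof -
  have "(m1 - l1) * (m1 - l2) = m1 * m1 - m1 * (l1 + l2) + l1 * l2" by (simp add: algebra_simps)
  also have "\<dots> = 0" unfolding assms by (simp add: algebra_simps)
  finally show ?thesis using assms(1) by auto
qed

text \<open>Singular points over a simple singularity lie in the eigendirections of its linear part,
  and there eigenvalues l1, l2 turn into l1, l2 - l1.\<close>

lemma simple_blow:
  assumes simple: "simple_singularity (P, Q)"
    and P': "blow e P = exceptional_eq e * P'" and Q': "blow e Q = exceptional_eq e * Q'"
  shows "reduced_point (strict_coeffs e P' Q')"
proof -
  have jet: "jet_order (P, Q) = 1" using simple by (simp add: simple_singularity_def)
  then obtain l1 l2 where l: "l1 + l2 = coeff2 Q 1 0 - coeff2 P 0 1"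
    "l1 * l2 = coeff2 Q 0 1 * coeff2 P 1 0 - coeff2 Q 1 0 * coeff2 P 0 1" "simple_eigenvalues l1 l2"
    using simple by (auto simp: simple_singularity_iff)
  have eigen: "simple_eigenvalues m1 m2"
    if "m1 + m2 = coeff2 Q 1 0 - coeff2 P 0 1"
      "m1 * m2 = coeff2 Q 0 1 * coeff2 P 1 0 - coeff2 Q 1 0 * coeff2 P 0 1" for m1 m2
    using sum_product_cases[of l1 l2 m1 m2] that l simple_eigenvalues_commute[of l1 l2] by auto
  have ord: "ord_ge 1 P" "ord_ge 1 Q"
    using P' Q' at_origin_blow[of e P] at_origin_blow[of e Q] by (simp_all add: ord_ge_1[simplified])
  have hom1: "eval2 const_bpoly (hom_part 1 p) u v = const_bpoly (coeff2 p 0 1) * v + const_bpoly (coeff2 p 1 0) * u"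
    for p u v
    using eval2_hom_part[OF const_bpoly.ring_hom_1_axioms, of 1 p u v] by simp
  show ?thesis
  proof (cases e)
    case (Slope c)
    obtain g1 where g1: "P' = const_bpoly (coeff2 P 0 1) * (polyY + const_bpoly c) + const_bpoly (coeff2 P 1 0) + polyX * g1"
      using blow_residue_eq[OF ord(1), of e P'] P' unfolding hom1 by (auto simp: Slope)
    obtain g2 where g2: "Q' = const_bpoly (coeff2 Q 0 1) * (polyY + const_bpoly c) + const_bpoly (coeff2 Q 1 0) + polyX * g2"
      using blow_residue_eq[OF ord(2), of e Q'] Q' unfolding hom1 by (auto simp: Slope)
    \<comment> \<open>For d = 0 the vector (1, c) is an eigenvector of the linear part with
      eigenvalue \<open>m1\<close>, and \<open>m2\<close> is the trace minus \<open>m1\<close>. In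
      general d is the value of the tangent cone at (1, c).\<close>
    define m1 where "m1 = coeff2 Q 1 0 + coeff2 Q 0 1 * c"
    define m2 where "m2 = - coeff2 P 0 1 - coeff2 Q 0 1 * c"
    define d where "d = coeff2 P 1 0 + coeff2 P 0 1 * c + c * m1"
    have d: "at_origin (P' + (polyY + const_bpoly c) * Q') = d"
      by (simp add: g1 g2 d_def m1_def algebra_simps)
    show ?thesis
    proof (cases "d = 0")
      case False
      then show ?thesis unfolding Slope strict_coeffs.simps
        by (intro reduced_pointI_nonsingular) (simp only: d, simp)
    next
      case True
      have "m1 * m2 = coeff2 Q 0 1 * coeff2 P 1 0 - coeff2 Q 1 0 * coeff2 P 0 1 - coeff2 Q 0 1 * d"
        by (simp add: m1_def m2_def d_def algebra_simps)
      then have "simple_eigenvalues m1 m2"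
        using True by (intro eigen) (simp_all add: m1_def m2_def)
      then have "simple_eigenvalues m1 (m2 - m1)" by (rule simple_eigenvalues_blow)
      moreover have "coeff2 (polyX * Q') 1 0 = m1"
        by (simp add: coeff2_mult_X) (simp add: g2 coeff2_mult_X coeff2_mult_Y coeff2_const coeff2_gen m1_def distrib_left)
      moreover have "coeff2 (P' + (polyY + const_bpoly c) * Q') 0 1 = - (m2 - m1)"
        by (simp add: distrib_right coeff2_mult_Y)
          (simp add: g1 g2 distrib_left coeff2_mult_X coeff2_mult_Y coeff2_const coeff2_gen m1_def m2_def)
      moreover have "coeff2 (polyX * Q') 0 1 = 0" by (simp add: coeff2_mult_X)
      ultimately show ?thesis unfolding Slope strict_coeffs.simps
        using d True by (intro reduced_pointI_simple) simp_all
    qed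
  next
    case Vertical
    obtain g1 where g1: "P' = const_bpoly (coeff2 P 0 1) + const_bpoly (coeff2 P 1 0) * polyX + polyY * g1"
      using blow_residue_eq[OF ord(1), of e P'] P' unfolding hom1 by (auto simp: Vertical)
    obtain g2 where g2: "Q' = const_bpoly (coeff2 Q 0 1) + const_bpoly (coeff2 Q 1 0) * polyX + polyY * g2"
      using blow_residue_eq[OF ord(2), of e Q'] Q' unfolding hom1 by (auto simp: Vertical)
    have d: "at_origin (polyX * P' + Q') = coeff2 Q 0 1" by (simp add: g2)
    show ?thesis
    proof (cases "coeff2 Q 0 1 = 0")
      case False
      then show ?thesis unfolding Vertical strict_coeffs.simps
        by (intro reduced_pointI_nonsingular) (simp only: d, simp)
    next
      case True
      \<comment> \<open>With vanishing \<open>coeff2 Q 0 1\<close> the vector (0, 1) is an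
        eigenvector for the eigenvalue \<open>- coeff2 P 0 1\<close>.\<close>
      have "simple_eigenvalues (- coeff2 P 0 1) (coeff2 Q 1 0)"
        using True by (intro eigen) simp_all
      then have "simple_eigenvalues (coeff2 Q 1 0 - (- coeff2 P 0 1)) (- coeff2 P 0 1)"
        using simple_eigenvalues_blow simple_eigenvalues_commute by blast
      moreover have "coeff2 (polyX * P' + Q') 1 0 = coeff2 Q 1 0 - (- coeff2 P 0 1)"
        by (simp add: g1 g2 coeff2_mult_X coeff2_mult_Y coeff2_const coeff2_gen)
      moreover have "coeff2 (polyY * P') 0 1 = - (- coeff2 P 0 1)"
        by (simp add: coeff2_mult_Y) (simp add: g1 coeff2_mult_X coeff2_mult_Y coeff2_const coeff2_gen)
      moreover have "coeff2 (polyY * P') 1 0 = 0" by (simp add: coeff2_mult_Y)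
      ultimately show ?thesis unfolding Vertical strict_coeffs.simps
        using d True by (intro reduced_pointI_simple) simp_all
    qed
  qed
qed

text \<open>In order 1 a vanishing tangent cone makes the linear part a multiple of the identity;
  two equal eigenvalues have quotient 1 or are both 0, and neither is simple.\<close>

lemma reduced_radial_nonzero:
  assumes red: "reduced_point (P, Q)"
    and k: "ord_ge k P" "ord_ge k Q" "hom_part k P \<noteq> 0 \<or> hom_part k Q \<noteq> 0"
  shows "k \<le> 1" "hom_part (Suc k) (radial P Q) \<noteq> 0"
proof -
  have jet: "jet_order (P, Q) = k" using jet_order_eqI[OF k] .
  then show "k \<le> 1" using red by (auto simp: reduced_point_def simple_singularity_def)
  then consider "k = 0" | "k = 1" by linarith
  then show "hom_part (Suc k) (radial P Q) \<noteq> 0"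
  proof cases
    case 1
    have "coeff2 (hom_part 1 (radial P Q)) 1 0 = at_origin P" "coeff2 (hom_part 1 (radial P Q)) 0 1 = at_origin Q"
      by (simp_all add: coeff2_hom_part radial_def coeff2_mult_X coeff2_mult_Y at_origin_coeff2)
    then show ?thesis using k(3) 1 by (auto simp: hom_part_0)
  next
    case 2
    then have "simple_singularity (P, Q)" using red jet by (simp add: reduced_point_def)
    then obtain l1 l2 where l: "l1 + l2 = coeff2 Q 1 0 - coeff2 P 0 1"
      "l1 * l2 = coeff2 Q 0 1 * coeff2 P 1 0 - coeff2 Q 1 0 * coeff2 P 0 1" "simple_eigenvalues l1 l2"
      using jet 2 by (auto simp: simple_singularity_iff)
    show ?thesis
    proof
      assume 0: "hom_part (Suc k) (radial P Q) = 0"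
      have c: "coeff2 (hom_part (Suc 1) (radial P Q)) i j = 0" for i j
        using 0 2 by simp
      have "coeff2 P 1 0 = 0" "coeff2 Q 1 0 + coeff2 P 0 1 = 0" "coeff2 Q 0 1 = 0"
        using c[of 2 0] c[of 1 1] c[of 0 2]
        by (simp_all add: coeff2_hom_part radial_def coeff2_mult_X coeff2_mult_Y numeral_2_eq_2 add.commute)
      then have "coeff2 P 1 0 = 0" "coeff2 P 0 1 = - coeff2 Q 1 0" "coeff2 Q 0 1 = 0"
        by (simp_all add: eq_neg_iff_add_eq_0 add.commute)
      then have "coeff2 Q 1 0 = l1 \<and> coeff2 Q 1 0 = l2"
        using sum_product_cases[of l1 l2 "coeff2 Q 1 0" "coeff2 Q 1 0"] l(1,2) by auto
      then show False using simple_eigenvalues_distinct[OF l(3)] by metis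
    qed
  qed
qed

lemma reduced_strict_transform:
  assumes red: "reduced_point (P, Q)" and nz: "P \<noteq> 0 \<or> Q \<noteq> 0"
  shows "reduced_point (strict_transform e (P, Q))"
proof -
  obtain k where k: "ord_ge k P" "ord_ge k Q" "hom_part k P \<noteq> 0 \<or> hom_part k Q \<noteq> 0"
    using order_exists2[OF nz] .
  note rad = reduced_radial_nonzero[OF red k]
  obtain P' where P': "blow e P = exceptional_eq e ^ k * P'" using blow_factor[OF k(1)] .
  obtain Q' where Q': "blow e Q = exceptional_eq e ^ k * Q'" using blow_factor[OF k(2)] .
  interpret invariant_exceptional P Q P' Q' k e
    by unfold_locales (fact k rad P' Q')+
  consider "k = 0" | "k = 1" using rad(1) by linarith
  then show ?thesis
  proof cases
    case 1
    then have "P' = blow e P" "Q' = blow e Q" using P' Q' by simp_all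
    moreover have "at_origin P \<noteq> 0 \<or> at_origin Q \<noteq> 0" using k(3) 1 by (auto simp: hom_part_0)
    ultimately show ?thesis unfolding strict_transform_eq using nonsingular_blow by simp
  next
    case 2
    then have "simple_singularity (P, Q)"
      using red jet_order_eqI[OF k] by (simp add: reduced_point_def)
    then show ?thesis unfolding strict_transform_eq using simple_blow P' Q' 2 by simp
  qed
qed

section \<open>Dicritical points are the base points of the pencil\<close>

lemma reduced_not_base_point:
  assumes "form_integral P Q f g" "locally_coprime P Q" "locally_coprime f g"
    "at_origin f = 0" "at_origin g = 0" "colength_le f g N" "reduced_point (P, Q)"
  shows False
  using assms
proof (induction N arbitrary: P Q f g)
  case 0
  then show ?case using colength_base_point by blast
next
  case (Suc N)
  note nz = locally_coprime_nonzero[OF Suc.prems(2)]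
  obtain k where k: "ord_ge k P" "ord_ge k Q" "hom_part k P \<noteq> 0 \<or> hom_part k Q \<noteq> 0"
    using order_exists2[OF nz] .
  obtain e P1 Q1 f' g' where st: "strict_transform e (P, Q) = (P1, Q1)" "form_integral P1 Q1 f' g'"
    "locally_coprime P1 Q1" "locally_coprime f' g'" "at_origin f' = 0" "at_origin g' = 0" "colength_le f' g' N"
    using base_point_step[OF Suc.prems(1-6) k(1,2) reduced_radial_nonzero(2)[OF Suc.prems(7) k]] .
  show ?case
    using Suc.IH[OF st(2-7)] reduced_strict_transform[OF Suc.prems(7) nz, of e] st(1) by simp
qed

lemma dicritical_terminal:
  "ordinary_singularity \<omega> \<Longrightarrow> terminal_dicritical \<omega> \<Longrightarrow> dicritical \<omega>"
  unfolding dicritical_def by (intro conjI bexI[of _ "[]"]) (simp_all add: singular_configuration_def)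

lemma dicritical_strict_transform:
  assumes ord: "ordinary_singularity \<omega>" and dic: "dicritical (strict_transform e \<omega>)"
  shows "dicritical \<omega>"
proof -
  obtain es where es: "es \<in> singular_configuration (strict_transform e \<omega>)"
    "terminal_dicritical (transform_at (strict_transform e \<omega>) es)"
    using dic by (auto simp: dicritical_def)
  have "e # es \<in> singular_configuration \<omega>"
    unfolding singular_configuration_def
  proof (intro CollectI allI impI)
    fix n assume "n \<le> length (e # es)"
    then show "ordinary_singularity (transform_at \<omega> (take n (e # es)))"
      using ord es(1) by (cases n) (simp_all add: singular_configuration_def)
  qed
  moreover have "[] \<in> singular_configuration \<omega>" using ord by (simp add: singular_configuration_def)
  ultimately show ?thesis unfolding dicritical_def using es(2) by (intro conjI bexI[of _ "e # es"]) simp_all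
qed

theorem base_point_dicritical:
  assumes "form_integral P Q f g" "locally_coprime P Q" "locally_coprime f g"
    "at_origin f = 0" "at_origin g = 0"
  shows "dicritical (P, Q)"
proof -
  obtain N where "colength_le f g N" using colength_finite[OF assms(3)] .
  with assms show ?thesis
  proof (induction N arbitrary: P Q f g)
    case 0
    then show ?case using colength_base_point by blast
  next
    case (Suc N)
    obtain k where k: "ord_ge k P" "ord_ge k Q" "hom_part k P \<noteq> 0 \<or> hom_part k Q \<noteq> 0"
      using order_exists2[OF locally_coprime_nonzero[OF Suc.prems(2)]] .
    \<comment> \<open>The singular configuration contains only ordinary singularities, so the
      descent must not meet a reduced point.\<close>
    have ordinary: "ordinary_singularity (P, Q)"
      using reduced_not_base_point[OF Suc.prems] by (auto simp: ordinary_iff_not_reduced)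
    show ?case
    proof (cases "hom_part (Suc k) (radial P Q) = 0")
      case True
      moreover have "k \<ge> 1"
        using ordinary jet_order_eqI[OF k] by (simp add: ordinary_singularity_def singularity_def)
      ultimately have "terminal_dicritical (P, Q)" by (simp add: terminal_dicritical_iff[OF k])
      with ordinary show ?thesis by (rule dicritical_terminal)
    next
      case False
      obtain e P1 Q1 f' g' where st: "strict_transform e (P, Q) = (P1, Q1)" "form_integral P1 Q1 f' g'"
        "locally_coprime P1 Q1" "locally_coprime f' g'" "at_origin f' = 0" "at_origin g' = 0" "colength_le f' g' N"
        using base_point_step[OF Suc.prems(1-6) k(1,2) False] .
      show ?thesis
        using dicritical_strict_transform[OF ordinary, of e] Suc.IH[OF st(2-7)] st(1) by simp
    qed
  qed
qed

section \<open>Points off the base locus\<close>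

definition linearly_independent :: "bpoly \<Rightarrow> bpoly \<Rightarrow> bool" where
  "linearly_independent f g \<longleftrightarrow>
     (\<forall>a b. const_bpoly a * f + const_bpoly b * g = 0 \<longrightarrow> a = 0 \<and> b = 0)"

lemma linearly_independent_commute: "linearly_independent f g \<Longrightarrow> linearly_independent g f"
  unfolding linearly_independent_def by (metis add.commute)

text \<open>Let n \<ge> 1 be the order of f. As g is a unit, the contraction of g df - f dg has
  order exactly n, its leading part being n g(0) times that of f. The form itself has order at least
  n - 1, so a jump of two or more in \<open>radial P Q\<close> would push the contraction above
  order n.\<close>

lemma radial_nonzero_off_zero_locus:
  assumes integral: "form_integral P Q f g" and lc: "locally_coprime P Q"
    and k: "ord_ge k P" "ord_ge k Q" "hom_part k P \<noteq> 0 \<or> hom_part k Q \<noteq> 0"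
    and f: "f \<noteq> 0" "at_origin f = 0" and g: "at_origin g \<noteq> 0"
  shows "hom_part (Suc k) (radial P Q) \<noteq> 0"
proof
  assume 0: "hom_part (Suc k) (radial P Q) = 0"
  define A where "A = pdx f * g - f * pdx g"
  define B where "B = pdy f * g - f * pdy g"
  obtain u h where u: "at_origin u \<noteq> 0" "u * A = P * h" "u * B = Q * h"
    using proportional_coprime[OF lc, of B A] integral by (auto simp: form_integral_def A_def B_def)
  obtain n where n: "ord_ge n f" "hom_part n f \<noteq> 0" using order_exists[OF f(1)] .
  have "n \<noteq> 0"
  proof
    assume "n = 0"
    then show False using n(2) f(2) by (simp add: hom_part_0)
  qed
  have "hom_part (n + 0) (radial (pdx f) (pdy f) * g) = const_bpoly (of_nat n) * hom_part n f * hom_part 0 g"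
    using ord_ge_theta[OF n(1)] by (subst hom_part_mult_ord_ge) (simp_all add: hom_part_theta)
  moreover have "hom_part (n + 0) (f * radial (pdx g) (pdy g)) = 0"
    using n(1) by (subst hom_part_mult_ord_ge) (simp_all add: hom_part_theta)
  ultimately have V: "hom_part n (radial A B) = const_bpoly (of_nat n) * hom_part n f * hom_part 0 g"
    unfolding A_def B_def radial_wronskian hom_part_diff by simp
  have "ord_ge (n + 0) (radial (pdx f) (pdy f) * g)" "ord_ge (n + 0) (f * radial (pdx g) (pdy g))"
    using ord_ge_theta[OF n(1)] n(1) by (intro ord_ge_mult; simp)+
  then have "ord_ge n (radial A B)"
    unfolding A_def B_def radial_wronskian by (simp add: ord_ge_diff)
  then have "hom_part (0 + n) (u * radial A B) = hom_part 0 u * hom_part n (radial A B)"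
    by (intro hom_part_mult_ord_ge) simp_all
  then have uV: "hom_part n (u * radial A B) \<noteq> 0"
    unfolding V using u(1) g n(2) \<open>n \<noteq> 0\<close> by (simp add: hom_part_0 const_bpoly_def)
  have "u * radial A B = polyX * (u * A) + polyY * (u * B)"
    by (simp add: radial_def algebra_simps)
  also have "\<dots> = radial P Q * h" unfolding u by (simp add: radial_def algebra_simps)
  finally have Wh: "u * radial A B = radial P Q * h" .
  have "h \<noteq> 0"
  proof
    assume "h = 0"
    then show False using uV unfolding Wh by (simp add: hom_part_eq_0_iff)
  qed
  then obtain l where l: "ord_ge l h" "hom_part l h \<noteq> 0" by (rule order_exists)
  have AB: "ord_ge (n - 1) A" "ord_ge (n - 1) B"
    unfolding A_def B_def
    using ord_ge_mult[OF ord_ge_pdx[OF n(1)], of 0 g] ord_ge_mult[OF ord_ge_pdy[OF n(1)], of 0 g]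
      ord_ge_mono[OF ord_ge_mult[OF n(1), of 0]] by (auto intro!: ord_ge_diff)
  then have uAB: "ord_ge (n - 1) (P * h)" "ord_ge (n - 1) (Q * h)"
    unfolding u[symmetric] using ord_ge_mult[of 0 u "n - 1"] by simp_all
  have "hom_part (k + l) (P * h) \<noteq> 0 \<or> hom_part (k + l) (Q * h) \<noteq> 0"
    using hom_part_mult_ord_ge[OF k(1) l(1)] hom_part_mult_ord_ge[OF k(2) l(1)] k(3) l(2) by auto
  then have "\<not> k + l < n - 1" using uAB unfolding ord_ge_def by blast
  moreover have "ord_ge (Suc (Suc k) + l) (radial P Q * h)"
    using ord_ge_radial[OF k(1,2)] 0 l(1) by (intro ord_ge_mult) (simp_all add: ord_ge_Suc)
  ultimately show False using uV unfolding Wh ord_ge_def by simp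
qed

text \<open>Subtract the value at the origin of f / g or of g / f, whichever is defined there;
  linear independence keeps the difference from being 0.\<close>

lemma radial_nonzero_off_base_point:
  assumes integral: "form_integral P Q f g" and lc: "locally_coprime P Q"
    and k: "ord_ge k P" "ord_ge k Q" "hom_part k P \<noteq> 0 \<or> hom_part k Q \<noteq> 0"
    and ind: "linearly_independent f g" and nb: "at_origin f \<noteq> 0 \<or> at_origin g \<noteq> 0"
  shows "hom_part (Suc k) (radial P Q) \<noteq> 0"
proof -
  have main: "hom_part (Suc k) (radial P Q) \<noteq> 0"
    if fg: "form_integral P Q f g" "linearly_independent f g" "at_origin g \<noteq> 0" for f g
  proof -
    define c where "c = at_origin f / at_origin g"
    have "f - const_bpoly c * g \<noteq> 0"
    proof
      assume "f - const_bpoly c * g = 0"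
      then have "const_bpoly 1 * f + const_bpoly (- c) * g = 0" by simp
      then show False using fg(2) unfolding linearly_independent_def by fastforce
    qed
    then show ?thesis
      using radial_nonzero_off_zero_locus[OF form_integral_shift[OF fg(1)] lc k, of c] fg(3)
      by (simp add: c_def)
  qed
  from nb show ?thesis
  proof
    assume "at_origin f \<noteq> 0"
    then show ?thesis
      using main[OF form_integral_commute[OF integral] linearly_independent_commute[OF ind]] by blast
  next
    assume "at_origin g \<noteq> 0"
    then show ?thesis using main integral ind by blast
  qed
qed

text \<open>No infinitely near point is a base point of the pulled-back pencil: f and g are not
  divided by the exceptional equation (m = 0 in \<open>form_integral_strict_coeffs\<close>), and
  their values at the origin do not change.\<close>

theorem not_base_point_not_dicritical:
  assumes "form_integral P Q f g" "locally_coprime P Q" "linearly_independent f g"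
    "at_origin f \<noteq> 0 \<or> at_origin g \<noteq> 0"
  shows "\<not> dicritical (P, Q)"
proof -
  have "\<not> terminal_dicritical (transform_at (P, Q) es)" for es
    using assms
  proof (induction es arbitrary: P Q f g)
    case Nil
    obtain k where k: "ord_ge k P" "ord_ge k Q" "hom_part k P \<noteq> 0 \<or> hom_part k Q \<noteq> 0"
      using order_exists2[OF locally_coprime_nonzero[OF Nil(2)]] .
    show ?case
      using radial_nonzero_off_base_point[OF Nil(1,2) k Nil(3,4)] by (simp add: terminal_dicritical_iff[OF k])
  next
    case (Cons e es)
    obtain k where k: "ord_ge k P" "ord_ge k Q" "hom_part k P \<noteq> 0 \<or> hom_part k Q \<noteq> 0"
      using order_exists2[OF locally_coprime_nonzero[OF Cons.prems(2)]] .
    obtain P' where P': "blow e P = exceptional_eq e ^ k * P'" using blow_factor[OF k(1)] .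
    obtain Q' where Q': "blow e Q = exceptional_eq e ^ k * Q'" using blow_factor[OF k(2)] .
    interpret invariant_exceptional P Q P' Q' k e
      by unfold_locales (fact k radial_nonzero_off_base_point[OF Cons.prems(1,2) k Cons.prems(3,4)] P' Q')+
    have "const_bpoly a * blow e f + const_bpoly b * blow e g = blow e (const_bpoly a * f + const_bpoly b * g)" for a b
      by simp
    then have "linearly_independent (blow e f) (blow e g)"
      using Cons.prems(3) unfolding linearly_independent_def by (simp only: blow_eq_0_iff)
    moreover have "form_integral (fst (strict_coeffs e P' Q')) (snd (strict_coeffs e P' Q')) (blow e f) (blow e g)"
      by (rule form_integral_strict_coeffs[OF Cons.prems(1), where m = 0]) simp_all
    ultimately show ?case
      using Cons.IH[OF _ locally_coprime_strict_coeffs[OF Cons.prems(2)]] Cons.prems(4)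
      by (simp add: strict_transform_eq)
  qed
  then show ?thesis by (simp add: dicritical_def)
qed

section \<open>Derivations of rational functions\<close>

lemma ratfun_of_eq_0_iff [simp]: "ratfun_of p = 0 \<longleftrightarrow> p = 0"
  by (simp add: ratfun_of_def Zero_fract_def eq_fract)

lemma ratfun_of_inj: "ratfun_of p = ratfun_of q \<longleftrightarrow> p = q"
  by (simp add: ratfun_of_def eq_fract)

lemma Fract_conv: "q \<noteq> 0 \<Longrightarrow> Fract p q = ratfun_of p / ratfun_of q"
  by (simp add: ratfun_of_def divide_fract)

interpretation rat_dx: derivation rat_dx
proof
  fix f g :: ratfun
  obtain p q where f: "f = Fract p q" "q \<noteq> 0" by (cases f)
  obtain p' q' where g: "g = Fract p' q'" "q' \<noteq> 0" by (cases g)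
  show "rat_dx (f + g) = rat_dx f + rat_dx g"
    using f g by (simp add: rat_dx_Fract eq_fract pdx.mult) (simp add: algebra_simps power2_eq_square)
  show "rat_dx (f * g) = rat_dx f * g + f * rat_dx g"
    using f g by (simp add: rat_dx_Fract eq_fract pdx.mult) (simp add: algebra_simps power2_eq_square)
qed

interpretation rat_dy: derivation rat_dy
proof
  fix f g :: ratfun
  obtain p q where f: "f = Fract p q" "q \<noteq> 0" by (cases f)
  obtain p' q' where g: "g = Fract p' q'" "q' \<noteq> 0" by (cases g)
  show "rat_dy (f + g) = rat_dy f + rat_dy g"
    using f g by (simp add: rat_dy_Fract eq_fract pdy.mult) (simp add: algebra_simps power2_eq_square)
  show "rat_dy (f * g) = rat_dy f * g + f * rat_dy g"
    using f g by (simp add: rat_dy_Fract eq_fract pdy.mult) (simp add: algebra_simps power2_eq_square)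
qed

lemma rat_dx_ratfun_of: "rat_dx (ratfun_of p) = ratfun_of (pdx p)"
  and rat_dy_ratfun_of: "rat_dy (ratfun_of p) = ratfun_of (pdy p)"
  by (simp_all add: ratfun_of_def rat_dx_Fract rat_dy_Fract)

lemma rat_d_const [simp]: "rat_dx (const_ratfun c) = 0" "rat_dy (const_ratfun c) = 0"
  by (simp_all add: const_ratfun_def rat_dx_ratfun_of rat_dy_ratfun_of)

section \<open>Coprime polynomials\<close>

text \<open>A substitute for the resultant. By pseudo-division, a nonzero d of least degree in y in
  the ideal divides every member up to a factor from C[x]; by the lemma of Gauss its primitive part
  divides p and q, hence is a unit, and d lies in C[x].\<close>

lemma coprime_bezout_const:
  fixes p q :: bpoly
  assumes "coprime p q"
  obtains a b R where "R \<noteq> 0" "a * p + b * q = [:R:]"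
proof -
  define I where "I = {a * p + b * q |a b. True}"
  have I_mult: "t * x \<in> I" if x: "x \<in> I" for t x
  proof -
    obtain a b where "x = a * p + b * q" using x by (auto simp: I_def)
    then have "t * x = (t * a) * p + (t * b) * q" by (simp add: algebra_simps)
    then show ?thesis by (auto simp: I_def)
  qed
  have I_diff: "x - y \<in> I" if xy: "x \<in> I" "y \<in> I" for x y
  proof -
    obtain a b c d where "x = a * p + b * q" "y = c * p + d * q" using xy by (auto simp: I_def)
    then have "x - y = (a - c) * p + (b - d) * q" by (simp add: algebra_simps)
    then show ?thesis by (auto simp: I_def)
  qed
  have p: "p \<in> I" unfolding I_def by (intro CollectI exI[of _ 1] exI[of _ 0]) simp
  have q: "q \<in> I" unfolding I_def by (intro CollectI exI[of _ 0] exI[of _ 1]) simp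
  have "p \<noteq> 0 \<or> q \<noteq> 0" using assms by auto
  then have "\<exists>d. d \<in> I \<and> d \<noteq> 0" using p q by blast
  then obtain d where d: "d \<in> I" "d \<noteq> 0" and min: "\<And>x. x \<in> I \<Longrightarrow> x \<noteq> 0 \<Longrightarrow> degree d \<le> degree x"
    using ex_has_least_nat[of "\<lambda>d. d \<in> I \<and> d \<noteq> 0" _ degree] by blast
  have dvd: "primitive_part d dvd x" if x: "x \<in> I" for x
  proof -
    obtain u r where ur: "pseudo_divmod x d = (u, r)" by fastforce
    define c where "c = lead_coeff d ^ (Suc (degree x) - degree d)"
    have c: "c \<noteq> 0" using d(2) by (simp add: c_def)
    have eq: "smult c x = d * u + r" and r: "r = 0 \<or> degree r < degree d"
      using pseudo_divmod[OF d(2) ur] by (simp_all add: c_def)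
    have "r = [:c:] * x - u * d" using eq by (simp add: algebra_simps)
    then have "r \<in> I" using I_diff I_mult x d(1) by metis
    then have "r = 0" using min[of r] r by fastforce
    then have "d dvd smult c x" using eq by simp
    moreover have "primitive_part d dvd d"
      by (metis content_times_primitive_part dvd_smult dvd_refl)
    ultimately have "primitive_part d dvd smult c x" by (rule dvd_trans[rotated])
    then have "fract_poly (primitive_part d) dvd smult (to_fract c) (fract_poly x)"
      using fract_poly_dvd fract_poly_smult by metis
    then have "fract_poly (primitive_part d) dvd fract_poly x"
      using c by (simp add: dvd_smult_iff)
    then show ?thesis
      by (rule fract_poly_dvdD) (simp add: d(2))
  qed
  have "is_unit (primitive_part d)"
    using coprime_common_divisor[OF assms dvd[OF p] dvd[OF q]] .
  then have "degree (primitive_part d) = 0"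
    by (metis is_unit_iff_degree is_unit_polyE degree_pCons_0)
  then obtain R where "d = [:R:]" by (auto elim: degree_eq_zeroE)
  then show thesis using that d by (auto simp: I_def)
qed

lemma const_poly_eq_power_times_unit:
  assumes "R \<noteq> 0"
  obtains K s where "[:R:] = polyX ^ K * s" "at_origin s \<noteq> 0"
proof -
  have "poly (map_poly const_bpoly R) polyX = [:R:]"
  proof (induction R)
    case (pCons a R)
    have "[:pCons a R:] = const_bpoly a + polyX * [:R:]" by (simp add: const_bpoly_def polyX_def)
    then show ?case using pCons by simp
  qed simp
  then show thesis
    using up_eq_power_times_unit[OF assms, of polyX] that by auto
qed

lemma coprime_locally_coprime:
  assumes "coprime p q"
  shows "locally_coprime p q"
proof -
  have c: "coordinates polyX polyY" by (simp add: coordinates_def)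
  obtain a b R where R: "R \<noteq> 0" "a * p + b * q = [:R:]" using coprime_bezout_const[OF assms] .
  obtain K s where s: "[:R:] = polyX ^ K * s" "at_origin s \<noteq> 0"
    using const_poly_eq_power_times_unit[OF R(1)] .
  have "local_ideal p q (polyX ^ K)"
    by (rule local_idealI[OF s(2), of _ a _ b]) (simp only: R(2) s(1) mult.commute[of s])
  moreover have "\<not> (polyX dvd p \<and> polyX dvd q)"
    using coprime_common_divisor[OF assms] prime_elem_coordinate[OF c] by (auto simp: prime_elem_def)
  ultimately show ?thesis by (rule locally_coprimeI[OF c])
qed

section \<open>The chart at infinity\<close>

text \<open>This is s^N f(1/s, s^\<delta> t) in the chart coordinates. With a bound N shared by
  several polynomials, instead of the exact degree, all get the same factor s^N and the map is
  linear. As i \<le> N, the subtraction is never truncated.\<close>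

definition chart_poly :: "nat \<Rightarrow> nat \<Rightarrow> bpoly \<Rightarrow> bpoly" where
  "chart_poly N \<delta> f =
     (\<Sum>j\<le>degree f. \<Sum>i\<le>N. monom (monom (coeff2 f i j) (N + \<delta> * j - i)) j)"

definition x_degree_le :: "nat \<Rightarrow> bpoly \<Rightarrow> bool" where
  "x_degree_le N f \<longleftrightarrow> (\<forall>i j. N < i \<longrightarrow> coeff2 f i j = 0)"

lemma x_degree_le_mono: "x_degree_le M f \<Longrightarrow> M \<le> N \<Longrightarrow> x_degree_le N f"
  by (auto simp: x_degree_le_def)

lemma x_degree_exists: "\<exists>N. x_degree_le N f"
proof (induction f)
  case 0
  show ?case by (simp add: x_degree_le_def)
next
  case (pCons q f)
  then obtain N where "x_degree_le N f" by blast
  then have "x_degree_le (max N (degree q)) (pCons q f)"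
    by (auto simp: x_degree_le_def coeff_pCons coeff_eq_0 split: nat.splits)
  then show ?case by blast
qed

lemma sum_monom_eq:
  assumes "x_degree_le N f"
  shows "f = (\<Sum>j\<le>degree f. \<Sum>i\<le>N. monom (monom (coeff2 f i j) i) j)"
proof (rule bpoly_eqI)
  fix a b
  have "coeff2 (\<Sum>j\<le>degree f. \<Sum>i\<le>N. monom (monom (coeff2 f i j) i) j) a b =
      (\<Sum>j\<le>degree f. \<Sum>i\<le>N. if i = a \<and> j = b then coeff2 f i j else 0)"
    by (simp only: coeff_sum coeff2_monom)
  also have "\<dots> = (\<Sum>j\<le>degree f. if j = b then \<Sum>i\<le>N. if i = a then coeff2 f i j else 0 else 0)"
    by (intro sum.cong) auto
  also have "\<dots> = coeff2 f a b"
    using assms by (auto simp: x_degree_le_def coeff_eq_0)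
  finally show "coeff2 f a b = coeff2 (\<Sum>j\<le>degree f. \<Sum>i\<le>N. monom (monom (coeff2 f i j) i) j) a b" ..
qed

lemma coeff2_chart_poly:
  assumes "x_degree_le N f"
  shows "coeff2 (chart_poly N \<delta> f) a b = (if a \<le> N + \<delta> * b then coeff2 f (N + \<delta> * b - a) b else 0)"
proof -
  have "coeff2 (chart_poly N \<delta> f) a b =
      (\<Sum>j\<le>degree f. \<Sum>i\<le>N. if N + \<delta> * j - i = a \<and> j = b then coeff2 f i j else 0)"
    unfolding chart_poly_def by (simp only: coeff_sum coeff2_monom)
  also have "\<dots> = (\<Sum>j\<le>degree f. if j = b then \<Sum>i\<le>N. if N + \<delta> * b - i = a then coeff2 f i b else 0 else 0)"
    by (intro sum.cong) auto
  also have "\<dots> = (\<Sum>i\<le>N. if N + \<delta> * b - i = a then coeff2 f i b else 0)"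
    by (auto simp: coeff_eq_0 intro!: sum.neutral)
  also have "\<dots> = (\<Sum>i\<le>N. if i = N + \<delta> * b - a then (if a \<le> N + \<delta> * b then coeff2 f (N + \<delta> * b - a) b else 0) else 0)"
    by (intro sum.cong) auto
  also have "\<dots> = (if a \<le> N + \<delta> * b then coeff2 f (N + \<delta> * b - a) b else 0)"
    using assms by (auto simp: x_degree_le_def)
  finally show ?thesis .
qed

text \<open>The chart change as a ring homomorphism. \<open>chart_poly\<close> with a fixed N does
  not respect products, so identities are transported here and the denominators cleared
  afterwards.\<close>

definition chart_hom :: "nat \<Rightarrow> bpoly \<Rightarrow> ratfun" where
  "chart_hom \<delta> f = eval2 const_ratfun f (1 / ratfun_of polyX) (ratfun_of polyX ^ \<delta> * ratfun_of polyY)"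

interpretation chart_hom: ring_hom_1 "chart_hom \<delta>" for \<delta>
  unfolding chart_hom_def by unfold_locales

lemma ratfun_of_chart_poly:
  assumes "x_degree_le N f"
  shows "ratfun_of (chart_poly N \<delta> f) = ratfun_of polyX ^ N * chart_hom \<delta> f"
proof -
  let ?x = "ratfun_of polyX" and ?y = "ratfun_of polyY"
  have x: "?x \<noteq> 0" by simp
  have "chart_hom \<delta> f = (\<Sum>j\<le>degree f. \<Sum>i\<le>N. const_ratfun (coeff2 f i j) * (1 / ?x) ^ i * (?x ^ \<delta> * ?y) ^ j)"
    by (subst (1) sum_monom_eq[OF assms]) (simp add: chart_hom.sum monom2_eq, simp add: chart_hom_def)
  then have "?x ^ N * chart_hom \<delta> f =
      (\<Sum>j\<le>degree f. \<Sum>i\<le>N. ?x ^ N * (const_ratfun (coeff2 f i j) * (1 / ?x) ^ i * (?x ^ \<delta> * ?y) ^ j))"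
    by (simp only: sum_distrib_left)
  also have "\<dots> = (\<Sum>j\<le>degree f. \<Sum>i\<le>N. ratfun_of (monom (monom (coeff2 f i j) (N + \<delta> * j - i)) j))"
  proof (intro sum.cong refl)
    fix j i assume "i \<in> {..N}"
    then have i: "i \<le> N + \<delta> * j" by simp
    have "?x ^ N * (const_ratfun (coeff2 f i j) * (1 / ?x) ^ i * (?x ^ \<delta> * ?y) ^ j) =
        const_ratfun (coeff2 f i j) * (?x ^ (N + \<delta> * j) / ?x ^ i) * ?y ^ j"
      by (simp add: power_add power_mult power_mult_distrib power_divide)
    also have "?x ^ (N + \<delta> * j) / ?x ^ i = ?x ^ (N + \<delta> * j - i)"
      by (rule power_diff[OF x i, symmetric])
    finally show "?x ^ N * (const_ratfun (coeff2 f i j) * (1 / ?x) ^ i * (?x ^ \<delta> * ?y) ^ j) =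
        ratfun_of (monom (monom (coeff2 f i j) (N + \<delta> * j - i)) j)"
      by (simp add: monom2_eq const_ratfun_def)
  qed
  finally show ?thesis by (simp add: chart_poly_def ratfun_of.sum)
qed

lemma chart_poly_eq_0:
  assumes "x_degree_le N f" "chart_poly N \<delta> f = 0"
  shows "f = 0"
proof (rule bpoly_eqI)
  fix i j
  show "coeff2 f i j = coeff2 0 i j"
  proof (cases "i \<le> N")
    case True
    then show ?thesis
      using coeff2_chart_poly[OF assms(1), of \<delta> j "N + \<delta> * j - i"] by (simp add: assms(2))
  next
    case False
    then show ?thesis using assms(1) by (simp add: x_degree_le_def)
  qed
qed

lemma chart_hom_eq_0_iff: "chart_hom \<delta> f = 0 \<longleftrightarrow> f = 0"
proof
  assume 0: "chart_hom \<delta> f = 0"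
  obtain N where N: "x_degree_le N f" using x_degree_exists by blast
  have "chart_poly N \<delta> f = 0"
    using ratfun_of_chart_poly[OF N, of \<delta>] 0 by simp
  then show "f = 0" using chart_poly_eq_0[OF N] by blast
qed simp

lemma pullback_chart:
  "pullback_rat (chart_change \<delta> 1 0) (P, Q) =
    (chart_hom \<delta> P * rat_dx (1 / ratfun_of polyX) + chart_hom \<delta> Q * rat_dx (ratfun_of polyX ^ \<delta> * ratfun_of polyY),
     chart_hom \<delta> Q * ratfun_of polyX ^ \<delta>)"
proof -
  have "1 / ratfun_of polyX = Fract 1 polyX" by (simp add: Fract_conv)
  then have 1: "rat_dy (1 / ratfun_of polyX) = 0" by (simp add: rat_dy_Fract Zero_fract_def eq_fract)
  have "pdy (polyX ^ n) = 0" for n by (induction n) (simp_all add: pdy.mult)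
  then have 2: "rat_dy (ratfun_of polyX ^ \<delta> * ratfun_of polyY) = ratfun_of polyX ^ \<delta>"
    using rat_dy_ratfun_of[of "polyX ^ \<delta> * polyY"] by (simp add: pdy.mult)
  show ?thesis by (simp add: pullback_def chart_change_def chart_hom_def Let_def 1 2)
qed

lemma pullback_chart_nonzero:
  assumes "P \<noteq> 0 \<or> Q \<noteq> 0"
  shows "pullback_rat (chart_change \<delta> 1 0) (P, Q) \<noteq> (0, 0)"
proof
  assume 0: "pullback_rat (chart_change \<delta> 1 0) (P, Q) = (0, 0)"
  then have "chart_hom \<delta> Q = 0" unfolding pullback_chart by simp
  then have Q: "Q = 0" by (simp add: chart_hom_eq_0_iff)
  have "rat_dx (1 / ratfun_of polyX) \<noteq> 0"
  proof -
    have "1 / ratfun_of polyX = Fract 1 polyX" by (simp add: Fract_conv)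
    then show ?thesis by (simp add: rat_dx_Fract Zero_fract_def eq_fract)
  qed
  then have "chart_hom \<delta> P = 0" using 0 Q unfolding pullback_chart by simp
  then have "P = 0" by (simp add: chart_hom_eq_0_iff)
  then show False using Q assms by simp
qed

lemma ratfun_pair_proportional:
  assumes "(\<alpha>, \<beta>) \<noteq> (0 :: ratfun, 0)"
  obtains r p q where "r \<noteq> 0" "coprime p q" "\<alpha> = r * ratfun_of p" "\<beta> = r * ratfun_of q"
proof -
  obtain a b where ab: "\<alpha> = Fract a b" "b \<noteq> 0" by (cases \<alpha>)
  obtain c d where cd: "\<beta> = Fract c d" "d \<noteq> 0" by (cases \<beta>)
  define g where "g = gcd (a * d) (c * b)"
  have "a \<noteq> 0 \<or> c \<noteq> 0" using assms ab cd by (auto simp: Zero_fract_def eq_fract)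
  then have nz: "a * d \<noteq> 0 \<or> c * b \<noteq> 0" using ab cd by auto
  then have g: "g \<noteq> 0" by (simp add: g_def)
  show thesis
  proof
    show "Fract g (b * d) \<noteq> 0" using g ab cd by (simp add: Zero_fract_def eq_fract)
    show "coprime (a * d div g) (c * b div g)" unfolding g_def using nz by (rule div_gcd_coprime)
    have "g * (a * d div g) = a * d" "g * (c * b div g) = c * b" by (simp_all add: g_def)
    then show "\<alpha> = Fract g (b * d) * ratfun_of (a * d div g)" "\<beta> = Fract g (b * d) * ratfun_of (c * b div g)"
      using ab cd by (simp_all add: ratfun_of_def eq_fract mult_ac)
  qed
qed

text \<open>\<open>dicritical_point\<close> asks for some extended form, so a base point makes it
  true only once such a form is known to exist.\<close>

lemma extended_form_exists:
  assumes "vector_field X"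
  obtains \<omega> where "extended_form \<delta> X 1 0 \<omega>"
proof -
  have "fst X \<noteq> 0 \<or> snd X \<noteq> 0" using assms by (auto simp: vector_field_def)
  then have "snd X \<noteq> 0 \<or> - fst X \<noteq> 0" by auto
  then have nz: "pullback_rat (chart_change \<delta> 1 0) (form_of X) \<noteq> (0, 0)"
    unfolding form_of_def by (rule pullback_chart_nonzero)
  obtain \<alpha> \<beta> where \<alpha>\<beta>: "pullback_rat (chart_change \<delta> 1 0) (form_of X) = (\<alpha>, \<beta>)" by fastforce
  obtain r p q where "r \<noteq> 0" "coprime p q" "\<alpha> = r * ratfun_of p" "\<beta> = r * ratfun_of q"
    using ratfun_pair_proportional nz unfolding \<alpha>\<beta> by metis
  then show thesis using that[of "(p, q)"] unfolding extended_form_def \<alpha>\<beta> by auto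
qed

lemma centre_at_0: "centre_at (0, 0) \<omega> = \<omega>"
  by (cases \<omega>) (simp add: centre_at_def pullback_def eval2_id)

text \<open>A point with X_0 = 0 and Y_1 = 0 lies in the chart U_10 only, where its coordinates are
  (0, 0).\<close>

lemma dicritical_point_iff:
  "dicritical_point \<delta> X (hirzebruch_point \<delta> (0, 1, 1, 0)) \<longleftrightarrow>
    (\<exists>\<omega>. extended_form \<delta> X 1 0 \<omega> \<and> dicritical \<omega>)"
proof
  assume "dicritical_point \<delta> X (hirzebruch_point \<delta> (0, 1, 1, 0))"
  then obtain q i j \<omega> where q: "q \<in> hirzebruch_point \<delta> (0, 1, 1, 0)" and ij: "i \<in> {0, 1}" "j \<in> {0, 1}"
    and chart': "in_chart i j q" and \<omega>': "extended_form \<delta> X i j \<omega>"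
      "dicritical (centre_at (chart_coords \<delta> i j q) \<omega>)"
    unfolding dicritical_point_def by blast
  obtain l m where "q = (0, l, m, 0)" using q by auto
  note chart = chart'[unfolded this] and \<omega> = \<omega>'[unfolded this]
  have "i = 1" "j = 0" using ij chart by auto
  then show "\<exists>\<omega>. extended_form \<delta> X 1 0 \<omega> \<and> dicritical \<omega>"
    using \<omega> by (intro exI[of _ \<omega>]) (simp add: centre_at_0)
next
  assume "\<exists>\<omega>. extended_form \<delta> X 1 0 \<omega> \<and> dicritical \<omega>"
  then obtain \<omega> where "extended_form \<delta> X 1 0 \<omega>" "dicritical \<omega>" by blast
  moreover have "(0, 1, 1, 0) \<in> hirzebruch_point \<delta> (0, 1, 1, 0)"
    by (auto intro!: exI[of _ 1])
  ultimately show "dicritical_point \<delta> X (hirzebruch_point \<delta> (0, 1, 1, 0))"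
    unfolding dicritical_point_def
    by (intro bexI[of _ "(0, 1, 1, 0)"] bexI[of _ 1] bexI[of _ 0] exI[of _ \<omega>]) (simp_all add: centre_at_0)
qed

lemma polyX_power_decomposition:
  assumes "p \<noteq> 0 \<or> q \<noteq> 0"
  obtains e p' q' where "p = polyX ^ e * p'" "q = polyX ^ e * q'" "\<not> (polyX dvd p' \<and> polyX dvd q')"
proof -
  obtain i j where ij: "coeff2 p i j \<noteq> 0 \<or> coeff2 q i j \<noteq> 0"
    using assms bpoly_eqI[of p 0] bpoly_eqI[of q 0] by auto
  define E where "E = {e. polyX ^ e dvd p \<and> polyX ^ e dvd q}"
  have bound: "e \<le> i" if "e \<in> E" for e
    using that ij unfolding E_def polyX_power_dvd_iff by (metis (mono_tags, lifting) mem_Collect_eq not_le)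
  have "0 \<in> E" by (simp add: E_def)
  then have fin: "finite E" "E \<noteq> {}" using bound by (auto simp: finite_nat_set_iff_bounded_le)
  have "Max E \<in> E" using Max_in[OF fin] .
  then obtain p' q' where pq: "p = polyX ^ Max E * p'" "q = polyX ^ Max E * q'"
    unfolding E_def by (auto elim!: dvdE)
  have "\<not> (polyX dvd p' \<and> polyX dvd q')"
  proof
    assume "polyX dvd p' \<and> polyX dvd q'"
    then have "polyX ^ Max E * polyX dvd p" "polyX ^ Max E * polyX dvd q"
      by (subst pq, intro mult_dvd_mono dvd_refl, blast)+
    then have "Suc (Max E) \<in> E" by (simp add: E_def mult.commute)
    then show False using Max_ge[OF fin(1)] by fastforce
  qed
  with pq show thesis by (rule that)
qed

lemma x_degree_exists2: "\<exists>N. x_degree_le N f \<and> x_degree_le N g"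
proof -
  obtain M N where "x_degree_le M f" "x_degree_le N g" using x_degree_exists by blast
  then have "x_degree_le (M + N) f" "x_degree_le (M + N) g" by (auto simp: x_degree_le_def)
  then show ?thesis by blast
qed

text \<open>The Bezout identity of f1 and f2 has its right-hand side in C[x]; in the chart this
  becomes a polynomial in s alone, i.e. a power of s times a unit. Thus s = 0 is the only possible
  common component near the origin, and \<open>ndvd\<close> excludes it.\<close>

lemma chart_locally_coprime:
  assumes "coprime f1 f2" and N: "x_degree_le N f1" "x_degree_le N f2"
    and F: "chart_poly N \<delta> f1 = polyX ^ e * F1" "chart_poly N \<delta> f2 = polyX ^ e * F2"
    and ndvd: "\<not> (polyX dvd F1 \<and> polyX dvd F2)"
  shows "locally_coprime F1 F2"
proof -
  obtain a b R where R: "R \<noteq> 0" "a * f1 + b * f2 = [:R:]" using coprime_bezout_const[OF assms(1)] .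
  obtain Ma Mb Mr where "x_degree_le Ma a" "x_degree_le Mb b" "x_degree_le Mr [:R:]"
    using x_degree_exists by blast
  then obtain M where M: "x_degree_le M a" "x_degree_le M b" "x_degree_le M [:R:]"
    using x_degree_le_mono[of _ _ "Ma + Mb + Mr"] by (metis le_add1 le_add2 le_trans)
  have R': "chart_hom \<delta> [:R:] = chart_hom \<delta> a * chart_hom \<delta> f1 + chart_hom \<delta> b * chart_hom \<delta> f2"
    by (simp flip: R(2))
  have "ratfun_of (polyX ^ N * chart_poly M \<delta> [:R:]) =
      ratfun_of (chart_poly M \<delta> a * chart_poly N \<delta> f1 + chart_poly M \<delta> b * chart_poly N \<delta> f2)"
    by (simp add: ratfun_of_chart_poly M N R') (simp add: algebra_simps)
  then have eq: "polyX ^ N * chart_poly M \<delta> [:R:] =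
      chart_poly M \<delta> a * chart_poly N \<delta> f1 + chart_poly M \<delta> b * chart_poly N \<delta> f2"
    by (simp only: ratfun_of_inj)
  have "chart_poly M \<delta> [:R:] \<noteq> 0" using chart_poly_eq_0[OF M(3)] R(1) by fastforce
  moreover have "degree (chart_poly M \<delta> [:R:]) \<le> 0"
    unfolding chart_poly_def by (intro degree_sum_le) (simp_all add: monom_0)
  then obtain C where C: "chart_poly M \<delta> [:R:] = [:C:]" by (auto elim: degree_eq_zeroE)
  ultimately have "C \<noteq> 0" by auto
  then obtain K s where s: "[:C:] = polyX ^ K * s" "at_origin s \<noteq> 0"
    by (rule const_poly_eq_power_times_unit)
  have "s * polyX ^ (N + K) = polyX ^ N * (polyX ^ K * s)" by (simp add: power_add mult_ac)
  also have "\<dots> = polyX ^ N * chart_poly M \<delta> [:R:]" by (simp only: C s(1))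
  also have "\<dots> = (chart_poly M \<delta> a * polyX ^ e) * F1 + (chart_poly M \<delta> b * polyX ^ e) * F2"
    unfolding eq F by (simp only: mult.assoc)
  finally have "local_ideal F1 F2 (polyX ^ (N + K))" by (rule local_idealI[OF s(2)])
  then show ?thesis
    using ndvd by (intro locally_coprimeI[of polyX polyY]) (simp_all add: coordinates_def)
qed

lemma chart_form_integral:
  assumes ext: "extended_form \<delta> X 1 0 (A1, A2)" and integral: "form_integral (snd X) (- fst X) f1 f2"
    and N: "x_degree_le N f1" "x_degree_le N f2"
    and F: "chart_poly N \<delta> f1 = polyX ^ e * F1" "chart_poly N \<delta> f2 = polyX ^ e * F2"
  shows "form_integral A1 A2 F1 F2"
proof -
  let ?x = "ratfun_of polyX"
  obtain r where r: "r \<noteq> 0" "pullback_rat (chart_change \<delta> 1 0) (snd X, - fst X) = (r * ratfun_of A1, r * ratfun_of A2)"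
    using ext unfolding extended_form_def form_of_def by auto
  \<comment> \<open>The factor by which f1 and f2, read in the chart, both differ from F1 and F2;
    only its square survives in the Wronskians.\<close>
  define w where "w = ?x ^ e / ?x ^ N"
  have x: "?x \<noteq> 0" by simp
  then have w: "w \<noteq> 0" by (simp add: w_def)
  have hom: "chart_hom \<delta> f1 = w * ratfun_of F1" "chart_hom \<delta> f2 = w * ratfun_of F2"
    using ratfun_of_chart_poly[OF N(1), of \<delta>] ratfun_of_chart_poly[OF N(2), of \<delta>] x
    unfolding F by (simp_all add: w_def field_simps)
  have change: "chart_change \<delta> 1 0 = (1 / ?x, ?x ^ \<delta> * ratfun_of polyY)"
    by (simp add: chart_change_def Let_def)
  have "r * ratfun_of A1 * (rat_dy (w * ratfun_of F1) * (w * ratfun_of F2) - w * ratfun_of F1 * rat_dy (w * ratfun_of F2)) =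
      r * ratfun_of A2 * (rat_dx (w * ratfun_of F1) * (w * ratfun_of F2) - w * ratfun_of F1 * rat_dx (w * ratfun_of F2))"
    by (rule pullback_wedge[OF rat_dx.derivation_axioms rat_dy.derivation_axioms const_ratfun.ring_hom_1_axioms
          _ _ integral r(2)[unfolded change]])
      (simp_all add: hom[symmetric] chart_hom_def)
  then have "(r * w\<^sup>2) * ratfun_of (A1 * (pdy F1 * F2 - F1 * pdy F2)) =
      (r * w\<^sup>2) * ratfun_of (A2 * (pdx F1 * F2 - F1 * pdx F2))"
    unfolding rat_dx.scaled_wronskian rat_dy.scaled_wronskian rat_dx_ratfun_of rat_dy_ratfun_of
    by (simp add: mult_ac)
  then show ?thesis
    using r(1) w by (simp only: mult_cancel_left ratfun_of_inj form_integral_def) simp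
qed

lemma chart_dicritical_iff:
  assumes X: "vector_field X" and integral: "form_integral (snd X) (- fst X) f1 f2"
    and coprime: "coprime f1 f2" and ind: "linearly_independent f1 f2"
    and N: "x_degree_le N f1" "x_degree_le N f2"
    and F: "chart_poly N \<delta> f1 = polyX ^ e * F1" "chart_poly N \<delta> f2 = polyX ^ e * F2"
    and ndvd: "\<not> (polyX dvd F1 \<and> polyX dvd F2)"
  shows "dicritical_point \<delta> X (hirzebruch_point \<delta> (0, 1, 1, 0)) \<longleftrightarrow> at_origin F1 = 0 \<and> at_origin F2 = 0"
proof -
  have dic: "dicritical \<omega> \<longleftrightarrow> at_origin F1 = 0 \<and> at_origin F2 = 0" if ext: "extended_form \<delta> X 1 0 \<omega>" for \<omega>
  proof -
    obtain A1 A2 where \<omega>: "\<omega> = (A1, A2)" by fastforce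
    have A: "locally_coprime A1 A2"
      using ext by (intro coprime_locally_coprime) (simp add: extended_form_def \<omega>)
    have int: "form_integral A1 A2 F1 F2" using chart_form_integral[OF ext[unfolded \<omega>] integral N F] .
    have "linearly_independent F1 F2"
      unfolding linearly_independent_def
    proof (intro allI impI)
      fix a b assume "const_bpoly a * F1 + const_bpoly b * F2 = 0"
      then have "polyX ^ e * (const_bpoly a * F1 + const_bpoly b * F2) = 0" by simp
      then have "const_bpoly a * chart_poly N \<delta> f1 + const_bpoly b * chart_poly N \<delta> f2 = 0"
        unfolding F by (simp only: distrib_left mult_ac)
      moreover have "const_bpoly a * chart_poly N \<delta> f1 + const_bpoly b * chart_poly N \<delta> f2 =
          chart_poly N \<delta> (const_bpoly a * f1 + const_bpoly b * f2)"
      proof (rule bpoly_eqI)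
        have "x_degree_le N (const_bpoly a * f1 + const_bpoly b * f2)" using N by (simp add: x_degree_le_def)
        then show "coeff2 (const_bpoly a * chart_poly N \<delta> f1 + const_bpoly b * chart_poly N \<delta> f2) i j =
            coeff2 (chart_poly N \<delta> (const_bpoly a * f1 + const_bpoly b * f2)) i j" for i j
          by (simp add: coeff2_chart_poly N)
      qed
      ultimately have "chart_poly N \<delta> (const_bpoly a * f1 + const_bpoly b * f2) = 0" by simp
      moreover have "x_degree_le N (const_bpoly a * f1 + const_bpoly b * f2)" using N by (simp add: x_degree_le_def)
      ultimately have "const_bpoly a * f1 + const_bpoly b * f2 = 0" by (rule chart_poly_eq_0[rotated])
      then show "a = 0 \<and> b = 0" using ind by (simp add: linearly_independent_def)
    qed
    then show ?thesis
      unfolding \<omega>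
      using base_point_dicritical[OF int A chart_locally_coprime[OF coprime N F ndvd]]
        not_base_point_not_dicritical[OF int A] by blast
  qed
  then show ?thesis
    unfolding dicritical_point_iff using extended_form_exists[OF X] by blast
qed

definition support :: "bpoly \<Rightarrow> bpoly \<Rightarrow> (nat \<times> nat) set" where
  "support f1 f2 = {(i, j). coeff2 f1 i j \<noteq> 0 \<or> coeff2 f2 i j \<noteq> 0}"

lemma support_iff: "(i, j) \<in> support f1 f2 \<longleftrightarrow> coeff2 f1 i j \<noteq> 0 \<or> coeff2 f2 i j \<noteq> 0"
  by (simp add: support_def)

lemma x_degree_leD: "x_degree_le N f \<Longrightarrow> coeff2 f i j \<noteq> 0 \<Longrightarrow> i \<le> N"
  unfolding x_degree_le_def by (rule ccontr) simp

lemma not_polyX_dvd_of_origin: "at_origin F \<noteq> 0 \<Longrightarrow> \<not> polyX dvd F"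
  using not_dvd_power_times_unit[of polyX polyY F 0] by (simp add: coordinates_def)

text \<open>
  For large \<open>\<delta>\<close> the exponents \<open>\<delta> j - i\<close> of the first coordinate are minimal on the row \<open>j = 0\<close>, so the
  pencil has no base point; this makes the minimum in the definition of \<open>\<delta>\<^sub>1\<close> exist.
\<close>

lemma delta1_not_dicritical:
  assumes X: "vector_field X" and integral: "form_integral (snd X) (- fst X) f1 f2"
    and coprime: "coprime f1 f2" and ind: "linearly_independent f1 f2"
  shows "\<not> dicritical_point (delta1 X) X (hirzebruch_point (delta1 X) (0, 1, 1, 0))"
proof -
  have ex: "\<exists>\<delta>. \<not> dicritical_point \<delta> X (hirzebruch_point \<delta> (0, 1, 1, 0))"
  proof -
    obtain N where N: "x_degree_le N f1" "x_degree_le N f2" using x_degree_exists2 by blast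
    have "\<not> (polyY dvd f1 \<and> polyY dvd f2)"
      using locally_coprimeD(2)[OF coprime_locally_coprime[OF coprime], of polyY polyX]
      by (simp add: coordinates_def)
    then have "\<not> (polyY ^ 1 dvd f1 \<and> polyY ^ 1 dvd f2)" by simp
    \<comment> \<open>By coprimality y does not divide both polynomials, so the row j = 0 of the
      support is not empty.\<close>
    then have ne: "{i. (i, 0) \<in> support f1 f2} \<noteq> {}"
      unfolding polyY_power_dvd_iff by (auto simp: support_iff)
    have le_N: "i \<le> N" if "(i, j) \<in> support f1 f2" for i j
      using that x_degree_leD[OF N(1)] x_degree_leD[OF N(2)] unfolding support_iff by blast
    then have "{i. (i, 0) \<in> support f1 f2} \<subseteq> {..N}" by blast
    then have fin: "finite {i. (i, 0) \<in> support f1 f2}" by (rule finite_subset) simp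
    define d where "d = Max {i. (i, 0) \<in> support f1 f2}"
    have d: "(d, 0) \<in> support f1 f2" using Max_in[OF fin ne] unfolding d_def by (rule CollectD)
    have max: "i \<le> d" if "(i, 0) \<in> support f1 f2" for i
      unfolding d_def by (rule Max_ge[OF fin]) (simp add: that)
    have "d \<le> N" using le_N[OF d] .
    \<comment> \<open>This is where \<delta> = N is large enough: above the row j = 0 one has i
      \<le> N \<le> N j.\<close>
    have le: "i \<le> d + N * j" if "(i, j) \<in> support f1 f2" for i j
    proof (cases "j = 0")
      case True
      then show ?thesis using that max by simp
    next
      case False
      have "i \<le> N" using le_N[OF that] .
      also have "N \<le> N * j" using False by simp
      finally show ?thesis by simp
    qed
    \<comment> \<open>N - d is the exponent of s that x^d receives, the smallest on the support by
      \<open>le\<close>.\<close>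
    have dvd: "polyX ^ (N - d) dvd chart_poly N N f" if f: "f = f1 \<or> f = f2" for f
      unfolding polyX_power_dvd_iff
    proof (intro allI impI)
      fix a b assume a: "a < N - d"
      have "x_degree_le N f" using f N by auto
      moreover have "coeff2 f (N + N * b - a) b = 0"
      proof (rule ccontr)
        assume "coeff2 f (N + N * b - a) b \<noteq> 0"
        then have "(N + N * b - a, b) \<in> support f1 f2" using f by (auto simp: support_iff)
        then have "N + N * b - a \<le> d + N * b" by (rule le)
        then show False using a by linarith
      qed
      ultimately show "coeff2 (chart_poly N N f) a b = 0" by (simp add: coeff2_chart_poly)
    qed
    obtain F1 where F1: "chart_poly N N f1 = polyX ^ (N - d) * F1"
      using dvd[OF disjI1[OF refl]] by (rule dvdE)
    obtain F2 where F2: "chart_poly N N f2 = polyX ^ (N - d) * F2"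
      using dvd[OF disjI2[OF refl]] by (rule dvdE)
    note F = F1 F2
    have "at_origin F = coeff2 f d 0"
      if "chart_poly N N f = polyX ^ (N - d) * F" "x_degree_le N f" for F f
    proof -
      have "at_origin F = coeff2 (polyX ^ (N - d) * F) (N - d) 0"
        by (simp add: coeff2_mult_X_power at_origin_coeff2)
      also have "\<dots> = coeff2 f d 0"
        unfolding that(1)[symmetric] coeff2_chart_poly[OF that(2)] using \<open>d \<le> N\<close> by simp
      finally show ?thesis .
    qed
    then have nz: "at_origin F1 \<noteq> 0 \<or> at_origin F2 \<noteq> 0"
      using F N d by (auto simp: support_iff)
    then have "\<not> (polyX dvd F1 \<and> polyX dvd F2)" using not_polyX_dvd_of_origin by blast
    from chart_dicritical_iff[OF X integral coprime ind N F this] nz show ?thesis by blast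
  qed
  then show ?thesis unfolding delta1_def by (rule LeastI_ex)
qed

lemma support_bound:
  assumes X: "vector_field X" and integral: "form_integral (snd X) (- fst X) f1 f2"
    and coprime: "coprime f1 f2" and ind: "linearly_independent f1 f2"
    and ij: "(i, j) \<in> support f1 f2"
  obtains i0 where "(i0, 0) \<in> support f1 f2" "i \<le> i0 + delta1 X * j"
proof -
  define \<delta> where "\<delta> = delta1 X"
  obtain N where N: "x_degree_le N f1" "x_degree_le N f2" using x_degree_exists2 by blast
  have "f1 \<noteq> 0 \<or> f2 \<noteq> 0" using coprime by auto
  then have "chart_poly N \<delta> f1 \<noteq> 0 \<or> chart_poly N \<delta> f2 \<noteq> 0" using chart_poly_eq_0 N by blast
  then obtain e F1 F2 where F: "chart_poly N \<delta> f1 = polyX ^ e * F1" "chart_poly N \<delta> f2 = polyX ^ e * F2"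
    and ndvd: "\<not> (polyX dvd F1 \<and> polyX dvd F2)"
    by (rule polyX_power_decomposition)
  have "at_origin F1 \<noteq> 0 \<or> at_origin F2 \<noteq> 0"
    using chart_dicritical_iff[OF X integral coprime ind N F ndvd]
      delta1_not_dicritical[OF X integral coprime ind] by (auto simp: \<delta>_def)
  \<comment> \<open>The value of G at the origin is the coefficient of s^e in the row j = 0, which
    stems from the monomial x^(N - e). Hence i0 will be N - e.\<close>
  moreover have origin: "at_origin G = (if e \<le> N then coeff2 f (N - e) 0 else 0)"
    if "chart_poly N \<delta> f = polyX ^ e * G" "x_degree_le N f" for G f
  proof -
    have "at_origin G = coeff2 (polyX ^ e * G) e 0"
      by (simp add: coeff2_mult_X_power at_origin_coeff2)
    then show ?thesis unfolding that(1)[symmetric] coeff2_chart_poly[OF that(2)] by simp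
  qed
  ultimately have e: "e \<le> N" "(N - e, 0) \<in> support f1 f2"
    using F N by (auto simp: support_def split: if_splits)
  have "i \<le> (N - e) + \<delta> * j"
  proof (rule ccontr)
    \<comment> \<open>The monomial x^i y^j would contribute the exponent N + \<delta> j - i of s,
      which is then below the common power e.\<close>
    assume i: "\<not> i \<le> (N - e) + \<delta> * j"
    obtain f G where f: "coeff2 f i j \<noteq> 0" "x_degree_le N f" "chart_poly N \<delta> f = polyX ^ e * G"
    proof (cases "coeff2 f1 i j = 0")
      case True
      then show ?thesis using that[of f2 F2] ij N F by (simp add: support_iff)
    next
      case False
      then show ?thesis using that[of f1 F1] N F by simp
    qed
    have "i \<le> N" using x_degree_leD[OF f(2,1)] .
    then have "coeff2 (chart_poly N \<delta> f) (N + \<delta> * j - i) j = coeff2 f i j"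
      unfolding coeff2_chart_poly[OF f(2)] by simp
    moreover have "coeff2 (chart_poly N \<delta> f) (N + \<delta> * j - i) j = 0"
    proof -
      have "N + \<delta> * j - i < e" using i e(1) \<open>i \<le> N\<close> by linarith
      then show ?thesis unfolding f(3) coeff2_mult_X_power by simp
    qed
    ultimately show False using f(1) by simp
  qed
  then show thesis using that e(2) by (simp add: \<delta>_def)
qed

section \<open>Swapping the variables\<close>

interpretation swap_vars: ring_hom_1 swap_vars
  unfolding swap_vars_def by unfold_locales

lemma swap_vars_gen [simp]:
  "swap_vars (const_bpoly c) = const_bpoly c" "swap_vars polyX = polyY" "swap_vars polyY = polyX"
  by (simp_all add: swap_vars_def)

lemma coeff2_swap_vars: "coeff2 (swap_vars p) i j = coeff2 p j i"
proof (induction p arbitrary: i j rule: bpoly_linear_induct)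
  case (const c)
  show ?case by (simp only: swap_vars_gen coeff2_const conj_commute)
next
  case (add p q)
  then show ?case by (simp only: swap_vars.add coeff_add)
next
  case (multX p)
  then show ?case by (simp only: swap_vars.mult swap_vars_gen coeff2_mult_X coeff2_mult_Y)
next
  case (multY p)
  then show ?case by (simp only: swap_vars.mult swap_vars_gen coeff2_mult_X coeff2_mult_Y)
qed

lemma swap_vars_swap_vars [simp]: "swap_vars (swap_vars p) = p"
  by (rule bpoly_eqI) (simp add: coeff2_swap_vars)

lemma pdx_swap_vars: "pdx (swap_vars p) = swap_vars (pdy p)"
  and pdy_swap_vars: "pdy (swap_vars p) = swap_vars (pdx p)"
  by (auto intro!: bpoly_eqI simp: coeff2_swap_vars coeff2_pdx coeff2_pdy)

lemma swap_vars_dvd: "p dvd q \<Longrightarrow> swap_vars p dvd swap_vars q"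
proof (elim dvdE)
  fix k assume "q = p * k"
  then have "swap_vars q = swap_vars p * swap_vars k" by simp
  then show "swap_vars p dvd swap_vars q" by (rule dvdI)
qed

lemma coprime_swap_vars:
  assumes "coprime p q"
  shows "coprime (swap_vars p) (swap_vars q)"
proof (rule coprimeI)
  fix d assume "d dvd swap_vars p" "d dvd swap_vars q"
  then have "swap_vars d dvd p" "swap_vars d dvd q"
    using swap_vars_dvd[of d "swap_vars p"] swap_vars_dvd[of d "swap_vars q"] by simp_all
  then have "is_unit (swap_vars d)" using coprime_common_divisor[OF assms] by blast
  then show "is_unit d" using swap_vars_dvd[of "swap_vars d" 1] by simp
qed

lemma support_swap_vars: "(i, j) \<in> support (swap_vars f1) (swap_vars f2) \<longleftrightarrow> (j, i) \<in> support f1 f2"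
  by (simp add: support_def coeff2_swap_vars)

text \<open>Swapping exchanges the partial derivatives and thus, up to sign, the two sides of
  \<open>form_integral\<close>; so \<open>support_bound\<close> applies to the swapped field and
  bounds the other exponent.\<close>

lemma support_bound_swap:
  assumes X: "vector_field X" and integral: "form_integral (snd X) (- fst X) f1 f2"
    and coprime: "coprime f1 f2" and ind: "linearly_independent f1 f2"
    and ij: "(i, j) \<in> support f1 f2"
  obtains j0 where "(0, j0) \<in> support f1 f2" "j \<le> j0 + delta1 (swap_field X) * i"
proof -
  have X': "vector_field (swap_field X)"
    using coprime_swap_vars[of "snd X" "fst X"] X
    by (simp add: vector_field_def swap_field_def coprime_commute)
  have "swap_vars (snd X * (pdy f1 * f2 - f1 * pdy f2)) = swap_vars (- fst X * (pdx f1 * f2 - f1 * pdx f2))"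
    using integral by (simp add: form_integral_def)
  then have "- (swap_vars (snd X) * (pdx (swap_vars f1) * swap_vars f2 - swap_vars f1 * pdx (swap_vars f2))) =
      swap_vars (fst X) * (pdy (swap_vars f1) * swap_vars f2 - swap_vars f1 * pdy (swap_vars f2))"
    by (simp add: pdx_swap_vars pdy_swap_vars)
  then have integral': "form_integral (snd (swap_field X)) (- fst (swap_field X)) (swap_vars f1) (swap_vars f2)"
    by (simp add: form_integral_def swap_field_def)
  have "linearly_independent (swap_vars f1) (swap_vars f2)"
    unfolding linearly_independent_def
  proof (intro allI impI)
    fix a b assume "const_bpoly a * swap_vars f1 + const_bpoly b * swap_vars f2 = 0"
    then have "swap_vars (const_bpoly a * swap_vars f1 + const_bpoly b * swap_vars f2) = 0" by simp
    then show "a = 0 \<and> b = 0" using ind by (simp add: linearly_independent_def)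
  qed
  from support_bound[OF X' integral' coprime_swap_vars[OF coprime] this, of j i] show thesis
    using ij that by (auto simp: support_swap_vars)
qed

section \<open>The Newton polytope\<close>

lemma first_integral_form_integral:
  assumes "rational_first_integral X (Fract f1 f2)" "f2 \<noteq> 0"
  shows "form_integral (snd X) (- fst X) f1 f2"
proof -
  define A where "A = pdx f1 * f2 - f1 * pdx f2"
  define B where "B = pdy f1 * f2 - f1 * pdy f2"
  have "ratfun_of (fst X) * Fract A (f2\<^sup>2) + ratfun_of (snd X) * Fract B (f2\<^sup>2) = 0"
    using assms by (simp add: rational_first_integral_def rat_dx_Fract rat_dy_Fract A_def B_def)
  moreover have "Fract h (f2\<^sup>2) = ratfun_of h / ratfun_of (f2\<^sup>2)" for h
    using assms(2) by (intro Fract_conv) simp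
  ultimately have "ratfun_of (fst X * A + snd X * B) / ratfun_of (f2\<^sup>2) = 0"
    by (simp add: add_divide_distrib del: ratfun_of.power)
  then have "fst X * A + snd X * B = 0"
    using assms(2) by (simp del: ratfun_of.add ratfun_of.mult)
  then show ?thesis by (simp add: form_integral_def A_def B_def eq_neg_iff_add_eq_0 add.commute)
qed

lemma nonconstant_linearly_independent:
  assumes "nonconstant (Fract f1 f2)" "f2 \<noteq> 0"
  shows "linearly_independent f1 f2"
  unfolding linearly_independent_def
proof (intro allI impI)
  fix a b assume 0: "const_bpoly a * f1 + const_bpoly b * f2 = 0"
  have "a = 0"
  proof (rule ccontr)
    assume "a \<noteq> 0"
    have "const_bpoly (1 / a) * (const_bpoly a * f1 + const_bpoly b * f2) = f1 + const_bpoly (b / a) * f2"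
      using \<open>a \<noteq> 0\<close> by (simp add: distrib_left flip: mult.assoc const_bpoly.mult) 
    then have "f1 = const_bpoly (- (b / a)) * f2" using 0 by (simp add: eq_neg_iff_add_eq_0)
    then have "Fract f1 f2 = const_ratfun (- (b / a))"
      using assms(2) by (simp add: const_ratfun_def ratfun_of_def eq_fract)
    then have "Fract f1 f2 \<in> range const_ratfun" by (simp only: rangeI)
    then show False using assms(1) by (simp add: nonconstant_def)
  qed
  moreover have "b = 0" using 0 assms(2) \<open>a = 0\<close> by (simp add: const_bpoly_def)
  ultimately show "a = 0 \<and> b = 0" ..
qed

text \<open>A coefficient \<alpha> c + \<beta> d with complex c and d vanishes only for c = d = 0,
  by the independence of \<alpha> and \<beta>; so nothing cancels.\<close>

lemma coeff_generic_curve: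
  "coeff (coeff (generic_curve f1 f2) j) i \<noteq> 0 \<longleftrightarrow> (i, j) \<in> support f1 f2"
proof -
  have eq: "coeff (coeff (generic_curve f1 f2) j) i =
      ratfun_of (polyX * const_bpoly (coeff2 f1 i j) + polyY * const_bpoly (coeff2 f2 i j))"
    by (simp add: generic_curve_def coeff_map_poly const_ratfun_def)
  have iff: "polyX * const_bpoly c + polyY * const_bpoly d = 0 \<longleftrightarrow> c = 0 \<and> d = 0" for c d
  proof
    assume 0: "polyX * const_bpoly c + polyY * const_bpoly d = 0"
    have "coeff2 (polyX * const_bpoly c + polyY * const_bpoly d) 1 0 = c"
      "coeff2 (polyX * const_bpoly c + polyY * const_bpoly d) 0 1 = d"
      by (simp_all add: coeff2_mult_X coeff2_mult_Y coeff2_const)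
    then show "c = 0 \<and> d = 0" unfolding 0 by simp
  qed simp
  show ?thesis unfolding eq ratfun_of_eq_0_iff iff support_iff by blast
qed

lemma convex_halfplane_pair:
  "convex {(u :: real, v). 0 \<le> u \<and> 0 \<le> v \<and> u \<le> d + \<delta> * v \<and> v \<le> d' + \<delta>' * u}"
proof (rule convexI)
  have ineq: "a * u + b * u' \<le> d + \<delta> * (a * v + b * v')"
    if "0 \<le> a" "0 \<le> b" "a + b = 1" "u \<le> d + \<delta> * v" "u' \<le> d + \<delta> * v'" for a b u u' v v' d \<delta> :: real
  proof -
    have "a * u + b * u' \<le> a * (d + \<delta> * v) + b * (d + \<delta> * v')"
      using that by (intro add_mono mult_left_mono)
    also have "\<dots> = (a + b) * d + \<delta> * (a * v + b * v')" by (simp add: algebra_simps)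
    finally show ?thesis using that by simp
  qed
  fix x y :: "real \<times> real" and a b :: real
  assume "x \<in> {(u, v). 0 \<le> u \<and> 0 \<le> v \<and> u \<le> d + \<delta> * v \<and> v \<le> d' + \<delta>' * u}"
    "y \<in> {(u, v). 0 \<le> u \<and> 0 \<le> v \<and> u \<le> d + \<delta> * v \<and> v \<le> d' + \<delta>' * u}" "0 \<le> a" "0 \<le> b" "a + b = 1"
  then show "a *\<^sub>R x + b *\<^sub>R y \<in> {(u, v). 0 \<le> u \<and> 0 \<le> v \<and> u \<le> d + \<delta> * v \<and> v \<le> d' + \<delta>' * u}"
    by (cases x, cases y) (auto intro: ineq)
qed

theorem theorem5p2:
  fixes X :: vfield and f1 f2 :: bpoly and g :: "ratfun poly poly"
  assumes "vector_field X"
    and "algebraically_integrable X"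
    and "\<And>c. c \<noteq> 0 \<Longrightarrow> X \<noteq> (0, const_bpoly c)"
    and "\<And>c. c \<noteq> 0 \<Longrightarrow> X \<noteq> (const_bpoly c, 0)"
    and "primitive_first_integral X f1 f2"
    and "g = generic_curve f1 f2"
  shows "newton_polytope g \<subseteq>
    {(u, v). 0 \<le> u \<and> 0 \<le> v \<and>
       u \<le> real (deg_x0 g) + real (delta1 X) * v \<and>
       v \<le> real (deg_y0 g) + real (delta1 (swap_field X)) * u}"
proof -
  have f: "f2 \<noteq> 0" "coprime f1 f2" "rational_first_integral X (Fract f1 f2)"
    using assms(5) by (auto simp: primitive_first_integral_def)
  note hyps = assms(1) first_integral_form_integral[OF f(3,1)] f(2)
    nonconstant_linearly_independent[OF _ f(1)]
  have ind: "nonconstant (Fract f1 f2)" using f(3) by (simp add: rational_first_integral_def)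
  \<comment> \<open>The region is convex, so it is enough to place the exponents themselves.\<close>
  have bound: "i \<le> deg_x0 g + delta1 X * j \<and> j \<le> deg_y0 g + delta1 (swap_field X) * i"
    if ij: "coeff (coeff g j) i \<noteq> 0" for i j
  proof
    have ij: "(i, j) \<in> support f1 f2" using that by (simp only: assms(6) coeff_generic_curve)
    obtain i0 where i0: "(i0, 0) \<in> support f1 f2" "i \<le> i0 + delta1 X * j"
      using support_bound[OF hyps(1-3) hyps(4)[OF ind] ij] .
    have "coeff (poly g 0) i0 \<noteq> 0"
      using i0(1) unfolding poly_0_coeff_0 by (simp only: assms(6) coeff_generic_curve)
    then show "i \<le> deg_x0 g + delta1 X * j"
      using i0(2) le_degree unfolding deg_x0_def by fastforce
    obtain j0 where j0: "(0, j0) \<in> support f1 f2" "j \<le> j0 + delta1 (swap_field X) * i"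
      using support_bound_swap[OF hyps(1-3) hyps(4)[OF ind] ij] .
    have "coeff (map_poly (\<lambda>q. poly q 0) g) j0 \<noteq> 0"
      using j0(1) by (simp add: coeff_map_poly poly_0_coeff_0 assms(6) coeff_generic_curve)
    then show "j \<le> deg_y0 g + delta1 (swap_field X) * i"
      using j0(2) le_degree unfolding deg_y0_def by fastforce
  qed
  show ?thesis
    unfolding newton_polytope_def
  proof (rule hull_minimal)
    show "{(real i, real j) |i j. coeff (coeff g j) i \<noteq> 0} \<subseteq>
      {(u, v). 0 \<le> u \<and> 0 \<le> v \<and> u \<le> real (deg_x0 g) + real (delta1 X) * v \<and>
         v \<le> real (deg_y0 g) + real (delta1 (swap_field X)) * u}"
    proof clarify
      fix i j assume "coeff (coeff g j) i \<noteq> 0"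
      then have "i \<le> deg_x0 g + delta1 X * j" "j \<le> deg_y0 g + delta1 (swap_field X) * i" using bound by auto
      then show "0 \<le> real i \<and> 0 \<le> real j \<and> real i \<le> real (deg_x0 g) + real (delta1 X) * real j \<and>
          real j \<le> real (deg_y0 g) + real (delta1 (swap_field X)) * real i"
        by (simp flip: of_nat_add of_nat_mult)
    qed
  qed (rule convex_halfplane_pair)
qed

end
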